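(* Let $q$ be a prime power (of any characteristic), let $SE_6(q)$ be the group of $\mathbb{F}_q$-linear maps of the $27$-dimensional space $\mathbb{J}=\mathbb{J}_{\mathbb{F}_q}$ which preserve the cubic form $\det$ (the Dickson--Freudenthal determinant), and let $F_4(q)$ be the subgroup of $SE_6(q)$ consisting of those maps which fix the identity matrix $(1,1,1\mid 0,0,0)\in\mathbb{J}$. Then $$|F_4(q)|=q^{24}(q^{12}-1)(q^8-1)(q^6-1)(q^2-1).$$
   Context: Split octonions. For a field $F$, the split octonion algebra $\mathbb{O}=\mathbb{O}_F$ is the $8$-dimensional $F$-vector space with basis $\{e_i : i\in\pm I\}$, where $I=\{0,1,\omega,\bar\omega\}$ and $\pm I=\{\pm0,\pm1,\pm\omega,\pm\bar\omega\}$ ($8$ distinct labels, $0$ and $-0$ being different), with bilinear multiplication given by (1) $e_1e_\omega=-e_\omega e_1=e_{-\bar\omega}$; (2) $e_1e_0=e_{-0}e_1=e_1$; (3) $e_{-1}e_1=-e_0$ and $e_0e_0=e_0$; together with all the images of these rules under negating all subscripts (including $0\leftrightarrow -0$) and under multiplying all subscripts by $\omega$ (that is $1\mapsto\omega\mapsto\bar\omega\mapsto1$, $-1\mapsto-\omega\mapsto-\bar\omega\mapsto-1$, fixing $0$ and $-0$). All other products of basis vectors are $0$. The identity is $1=e_0+e_{-0}$, and $F$ is identified with $F\cdot 1$. The conjugation $x\mapsto\overline{x}$ is the linear map $e_0\leftrightarrow e_{-0}$, $e_i\mapsto -e_i$ for $i\ne\pm0$; it is an anti-automorphism. The trace is $\mathrm{Tr}(\sum\lambda_ie_i)=\lambda_0+\lambda_{-0}$,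 so $\mathrm{Tr}(x)=x+\overline{x}$, and $x\overline{x}=\sum_{i\in I}\lambda_i\lambda_{-i}\in F$ for $x=\sum\lambda_ie_i$. One has $\mathrm{Tr}(x(yz))=\mathrm{Tr}((xy)z)$, written $\mathrm{Tr}(xyz)$. The space $\mathbb{J}=\mathbb{J}_F$ is the $27$-dimensional $F$-space of Hermitian matrices $(a,b,c\mid A,B,C)=\begin{pmatrix}a&C&\overline{B}\\ \overline{C}&b&A\\ B&\overline{A}&c\end{pmatrix}$ with $a,b,c\in F$ and $A,B,C\in\mathbb{O}_F$. The Dickson--Freudenthal determinant is the cubic form (homogeneous polynomial of degree $3$ in the $27$ coordinates) $\det(a,b,c\mid A,B,C)=abc-aA\overline{A}-bB\overline{B}-cC\overline{C}+\mathrm{Tr}(ABC)$. A linear map preserves $\det$ if it preserves it as a cubic form (polynomial). *)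

theory Defs
  imports
    "HOL-Analysis.Cartesian_Space"
    "HOL-Algebra.Coset"
    "HOL-Library.Poly_Mapping"
    "HOL-Number_Theory.Prime_Powers"
begin

section \<open>Split octonions\<close>

datatype idx = I0 | I1 | I\<omega> | I\<omega>'

datatype label = Pos idx | Neg idx

lemma UNIV_idx: "(UNIV :: idx set) = {I0, I1, I\<omega>, I\<omega>'}"
  using idx.exhaust by auto

lemma UNIV_label: "(UNIV :: label set) =
  {Pos I0, Neg I0, Pos I1, Neg I1, Pos I\<omega>, Neg I\<omega>, Pos I\<omega>', Neg I\<omega>'}"
proof -
  have "x \<in> Pos ` UNIV \<union> Neg ` UNIV" for x
    by (cases x) auto
  then show ?thesis
    by (auto simp: UNIV_idx)
qed

instance idx :: finite
  by standard (simp add: UNIV_idx)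

instance label :: finite
  by standard (simp add: UNIV_label)

fun neg_label :: "label \<Rightarrow> label" where
  "neg_label (Pos i) = Neg i"
| "neg_label (Neg i) = Pos i"

fun rot_idx :: "idx \<Rightarrow> idx" where
  "rot_idx I0 = I0"
| "rot_idx I1 = I\<omega>"
| "rot_idx I\<omega> = I\<omega>'"
| "rot_idx I\<omega>' = I1"

fun rot_label :: "label \<Rightarrow> label" where
  "rot_label (Pos i) = Pos (rot_idx i)"
| "rot_label (Neg i) = Neg (rot_idx i)"

text \<open>
  \<open>oct_rule i j s k\<close> stands for \<open>e\<^sub>i e\<^sub>j = s e\<^sub>k\<close>, with \<open>s = 1\<close> or \<open>s = -1\<close>.
  The label \<open>I\<omega>'\<close> is the conjugate of \<open>\<omega>\<close>.
\<close>

inductive oct_rule :: "label \<Rightarrow> label \<Rightarrow> int \<Rightarrow> label \<Rightarrow> bool" where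
  "oct_rule (Pos I1) (Pos I\<omega>) 1 (Neg I\<omega>')"
| "oct_rule (Pos I\<omega>) (Pos I1) (-1) (Neg I\<omega>')"
| "oct_rule (Pos I1) (Pos I0) 1 (Pos I1)"
| "oct_rule (Neg I0) (Pos I1) 1 (Pos I1)"
| "oct_rule (Neg I1) (Pos I1) (-1) (Pos I0)"
| "oct_rule (Pos I0) (Pos I0) 1 (Pos I0)"
| "oct_rule i j s k \<Longrightarrow> oct_rule (neg_label i) (neg_label j) s (neg_label k)"
| "oct_rule i j s k \<Longrightarrow> oct_rule (rot_label i) (rot_label j) s (rot_label k)"

definition oct_coeff :: "label \<Rightarrow> label \<Rightarrow> label \<Rightarrow> int" where
  "oct_coeff i j k =
    (if oct_rule i j 1 k then 1 else if oct_rule i j (-1) k then -1 else 0)"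

text \<open>
  Octonions are taken over an arbitrary commutative ring, because the cubic form below is
  evaluated over a polynomial ring. The type \<open>'a ^ label\<close> already carries a
  componentwise product, which is unrelated to the octonion product.
\<close>

type_synonym 'a oct = "'a ^ label"

definition oct_mult :: "'a::comm_ring_1 oct \<Rightarrow> 'a oct \<Rightarrow> 'a oct" (infixl "\<odot>" 70) where
  "x \<odot> y = (\<chi> k. \<Sum>i\<in>UNIV. \<Sum>j\<in>UNIV. of_int (oct_coeff i j k) * (x $ i) * (y $ j))"

definition oct_one :: "'a::comm_ring_1 oct" where
  "oct_one = axis (Pos I0) 1 + axis (Neg I0) 1"

definition oct_cnj :: "'a::comm_ring_1 oct \<Rightarrow> 'a oct" where
  "oct_cnj x =
    (\<chi> k. if k = Pos I0 \<or> k = Neg I0 then x $ neg_label k else - (x $ k))"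

definition oct_trace :: "'a::comm_ring_1 oct \<Rightarrow> 'a" where
  "oct_trace x = x $ Pos I0 + x $ Neg I0"

definition oct_norm :: "'a::comm_ring_1 oct \<Rightarrow> 'a" where
  "oct_norm x = (\<Sum>i\<in>UNIV. x $ Pos i * x $ Neg i)"

text \<open>The multiplication table of the 32 nonzero products, used only to prove that
  \<open>oct_norm x\<close> is the scalar \<open>x * cnj x\<close>.\<close>

definition oct_table :: "(label \<times> label \<times> int \<times> label) set" where
  "oct_table =
  {(Pos I0, Pos I0, 1, Pos I0),
   (Pos I0, Neg I1, 1, Neg I1),
   (Pos I0, Neg I\<omega>, 1, Neg I\<omega>),
   (Pos I0, Neg I\<omega>', 1, Neg I\<omega>'),
   (Pos I1, Pos I0, 1, Pos I1),
   (Pos I1, Pos I\<omega>, 1, Neg I\<omega>'),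
   (Pos I1, Pos I\<omega>', -1, Neg I\<omega>),
   (Pos I1, Neg I1, -1, Neg I0),
   (Pos I\<omega>, Pos I0, 1, Pos I\<omega>),
   (Pos I\<omega>, Pos I1, -1, Neg I\<omega>'),
   (Pos I\<omega>, Pos I\<omega>', 1, Neg I1),
   (Pos I\<omega>, Neg I\<omega>, -1, Neg I0),
   (Pos I\<omega>', Pos I0, 1, Pos I\<omega>'),
   (Pos I\<omega>', Pos I1, 1, Neg I\<omega>),
   (Pos I\<omega>', Pos I\<omega>, -1, Neg I1),
   (Pos I\<omega>', Neg I\<omega>', -1, Neg I0),
   (Neg I0, Pos I1, 1, Pos I1),
   (Neg I0, Pos I\<omega>, 1, Pos I\<omega>),
   (Neg I0, Pos I\<omega>', 1, Pos I\<omega>'),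
   (Neg I0, Neg I0, 1, Neg I0),
   (Neg I1, Pos I1, -1, Pos I0),
   (Neg I1, Neg I0, 1, Neg I1),
   (Neg I1, Neg I\<omega>, 1, Pos I\<omega>'),
   (Neg I1, Neg I\<omega>', -1, Pos I\<omega>),
   (Neg I\<omega>, Pos I\<omega>, -1, Pos I0),
   (Neg I\<omega>, Neg I0, 1, Neg I\<omega>),
   (Neg I\<omega>, Neg I1, -1, Pos I\<omega>'),
   (Neg I\<omega>, Neg I\<omega>', 1, Pos I1),
   (Neg I\<omega>', Pos I\<omega>', -1, Pos I0),
   (Neg I\<omega>', Neg I0, 1, Neg I\<omega>'),
   (Neg I\<omega>', Neg I1, 1, Pos I\<omega>),
   (Neg I\<omega>', Neg I\<omega>, -1, Pos I1)}"


lemma oct_rule_imp_table: "oct_rule i j s k \<Longrightarrow> (i, j, s, k) \<in> oct_table"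
proof (induction rule: oct_rule.induct)
  case (7 i j s k)
  have "\<forall>(i,j,s,k)\<in>oct_table. (neg_label i, neg_label j, s, neg_label k) \<in> oct_table"
    unfolding oct_table_def by simp
  with 7 show ?case by blast
next
  case (8 i j s k)
  have "\<forall>(i,j,s,k)\<in>oct_table. (rot_label i, rot_label j, s, rot_label k) \<in> oct_table"
    unfolding oct_table_def by simp
  with 8 show ?case by blast
qed (simp_all add: oct_table_def)

lemma table_imp_oct_rule: "(i, j, s, k) \<in> oct_table \<Longrightarrow> oct_rule i j s k"
proof -
  have A: "oct_rule (rot_label i) (rot_label j) s (rot_label k)"
    "oct_rule (rot_label (rot_label i)) (rot_label (rot_label j)) s (rot_label (rot_label k))"
    "oct_rule (neg_label i) (neg_label j) s (neg_label k)"
    "oct_rule (neg_label (rot_label i)) (neg_label (rot_label j)) s (neg_label (rot_label k))"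
    "oct_rule (neg_label (rot_label (rot_label i))) (neg_label (rot_label (rot_label j))) s (neg_label (rot_label (rot_label k)))"
    if "oct_rule i j s k" for i j s k
    using that by (intro oct_rule.intros(7,8); assumption)+
  note R = oct_rule.intros(1-6)
  note S = R A[OF R(1), simplified] A[OF R(2), simplified] A[OF R(3), simplified]
    A[OF R(4), simplified] A[OF R(5), simplified] A[OF R(6), simplified]
  have "\<forall>(i,j,s,k)\<in>oct_table. oct_rule i j s k"
    unfolding oct_table_def by (simp add: S)
  then show "(i, j, s, k) \<in> oct_table \<Longrightarrow> oct_rule i j s k" by blast
qed


lemma oct_rule_iff: "oct_rule i j s k \<longleftrightarrow> (i, j, s, k) \<in> oct_table"
  using oct_rule_imp_table table_imp_oct_rule by blast


lemma oct_mult_cnj: "x \<odot> oct_cnj x = oct_norm x *s oct_one"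
proof -
  have "(x \<odot> oct_cnj x) $ k = (oct_norm x *s oct_one) $ k"
    if "k \<in> UNIV" for k
    using that unfolding UNIV_label
    by (elim insertE emptyE; hypsubst; simp add: oct_mult_def oct_coeff_def oct_rule_iff oct_table_def UNIV_label)
      (simp_all add: oct_norm_def UNIV_idx oct_one_def axis_def oct_cnj_def ac_simps)
  then show ?thesis by (simp add: vec_eq_iff)
qed


section \<open>The 27-dimensional space and the Dickson--Freudenthal determinant\<close>

text \<open>
  The Hermitian matrix \<open>(a, b, c | A, B, C)\<close> is represented by its 27 coordinates.
\<close>

datatype jlabel = Ja | Jb | Jc | JA label | JB label | JC label

lemma UNIV_jlabel: "(UNIV :: jlabel set) =
  {Ja, Jb, Jc} \<union> range JA \<union> range JB \<union> range JC"
proof -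
  have "x \<in> {Ja, Jb, Jc} \<union> range JA \<union> range JB \<union> range JC" for x
    by (cases x) auto
  then show ?thesis
    by blast
qed

instance jlabel :: finite
  by standard (simp add: UNIV_jlabel)

type_synonym 'a albert = "'a ^ jlabel"

definition herm :: "'a \<Rightarrow> 'a \<Rightarrow> 'a \<Rightarrow> 'a oct \<Rightarrow> 'a oct \<Rightarrow> 'a oct \<Rightarrow> 'a albert" where
  "herm a b c A B C = (\<chi> l. case l of
      Ja \<Rightarrow> a | Jb \<Rightarrow> b | Jc \<Rightarrow> c | JA i \<Rightarrow> A $ i | JB i \<Rightarrow> B $ i | JC i \<Rightarrow> C $ i)"

definition albert_one :: "'a::comm_ring_1 albert" where
  "albert_one = herm 1 1 1 0 0 0"

definition albert_det :: "'a::comm_ring_1 albert \<Rightarrow> 'a" where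
  "albert_det x =
    (let a = x $ Ja; b = x $ Jb; c = x $ Jc;
         A = (\<chi> i. x $ JA i); B = (\<chi> i. x $ JB i); C = (\<chi> i. x $ JC i)
     in a * b * c - a * oct_norm A - b * oct_norm B - c * oct_norm C
        + oct_trace (A \<odot> (B \<odot> C)))"


section \<open>Preservation of the determinant as a polynomial\<close>

text \<open>
  The polynomial ring over \<open>'a\<close> in 27 variables, one for each coordinate.
  Over a small field, equality of polynomials is stronger than equality of the induced functions.
\<close>

type_synonym 'a jpoly = "(jlabel \<Rightarrow>\<^sub>0 nat) \<Rightarrow>\<^sub>0 'a"

definition jvar :: "jlabel \<Rightarrow> 'a::comm_ring_1 jpoly" where
  "jvar i = Poly_Mapping.single (Poly_Mapping.single i 1) 1"

definition jconst :: "'a::comm_ring_1 \<Rightarrow> 'a jpoly" where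
  "jconst c = Poly_Mapping.single 0 c"

definition generic :: "'a::comm_ring_1 jpoly albert" where
  "generic = (\<chi> i. jvar i)"

text \<open>The image of the generic element under (the scalar extension of) the linear map \<open>g\<close>.\<close>

definition generic_image :: "('a::field albert \<Rightarrow> 'a albert) \<Rightarrow> 'a jpoly albert" where
  "generic_image g = map_matrix jconst (matrix g) *v generic"

definition preserves_det :: "('a::field albert \<Rightarrow> 'a albert) \<Rightarrow> bool" where
  "preserves_det g \<longleftrightarrow> albert_det (generic_image g) = albert_det generic"


section \<open>The groups\<close>

definition SE6 :: "('a::field albert \<Rightarrow> 'a albert) monoid" where
  "SE6 = \<lparr> carrier = {g. Vector_Spaces.linear (*s) (*s) g \<and> bij g \<and> preserves_det g},
           monoid.mult = (\<circ>), one = id \<rparr>"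

definition F4 :: "('a::field albert \<Rightarrow> 'a albert) monoid" where
  "F4 = SE6 \<lparr> carrier := {g \<in> carrier SE6. g albert_one = albert_one} \<rparr>"

end

theory Submission
  imports Defs "HOL-Computational_Algebra.Polynomial"
begin

text \<open>
  A linear map preserves the cubic form exactly if it preserves \<open>det\<close> and its polarization
  \<open>D(x, y)\<close>, the coefficient of \<open>t\<close> in \<open>det(x + ty)\<close>, at all points over the field; so it also
  preserves the elements of rank one, those with \<open>D(x, \<cdot>) = 0\<close>. The order is then a product of orbit
  lengths. Row and column operations \<open>x \<mapsto> M x M\<^sup>\<dagger>\<close>, permutations of the axes and octonion
  multiplications show that \<open>F\<^sub>4(q)\<close> is transitive on the \<open>q\<^sup>8(q\<^sup>8 + q\<^sup>4 + 1)\<close> elements of rank one and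
  trace 1, and that the stabilizer of \<open>E\<^sub>1 = diag(1,0,0)\<close> is transitive on the \<open>q\<^sup>4(q\<^sup>4 + 1)\<close>
  complementary idempotents \<open>v\<close> (\<open>v\<close> and \<open>1 - E\<^sub>1 - v\<close> of rank one). The pointwise stabilizer of the
  diagonal frame acts on the three octonion coordinates by related triples of isometries. Left and
  right multiplications by octonions of norm 1 make it transitive on the \<open>(q\<^sup>4 - 1)(q\<^sup>3 + 1)\<close> nonzero
  isotropic \<open>A\<close>, and the stabilizer of \<open>A = e\<^sub>0\<close> transitive on the \<open>q\<^sup>6\<close> isotropic \<open>A\<close> that
  are hyperbolic partners of \<open>e\<^sub>0\<close>. What fixes \<open>e\<^sub>0\<close> and \<open>e\<^bsub>-0\<^esub>\<close> is a copy of \<open>SL\<^sub>4(q)\<close>, acting on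
  \<open>B\<close> as on \<open>V \<oplus> V*\<close> and on the other six coordinates of \<open>A\<close> as on alternating forms.
\<close>

hide_const (open) Polynomial.order

subsection \<open>Octonion identities\<close>

text \<open>The row and column operations do not fix the identity matrix. So transitivity on
  idempotents is proved in two moves inside \<open>SE6\<close>: the idempotent is carried to its
  standard place, and then operations fixing that place bring the image of \<open>albert_one\<close>
  back. The second move succeeds because \<open>det(y) = 1\<close> and \<open>D(y, E1) = 1\<close>
  are the only conditions for \<open>(y, E1)\<close> to be equivalent to
  \<open>(albert_one, E1)\<close>. Characteristics 2 and 3 and tiny fields shape the rest. Nothing
  is divided by 2 or 6: quadratic norms are kept beside their polar forms, and \<open>det\<close>
  beside \<open>D\<close> and the trilinear form. Since the octonions are split, every scalar is a
  norm, so rescaling needs no square roots. The chain ends in SL_4 because the frame stabilizer is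
  Spin_8^+(q), and fixing a hyperbolic pair in its vector module leaves Spin_6^+(q) = SL_4(q). The
  two half-spin modules restrict to V + V*, and the remaining six-dimensional space is an exterior
  square whose quadratic form is the Pfaffian.\<close>

lemma all_label: "(\<forall>k::label. P k) \<longleftrightarrow> P (Pos I0) \<and> P (Neg I0) \<and> P (Pos I1) \<and> P (Neg I1) \<and>
   P (Pos I\<omega>) \<and> P (Neg I\<omega>) \<and> P (Pos I\<omega>') \<and> P (Neg I\<omega>')"
  using UNIV_label by (metis UNIV_I insertE singletonD)

lemma oct_eq_iff: "(x :: 'a oct) = y \<longleftrightarrow> x $ Pos I0 = y $ Pos I0 \<and> x $ Neg I0 = y $ Neg I0 \<and>
   x $ Pos I1 = y $ Pos I1 \<and> x $ Neg I1 = y $ Neg I1 \<and>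
   x $ Pos I\<omega> = y $ Pos I\<omega> \<and> x $ Neg I\<omega> = y $ Neg I\<omega> \<and>
   x $ Pos I\<omega>' = y $ Pos I\<omega>' \<and> x $ Neg I\<omega>' = y $ Neg I\<omega>'"
  by (simp add: vec_eq_iff all_label)

lemma sum_label: "(\<Sum>i\<in>(UNIV::label set). f i) = f (Pos I0) + f (Neg I0) + f (Pos I1) + f (Neg I1) +
   f (Pos I\<omega>) + f (Neg I\<omega>) + f (Pos I\<omega>') + (f (Neg I\<omega>') :: 'a :: comm_monoid_add)"
  by (simp add: UNIV_label add.assoc)

lemma oct_mult_nth:
  fixes x y :: "'a::comm_ring_1 oct"
  shows
  "(x \<odot> y) $ Pos I0 = x $ Pos I0 * y $ Pos I0 - x $ Neg I1 * y $ Pos I1 - x $ Neg I\<omega> * y $ Pos I\<omega> - x $ Neg I\<omega>' * y $ Pos I\<omega>'"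
  "(x \<odot> y) $ Neg I0 = x $ Neg I0 * y $ Neg I0 - x $ Pos I1 * y $ Neg I1 - x $ Pos I\<omega> * y $ Neg I\<omega> - x $ Pos I\<omega>' * y $ Neg I\<omega>'"
  "(x \<odot> y) $ Pos I1 = x $ Pos I1 * y $ Pos I0 + x $ Neg I0 * y $ Pos I1 + x $ Neg I\<omega> * y $ Neg I\<omega>' - x $ Neg I\<omega>' * y $ Neg I\<omega>"
  "(x \<odot> y) $ Neg I1 = x $ Neg I1 * y $ Neg I0 + x $ Pos I0 * y $ Neg I1 + x $ Pos I\<omega> * y $ Pos I\<omega>' - x $ Pos I\<omega>' * y $ Pos I\<omega>"
  "(x \<odot> y) $ Pos I\<omega> = x $ Pos I\<omega> * y $ Pos I0 + x $ Neg I0 * y $ Pos I\<omega> + x $ Neg I\<omega>' * y $ Neg I1 - x $ Neg I1 * y $ Neg I\<omega>'"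
  "(x \<odot> y) $ Neg I\<omega> = x $ Neg I\<omega> * y $ Neg I0 + x $ Pos I0 * y $ Neg I\<omega> + x $ Pos I\<omega>' * y $ Pos I1 - x $ Pos I1 * y $ Pos I\<omega>'"
  "(x \<odot> y) $ Pos I\<omega>' = x $ Pos I\<omega>' * y $ Pos I0 + x $ Neg I0 * y $ Pos I\<omega>' + x $ Neg I1 * y $ Neg I\<omega> - x $ Neg I\<omega> * y $ Neg I1"
  "(x \<odot> y) $ Neg I\<omega>' = x $ Neg I\<omega>' * y $ Neg I0 + x $ Pos I0 * y $ Neg I\<omega>' + x $ Pos I1 * y $ Pos I\<omega> - x $ Pos I\<omega> * y $ Pos I1"
  by (simp_all add: oct_mult_def sum_label oct_coeff_def oct_rule_iff oct_table_def)

lemma oct_cnj_nth [simp]: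
  "oct_cnj x $ Pos I0 = x $ Neg I0" "oct_cnj x $ Neg I0 = x $ Pos I0"
  "oct_cnj x $ Pos I1 = - x $ Pos I1" "oct_cnj x $ Neg I1 = - x $ Neg I1"
  "oct_cnj x $ Pos I\<omega> = - x $ Pos I\<omega>" "oct_cnj x $ Neg I\<omega> = - x $ Neg I\<omega>"
  "oct_cnj x $ Pos I\<omega>' = - x $ Pos I\<omega>'" "oct_cnj x $ Neg I\<omega>' = - x $ Neg I\<omega>'"
  by (simp_all add: oct_cnj_def)

lemma oct_norm_eq: "oct_norm x = x $ Pos I0 * x $ Neg I0 + x $ Pos I1 * x $ Neg I1
    + x $ Pos I\<omega> * x $ Neg I\<omega> + x $ Pos I\<omega>' * x $ Neg I\<omega>'"
  by (simp add: oct_norm_def UNIV_idx add.assoc)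

lemma oct_one_nth [simp]:
  "oct_one $ Pos I0 = 1" "oct_one $ Neg I0 = 1" "oct_one $ Pos I1 = 0" "oct_one $ Neg I1 = 0"
  "oct_one $ Pos I\<omega> = 0" "oct_one $ Neg I\<omega> = 0" "oct_one $ Pos I\<omega>' = 0" "oct_one $ Neg I\<omega>' = 0"
  by (simp_all add: oct_one_def axis_def)

definition oct_inner :: "'a::comm_ring_1 oct \<Rightarrow> 'a oct \<Rightarrow> 'a" where
  "oct_inner x y = oct_trace (x \<odot> oct_cnj y)"

lemma oct_mult_linear:
  fixes x y z :: "'a::comm_ring_1 oct"
  shows "(x + y) \<odot> z = x \<odot> z + y \<odot> z" "x \<odot> (y + z) = x \<odot> y + x \<odot> z"
    "(x - y) \<odot> z = x \<odot> z - y \<odot> z" "x \<odot> (y - z) = x \<odot> y - x \<odot> z"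
    "(c *s x) \<odot> y = c *s (x \<odot> y)" "x \<odot> (c *s y) = c *s (x \<odot> y)"
    "0 \<odot> x = 0" "x \<odot> 0 = 0" "(- x) \<odot> y = - (x \<odot> y)" "x \<odot> (- y) = - (x \<odot> y)"
  by (simp_all add: oct_eq_iff oct_mult_nth algebra_simps)

lemma oct_cnj_linear: "oct_cnj (x + y) = oct_cnj x + oct_cnj y" "oct_cnj (x - y) = oct_cnj x - oct_cnj y"
    "oct_cnj (c *s x) = c *s oct_cnj x" "oct_cnj 0 = 0" "oct_cnj (- x) = - oct_cnj x"
  by (simp_all add: oct_eq_iff)

lemma oct_cnj_cnj [simp]: "oct_cnj (oct_cnj x) = x"
  by (simp add: oct_eq_iff)

lemma oct_cnj_mult: "oct_cnj (x \<odot> y) = oct_cnj y \<odot> oct_cnj x"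
  by (simp add: oct_eq_iff oct_mult_nth algebra_simps)

lemma oct_trace_linear: "oct_trace (x + y) = oct_trace x + oct_trace y" "oct_trace (x - y) = oct_trace x - oct_trace y"
    "oct_trace (c *s x) = c * oct_trace x" "oct_trace 0 = 0" "oct_trace (- x) = - oct_trace x"
  by (simp_all add: oct_trace_def algebra_simps)

lemma oct_trace_cnj [simp]: "oct_trace (oct_cnj x) = oct_trace x"
  by (simp add: oct_trace_def)

lemma oct_trace_commute: "oct_trace (x \<odot> y) = oct_trace (y \<odot> x)"
  by (simp add: oct_trace_def oct_mult_nth algebra_simps)

lemma oct_trace_assoc: "oct_trace ((x \<odot> y) \<odot> z) = oct_trace (x \<odot> (y \<odot> z))"
  by (simp add: oct_trace_def oct_mult_nth algebra_simps)

lemma oct_trace_cycle: "oct_trace (x \<odot> (y \<odot> z)) = oct_trace (y \<odot> (z \<odot> x))"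
  by (metis oct_trace_assoc oct_trace_commute)

lemma oct_inner_eq: "oct_inner x y = x $ Pos I0 * y $ Neg I0 + x $ Neg I0 * y $ Pos I0
   + x $ Pos I1 * y $ Neg I1 + x $ Neg I1 * y $ Pos I1 + x $ Pos I\<omega> * y $ Neg I\<omega> + x $ Neg I\<omega> * y $ Pos I\<omega>
   + x $ Pos I\<omega>' * y $ Neg I\<omega>' + x $ Neg I\<omega>' * y $ Pos I\<omega>'"
  by (simp add: oct_inner_def oct_trace_def oct_mult_nth algebra_simps)

lemma oct_inner_commute: "oct_inner x y = oct_inner y x"
  by (simp add: oct_inner_eq algebra_simps)

lemma oct_inner_linear:
    "oct_inner (x + y) z = oct_inner x z + oct_inner y z" "oct_inner x (y + z) = oct_inner x y + oct_inner x z"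
    "oct_inner (c *s x) y = c * oct_inner x y" "oct_inner x (c *s y) = c * oct_inner x y"
    "oct_inner 0 x = 0" "oct_inner x 0 = 0" "oct_inner (- x) y = - oct_inner x y" "oct_inner x (- y) = - oct_inner x y"
  by (simp_all add: oct_inner_eq algebra_simps)

lemma oct_norm_add: "oct_norm (x + y) = oct_norm x + oct_norm y + oct_inner x y"
  by (simp add: oct_norm_eq oct_inner_eq algebra_simps)

lemma oct_norm_scale: "oct_norm (c *s x) = c * c * oct_norm x"
  by (simp add: oct_norm_eq algebra_simps)

lemma oct_norm_simps [simp]: "oct_norm 0 = 0" "oct_norm (- x) = oct_norm x" "oct_norm (oct_cnj x) = oct_norm x" "oct_norm oct_one = 1"
  by (simp_all add: oct_norm_eq algebra_simps)

lemma oct_norm_mult: "oct_norm (x \<odot> y) = oct_norm x * oct_norm y"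
  by (simp add: oct_norm_eq oct_mult_nth algebra_simps)

lemma oct_inner_self: "oct_inner x x = 2 * oct_norm x"
  by (simp add: oct_norm_eq oct_inner_eq algebra_simps)

lemma oct_cnj_cancel:
   "oct_cnj x \<odot> (x \<odot> y) = oct_norm x *s y" "(y \<odot> x) \<odot> oct_cnj x = oct_norm x *s y"
   "x \<odot> (oct_cnj x \<odot> y) = oct_norm x *s y" "(y \<odot> oct_cnj x) \<odot> x = oct_norm x *s y"
  by (simp_all add: oct_eq_iff oct_norm_eq oct_mult_nth algebra_simps)

lemma oct_Moufang: "(u \<odot> x) \<odot> (y \<odot> u) = u \<odot> ((x \<odot> y) \<odot> u)"
  by (simp add: oct_eq_iff oct_mult_nth algebra_simps)

subsection \<open>The determinant and its polarizations\<close>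

definition albA :: "'a albert \<Rightarrow> 'a oct" where "albA x = (\<chi> i. x $ JA i)"
definition albB :: "'a albert \<Rightarrow> 'a oct" where "albB x = (\<chi> i. x $ JB i)"
definition albC :: "'a albert \<Rightarrow> 'a oct" where "albC x = (\<chi> i. x $ JC i)"

lemma alb_nth [simp]: "albA x $ i = x $ JA i" "albB x $ i = x $ JB i" "albC x $ i = x $ JC i"
  by (simp_all add: albA_def albB_def albC_def)

lemma herm_nth [simp]: "herm a b c A B C $ Ja = a" "herm a b c A B C $ Jb = b" "herm a b c A B C $ Jc = c"
  "herm a b c A B C $ JA i = A $ i" "herm a b c A B C $ JB i = B $ i" "herm a b c A B C $ JC i = C $ i"
  by (simp_all add: herm_def)

lemma alb_herm [simp]: "albA (herm a b c A B C) = A" "albB (herm a b c A B C) = B" "albC (herm a b c A B C) = C"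
  by (simp_all add: vec_eq_iff)

lemma all_jlabel: "(\<forall>l. P l) \<longleftrightarrow> P Ja \<and> P Jb \<and> P Jc \<and> (\<forall>i. P (JA i)) \<and> (\<forall>i. P (JB i)) \<and> (\<forall>i. P (JC i))"
  by (metis jlabel.exhaust)

lemma albert_eq_iff: "x = y \<longleftrightarrow> x $ Ja = y $ Ja \<and> x $ Jb = y $ Jb \<and> x $ Jc = y $ Jc
    \<and> albA x = albA y \<and> albB x = albB y \<and> albC x = albC y"
  by (auto simp: vec_eq_iff all_jlabel)

lemma herm_eq_iff [simp]: "herm a b c A B C = herm a' b' c' A' B' C' \<longleftrightarrow>
    a = a' \<and> b = b' \<and> c = c' \<and> A = A' \<and> B = B' \<and> C = C'"
  by (simp add: albert_eq_iff)

lemma herm_exhaust: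
  obtains a b c A B C where "x = herm a b c A B C"
proof
  show "x = herm (x $ Ja) (x $ Jb) (x $ Jc) (albA x) (albB x) (albC x)"
    by (simp add: albert_eq_iff)
qed

lemma herm_add: "herm a b c A B C + herm a' b' c' A' B' C' = herm (a + a') (b + b') (c + c') (A + A') (B + B') (C + C')"
  by (simp add: albert_eq_iff vec_eq_iff)

lemma herm_diff: "herm a b c A B C - herm a' b' c' A' B' C' = herm (a - a') (b - b') (c - c') (A - A') (B - B') (C - C')"
  by (simp add: albert_eq_iff vec_eq_iff)

lemma herm_scale: "t *s herm a b c A B C = herm (t * a) (t * b) (t * c) (t *s A) (t *s B) (t *s C)"
  by (simp add: albert_eq_iff vec_eq_iff)

lemma herm_zero: "herm 0 0 0 0 0 0 = 0"
  by (simp add: albert_eq_iff vec_eq_iff)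

lemma albert_det_herm: "albert_det (herm a b c A B C) =
   a * b * c - a * oct_norm A - b * oct_norm B - c * oct_norm C + oct_trace (A \<odot> (B \<odot> C))"
  by (simp add: albert_det_def Let_def)

definition det_deriv :: "'a::comm_ring_1 albert \<Rightarrow> 'a albert \<Rightarrow> 'a" where
  "det_deriv x y = y $ Ja * (x $ Jb * x $ Jc - oct_norm (albA x)) + y $ Jb * (x $ Jc * x $ Ja - oct_norm (albB x))
     + y $ Jc * (x $ Ja * x $ Jb - oct_norm (albC x))
     - x $ Ja * oct_inner (albA x) (albA y) - x $ Jb * oct_inner (albB x) (albB y) - x $ Jc * oct_inner (albC x) (albC y)
     + oct_trace (albA y \<odot> (albB x \<odot> albC x)) + oct_trace (albA x \<odot> (albB y \<odot> albC x)) + oct_trace (albA x \<odot> (albB x \<odot> albC y))"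

text \<open>The symmetric trilinear form T, the polarization of \<open>D\<close> in its first
  argument. Since \<open>T(x, x, x) = 6 det x\<close>, it does not replace \<open>det\<close> and
  \<open>D\<close> in characteristic 2 or 3.\<close>

definition det_tri :: "'a::comm_ring_1 albert \<Rightarrow> 'a albert \<Rightarrow> 'a albert \<Rightarrow> 'a" where
  "det_tri x z y = y $ Ja * (x $ Jb * z $ Jc + z $ Jb * x $ Jc - oct_inner (albA x) (albA z))
     + y $ Jb * (x $ Jc * z $ Ja + z $ Jc * x $ Ja - oct_inner (albB x) (albB z))
     + y $ Jc * (x $ Ja * z $ Jb + z $ Ja * x $ Jb - oct_inner (albC x) (albC z))
     - x $ Ja * oct_inner (albA z) (albA y) - x $ Jb * oct_inner (albB z) (albB y) - x $ Jc * oct_inner (albC z) (albC y)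
     - z $ Ja * oct_inner (albA x) (albA y) - z $ Jb * oct_inner (albB x) (albB y) - z $ Jc * oct_inner (albC x) (albC y)
     + oct_trace (albA y \<odot> (albB x \<odot> albC z)) + oct_trace (albA x \<odot> (albB y \<odot> albC z)) + oct_trace (albA x \<odot> (albB z \<odot> albC y))
     + oct_trace (albA y \<odot> (albB z \<odot> albC x)) + oct_trace (albA z \<odot> (albB y \<odot> albC x)) + oct_trace (albA z \<odot> (albB x \<odot> albC y))"

lemma alb_linear:
  "albA (x + y) = albA x + albA y" "albB (x + y) = albB x + albB y" "albC (x + y) = albC x + albC y"
  "albA (t *s x) = t *s albA x" "albB (t *s x) = t *s albB x" "albC (t *s x) = t *s albC x"
  "albA 0 = 0" "albB 0 = 0" "albC 0 = 0"
  by (simp_all add: vec_eq_iff)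

lemmas oct_linear = oct_mult_linear oct_trace_linear oct_inner_linear oct_norm_add oct_norm_scale

lemma det_deriv_add: "det_deriv (x + z) y = det_deriv x y + det_deriv z y + det_tri x z y"
  by (simp add: det_deriv_def det_tri_def alb_linear oct_linear algebra_simps)

lemma det_deriv_linear: "det_deriv x (y + z) = det_deriv x y + det_deriv x z"
   "det_deriv x (t *s y) = t * det_deriv x y" "det_deriv x 0 = 0" "det_deriv 0 x = 0" "det_deriv (t *s x) y = t * t * det_deriv x y"
  by (simp_all add: det_deriv_def alb_linear oct_linear algebra_simps)

lemma det_tri_linear: "det_tri (x + x') z y = det_tri x z y + det_tri x' z y"
   "det_tri (t *s x) z y = t * det_tri x z y" "det_tri x (t *s z) y = t * det_tri x z y" "det_tri 0 z y = 0"
  by (simp_all add: det_tri_def alb_linear oct_linear algebra_simps)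

lemma albert_det_line: "albert_det (x + t *s y) =
   albert_det x + t * det_deriv x y + t * t * det_deriv y x + t * t * t * albert_det y"
proof -
  obtain a b c A B C where x: "x = herm a b c A B C" by (rule herm_exhaust)
  obtain a' b' c' A' B' C' where y: "y = herm a' b' c' A' B' C'" by (rule herm_exhaust)
  show ?thesis unfolding x y
    by (simp add: herm_scale herm_add albert_det_herm det_deriv_def oct_linear oct_inner_commute[of A' A]
      oct_inner_commute[of B' B] oct_inner_commute[of C' C] algebra_simps)
qed

lemma albert_det_zero [simp]: "albert_det 0 = 0"
  by (simp add: herm_zero[symmetric] albert_det_herm oct_linear)

text \<open>In \<open>det\<close> of a linear combination, the coefficients of \<open>c_i^3\<close>,
  \<open>c_i^2 c_j\<close> and \<open>c_i c_j c_k\<close> are \<open>det\<close>, \<open>D\<close>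
  and T at the vectors. This holds over every commutative ring, in particular with polynomial
  variables as the \<open>c_i\<close>.\<close>

lemma albert_det_sum_cong:
  fixes v w :: "'i \<Rightarrow> 'a::comm_ring_1 albert"
  assumes fin: "finite S"
   and det: "\<And>i. albert_det (v i) = albert_det (w i)"
   and deriv: "\<And>i j. det_deriv (v i) (v j) = det_deriv (w i) (w j)"
   and tri: "\<And>i j k. det_tri (v i) (v j) (v k) = det_tri (w i) (w j) (w k)"
  shows "albert_det (\<Sum>i\<in>S. c i *s v i) = albert_det (\<Sum>i\<in>S. c i *s w i)"
proof -
  have d1: "det_deriv (v i) (\<Sum>j\<in>S. c j *s v j) = det_deriv (w i) (\<Sum>j\<in>S. c j *s w j)"
    if "finite S" for i S
    using that by induction (simp_all add: det_deriv_linear deriv)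
  have t1: "det_tri (\<Sum>j\<in>S. c j *s v j) (v i) (v k) = det_tri (\<Sum>j\<in>S. c j *s w j) (w i) (w k)"
    if "finite S" for i k S
    using that by induction (simp_all add: det_tri_linear tri)
  have d2: "det_deriv (\<Sum>j\<in>S. c j *s v j) (v i) = det_deriv (\<Sum>j\<in>S. c j *s w j) (w i)"
    if "finite S" for i S
    using that
  proof induction
    case (insert j F)
    \<comment> \<open>Additivity of \<open>det_tri\<close> is available in the first slot, so
      symmetry moves the sum there.\<close>
    have "det_tri (c j *s v j) (\<Sum>j\<in>F. c j *s v j) (v i) = det_tri (\<Sum>j\<in>F. c j *s v j) (c j *s v j) (v i)"
      "det_tri (c j *s w j) (\<Sum>j\<in>F. c j *s w j) (w i) = det_tri (\<Sum>j\<in>F. c j *s w j) (c j *s w j) (w i)"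
      by (simp_all add: det_tri_def oct_inner_commute algebra_simps)
    with insert show ?case
      by (simp add: det_deriv_add det_deriv_linear det_tri_linear deriv t1)
  qed (simp add: det_deriv_linear)
  show ?thesis using fin
  proof induction
    case (insert j F)
    then show ?case
      by (simp add: add.commute[of "c j *s _"] albert_det_line det d1 d2)
  qed simp
qed

section \<open>Ring homomorphisms and evaluation of formal polynomials\<close>

definition albert_map :: "('a \<Rightarrow> 'b) \<Rightarrow> 'a albert \<Rightarrow> 'b albert" where
  "albert_map f x = (\<chi> l. f (x $ l))"

locale comm_ring_hom =
  fixes \<phi> :: "'a::comm_ring_1 \<Rightarrow> 'b::comm_ring_1"
  assumes hom_add [simp]: "\<phi> (x + y) = \<phi> x + \<phi> y"
    and hom_mult [simp]: "\<phi> (x * y) = \<phi> x * \<phi> y"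
    and hom_one [simp]: "\<phi> 1 = 1"
begin

lemma hom_zero [simp]: "\<phi> 0 = 0"
  using hom_add[of 0 0] by simp

lemma hom_minus [simp]: "\<phi> (- x) = - \<phi> x"
  using hom_add[of x "- x"] by (simp add: eq_neg_iff_add_eq_0 add.commute)

lemma hom_diff [simp]: "\<phi> (x - y) = \<phi> x - \<phi> y"
  using hom_add[of x "- y"] by simp

lemma hom_sum [simp]: "\<phi> (sum f S) = (\<Sum>i\<in>S. \<phi> (f i))"
  by (induction S rule: infinite_finite_induct) simp_all

lemmas albert_expand = det_deriv_def det_tri_def oct_mult_nth oct_norm_eq oct_trace_def oct_inner_eq

lemma albert_det_map: "albert_det (albert_map \<phi> x) = \<phi> (albert_det x)"
proof -
  have "x = herm (x $ Ja) (x $ Jb) (x $ Jc) (albA x) (albB x) (albC x)" for x :: "'c albert"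
    by (simp add: albert_eq_iff)
  then have *: "albert_det x = x $ Ja * x $ Jb * x $ Jc - x $ Ja * oct_norm (albA x) - x $ Jb * oct_norm (albB x)
     - x $ Jc * oct_norm (albC x) + oct_trace (albA x \<odot> (albB x \<odot> albC x))" for x :: "'c::comm_ring_1 albert"
    by (metis albert_det_herm)
  show ?thesis
    by (simp add: * albert_expand albert_map_def)
qed

lemma det_deriv_map: "det_deriv (albert_map \<phi> x) (albert_map \<phi> y) = \<phi> (det_deriv x y)"
  by (simp add: albert_expand albert_map_def)

lemma det_tri_map: "det_tri (albert_map \<phi> x) (albert_map \<phi> z) (albert_map \<phi> y) = \<phi> (det_tri x z y)"
  by (simp add: albert_expand albert_map_def)

end

text \<open>
  The polynomials \<open>[:a, b:]\<close> serve as dual numbers: the determinant of a lifted pair records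
  \<open>det\<close> and \<open>D\<close> at once, so invariance over every commutative ring gives both over the field.
\<close>

definition albert_lift :: "'a::comm_ring_1 albert \<Rightarrow> 'a albert \<Rightarrow> 'a poly albert" where
  "albert_lift x y = (\<chi> l. [:x $ l, y $ l:])"

lemma const_poly_hom: "comm_ring_hom (\<lambda>c::'a::comm_ring_1. [:c:])"
  by unfold_locales (simp_all add: one_pCons)

lemma albert_det_lift: "albert_det (albert_lift x y) = [:albert_det x, det_deriv x y, det_deriv y x, albert_det y:]"
proof -
  interpret comm_ring_hom "\<lambda>c::'a. [:c:]" by (rule const_poly_hom)
  have "albert_lift x y = albert_map (\<lambda>c. [:c:]) x + [:0,1:] *s albert_map (\<lambda>c. [:c:]) y"
    by (simp add: vec_eq_iff albert_lift_def albert_map_def)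
  then show ?thesis
    by (simp add: albert_det_line albert_det_map det_deriv_map)
qed

lemma jconst_hom: "comm_ring_hom (jconst :: 'a::comm_ring_1 \<Rightarrow> 'a jpoly)"
  by unfold_locales (simp_all add: jconst_def single_add mult_single)

context comm_ring_hom begin

definition jeval :: "(jlabel \<Rightarrow> 'b) \<Rightarrow> 'a jpoly \<Rightarrow> 'b" where
  "jeval v p = (\<Sum>m\<in>Poly_Mapping.keys p. \<phi> (Poly_Mapping.lookup p m) * (\<Prod>l\<in>UNIV. v l ^ Poly_Mapping.lookup m l))"

lemma jeval_add: "jeval v (p + q) = jeval v p + jeval v q"
  unfolding jeval_def
  by (rule setsum_keys_plus_distrib) (simp_all add: algebra_simps)

lemma jeval_single: "jeval v (Poly_Mapping.single m c) = \<phi> c * (\<Prod>l\<in>UNIV. v l ^ Poly_Mapping.lookup m l)"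
  by (simp add: jeval_def)

lemma jeval_sum: "jeval v (sum f S) = (\<Sum>i\<in>S. jeval v (f i))"
proof (induction S rule: infinite_finite_induct)
qed (simp_all add: jeval_add, simp_all add: jeval_def)

lemma jeval_mult: "jeval v (p * q) = jeval v p * jeval v q"
proof -
  have d: "p = (\<Sum>m\<in>Poly_Mapping.keys p. Poly_Mapping.single m (Poly_Mapping.lookup p m))" for p :: "'a jpoly"
    by (rule poly_mapping_eqI) (auto simp: lookup_sum lookup_single in_keys_iff when_def)
  have s: "jeval v (Poly_Mapping.single m a * Poly_Mapping.single n b)
      = jeval v (Poly_Mapping.single m a) * jeval v (Poly_Mapping.single n b)" for m n a b
    by (simp add: mult_single jeval_single lookup_add power_add prod.distrib algebra_simps)
  show ?thesis
    by (subst (2 3) d, subst (1) d[of p], subst (1) d[of q])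
      (simp add: sum_product jeval_sum s)
qed

lemma jeval_hom: "comm_ring_hom (jeval v)"
proof
  show "jeval v 1 = 1"
    using jeval_single[of v 0 1] by simp
qed (simp_all add: jeval_add jeval_mult)

lemma jeval_jconst: "jeval v (jconst c) = \<phi> c"
  by (simp add: jconst_def jeval_single)

lemma jeval_jvar: "jeval v (jvar l) = v l"
proof -
  have "(\<Prod>k\<in>UNIV. v k ^ Poly_Mapping.lookup (Poly_Mapping.single l 1) k) = (\<Prod>k\<in>UNIV. if k = l then v k else 1)"
    by (rule prod.cong) (auto simp: lookup_single when_def)
  also have "\<dots> = v l"
    by simp
  finally show ?thesis
    by (simp add: jvar_def jeval_single)
qed

end

lemma generic_image_nth: "generic_image g $ l = (\<Sum>i\<in>UNIV. jconst (matrix g $ l $ i) * jvar i)"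
  by (simp add: generic_image_def matrix_vector_mult_def map_matrix_def generic_def)

text \<open>Values of \<open>det\<close> alone do not determine the form over a small field:
  \<open>X^2 Y\<close> and \<open>X Y^2\<close> agree on F_2. The values of \<open>D\<close> on
  pairs of basis vectors separate such monomials.\<close>

lemma preserves_det_iff:
  fixes g :: "'a::field albert \<Rightarrow> 'a albert"
  assumes g: "Vector_Spaces.linear (*s) (*s) g"
  shows "preserves_det g \<longleftrightarrow> (\<forall>x y. albert_det (g x) = albert_det x \<and> det_deriv (g x) (g y) = det_deriv x y)"
proof
  assume p: "preserves_det g"
  show "\<forall>x y. albert_det (g x) = albert_det x \<and> det_deriv (g x) (g y) = det_deriv x y"
  proof (intro allI)
    fix x y :: "'a albert"
    interpret C: comm_ring_hom "\<lambda>c::'a. [:c:]" by (rule const_poly_hom)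
    \<comment> \<open>Variable \<open>l\<close> is evaluated at the dual number with parts
      \<open>x $ l\<close> and \<open>y $ l\<close>, so one polynomial identity yields both
      \<open>det\<close> and \<open>D\<close>.\<close>
    let ?v = "\<lambda>l::jlabel. [:x $ l, y $ l:]"
    interpret E: comm_ring_hom "C.jeval ?v" by (rule C.jeval_hom)
    have 1: "albert_map (C.jeval ?v) generic = albert_lift x y"
      by (simp add: vec_eq_iff albert_map_def albert_lift_def generic_def C.jeval_jvar)
    have s: "(\<Sum>i\<in>S. [:a i, b i:]) = [:\<Sum>i\<in>S. a i, \<Sum>i\<in>S. b i:]" for S and a b :: "jlabel \<Rightarrow> 'a"
      by (induction S rule: infinite_finite_induct) simp_all
    have 2: "albert_map (C.jeval ?v) (generic_image g) = albert_lift (g x) (g y)"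
    proof -
      have gz: "g z $ l = (\<Sum>i\<in>UNIV. matrix g $ l $ i * z $ i)" for z l
        unfolding matrix_works[OF g, of z, symmetric] by (simp add: matrix_vector_mult_def)
      have "C.jeval ?v (generic_image g $ l) = [:g x $ l, g y $ l:]" for l
        unfolding generic_image_nth E.hom_sum E.hom_mult C.jeval_jvar C.jeval_jconst gz
        unfolding s[symmetric] by (intro sum.cong refl) (simp only: mult_pCons_left mult_zero_left smult_pCons smult_0_right pCons_0_0 add_0_right)
      then show ?thesis
        by (simp add: vec_eq_iff albert_map_def albert_lift_def)
    qed
    have "albert_det (albert_lift (g x) (g y)) = albert_det (albert_lift x y)"
      using p unfolding preserves_det_def 1[symmetric] 2[symmetric] by (simp add: E.albert_det_map)
    then show "albert_det (g x) = albert_det x \<and> det_deriv (g x) (g y) = det_deriv x y"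
      by (simp add: albert_det_lift)
  qed
next
  assume p: "\<forall>x y. albert_det (g x) = albert_det x \<and> det_deriv (g x) (g y) = det_deriv x y"
  interpret J: comm_ring_hom "jconst :: 'a \<Rightarrow> 'a jpoly" by (rule jconst_hom)
  have t: "det_tri (g x) (g z) (g y) = det_tri x z y" for x y z
  proof -
    have "det_tri x z y = det_deriv (x + z) y - det_deriv x y - det_deriv z y" for x y z :: "'a albert"
      by (simp add: det_deriv_add)
    then show ?thesis
      using p by (metis vec.linear_add[OF g])
  qed
  let ?J = "albert_map (jconst :: 'a \<Rightarrow> 'a jpoly)"
  \<comment> \<open>The generic point is the combination of the basis vectors with the variables as
    coefficients, and its image is the same combination of their images;
    \<open>albert_det_sum_cong\<close> then compares the two.\<close>
  have 1: "generic_image g = (\<Sum>i\<in>UNIV. jvar i *s ?J (g (axis i 1)))"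
    by (simp add: vec_eq_iff generic_image_nth albert_map_def matrix_def mult.commute)
  have 2: "generic = (\<Sum>i\<in>UNIV. jvar i *s ?J (axis i 1))"
    by (simp add: vec_eq_iff generic_def albert_map_def axis_def if_distrib[of jconst] if_distrib[of "(*) _"] cong: if_cong)
  show "preserves_det g"
    unfolding preserves_det_def 1 2
    by (rule albert_det_sum_cong) (simp_all add: p t J.albert_det_map J.det_deriv_map J.det_tri_map)
qed

subsection \<open>The group of isometries of the determinant\<close>

abbreviation lin :: "('a::field ^ 'n \<Rightarrow> 'a ^ 'm) \<Rightarrow> bool" where
  "lin \<equiv> Vector_Spaces.linear (*s) (*s)"

lemma linI: "(\<And>x y. g (x + y) = g x + g y) \<Longrightarrow> (\<And>c x. g (c *s x) = c *s g x) \<Longrightarrow> lin g"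
  by (simp add: Vector_Spaces.linear_iff vec.vector_space_axioms)

lemma SE6_iff: "g \<in> carrier SE6 \<longleftrightarrow>
    lin g \<and> bij g \<and> (\<forall>x y. albert_det (g x) = albert_det x \<and> det_deriv (g x) (g y) = det_deriv x y)"
  using preserves_det_iff[of g] by (auto simp: SE6_def)

lemma SE6_linear: "g \<in> carrier SE6 \<Longrightarrow> lin g"
  by (simp add: SE6_iff)

lemma SE6_add: "g \<in> carrier SE6 \<Longrightarrow> g (x + y) = g x + g y"
  and SE6_scale: "g \<in> carrier SE6 \<Longrightarrow> g (c *s x) = c *s g x"
  and SE6_diff: "g \<in> carrier SE6 \<Longrightarrow> g (x - y) = g x - g y"
  by (simp_all add: SE6_linear vec.linear_add vec.linear_scale vec.linear_diff)

lemma SE6_zero: "g \<in> carrier SE6 \<Longrightarrow> g 0 = 0"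
  using SE6_diff[of g 0 0] by simp

lemma SE6_eq_iff: "g \<in> carrier SE6 \<Longrightarrow> g x = g y \<longleftrightarrow> x = y"
  by (auto simp: SE6_iff bij_def inj_on_def)

lemma SE6_bij: "g \<in> carrier SE6 \<Longrightarrow> bij g"
  by (simp add: SE6_iff)

lemma SE6_det: "g \<in> carrier SE6 \<Longrightarrow> albert_det (g x) = albert_det x"
  and SE6_deriv: "g \<in> carrier SE6 \<Longrightarrow> det_deriv (g x) (g y) = det_deriv x y"
  by (simp_all add: SE6_iff)

lemma SE6_tri: "g \<in> carrier SE6 \<Longrightarrow> det_tri (g x) (g z) (g y) = det_tri x z y"
proof -
  assume g: "g \<in> carrier SE6"
  have "det_tri x z y = det_deriv (x + z) y - det_deriv x y - det_deriv z y" for x y z :: "'a albert"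
    by (simp add: det_deriv_add)
  then show ?thesis
    by (simp add: SE6_deriv[OF g] flip: SE6_add[OF g])
qed

lemma SE6_id: "id \<in> carrier SE6"
  by (simp add: SE6_iff linI)

lemma SE6_comp: "g \<in> carrier SE6 \<Longrightarrow> h \<in> carrier SE6 \<Longrightarrow> g \<circ> h \<in> carrier SE6"
  by (auto simp: SE6_iff bij_comp intro!: linI simp: SE6_iff vec.linear_add vec.linear_scale)

lemma SE6_inv:
  assumes g: "g \<in> carrier SE6"
  shows "inv_into UNIV g \<in> carrier SE6"
proof -
  have b: "bij g" using g by (simp add: SE6_bij)
  then have i: "g (inv_into UNIV g x) = x" "inv_into UNIV g y = z \<longleftrightarrow> y = g z" for x y z
    by (auto simp: bij_def surj_f_inv_f)
  show ?thesis
    unfolding SE6_iff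
  proof (intro conjI allI linI)
    show "bij (inv_into UNIV g)" using b by (rule bij_imp_bij_inv)
    fix x y
    show "albert_det (inv_into UNIV g x) = albert_det x" by (metis SE6_det[OF g] i(1))
    show "det_deriv (inv_into UNIV g x) (inv_into UNIV g y) = det_deriv x y" by (metis SE6_deriv[OF g] i(1))
  qed (simp_all add: i SE6_add[OF g] SE6_scale[OF g])
qed

section \<open>Nondegeneracy, and a membership test for the group\<close>

lemma oct_inner_nondegenerate:
  fixes x :: "'a::comm_ring_1 oct"
  assumes "\<And>y. oct_inner x y = 0"
  shows "x = 0"
proof -
  have "x $ Pos i = 0" "x $ Neg i = 0" for i
    using assms[of "axis (Neg i) 1"] assms[of "axis (Pos i) 1"]
    by (cases i; simp add: oct_inner_eq axis_def)+
  then show ?thesis by (simp add: oct_eq_iff)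
qed

lemma det_deriv_herm: "det_deriv (herm a b c A B C) (herm a' b' c' A' B' C') =
  a' * (b * c - oct_norm A) + b' * (c * a - oct_norm B) + c' * (a * b - oct_norm C)
  - a * oct_inner A A' - b * oct_inner B B' - c * oct_inner C C'
  + oct_trace (A' \<odot> (B \<odot> C)) + oct_trace (A \<odot> (B' \<odot> C)) + oct_trace (A \<odot> (B \<odot> C'))"
  by (simp add: det_deriv_def)

lemma det_tri_nondegenerate:
  fixes x :: "'a::comm_ring_1 albert"
  assumes "\<And>z y. det_tri x z y = 0"
  shows "x = 0"
proof -
  obtain a b c A B C where x: "x = herm a b c A B C" by (rule herm_exhaust)
  have "a = 0" using assms[of "herm 0 0 1 0 0 0" "herm 0 1 0 0 0 0"] by (simp add: x det_tri_def oct_linear)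
  moreover have "b = 0" using assms[of "herm 1 0 0 0 0 0" "herm 0 0 1 0 0 0"] by (simp add: x det_tri_def oct_linear)
  moreover have "c = 0" using assms[of "herm 1 0 0 0 0 0" "herm 0 1 0 0 0 0"] by (simp add: x det_tri_def oct_linear)
  moreover have "A = 0"
  proof (rule oct_inner_nondegenerate)
    show "oct_inner A y = 0" for y
      using assms[of "herm 1 0 0 0 0 0" "herm 0 0 0 y 0 0"] by (simp add: x det_tri_def oct_linear)
  qed
  moreover have "B = 0"
  proof (rule oct_inner_nondegenerate)
    show "oct_inner B y = 0" for y
      using assms[of "herm 0 1 0 0 0 0" "herm 0 0 0 0 y 0"] by (simp add: x det_tri_def oct_linear)
  qed
  moreover have "C = 0"
  proof (rule oct_inner_nondegenerate)
    show "oct_inner C y = 0" for y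
      using assms[of "herm 0 0 1 0 0 0" "herm 0 0 0 0 0 y"] by (simp add: x det_tri_def oct_linear)
  qed
  ultimately show ?thesis by (simp add: x herm_zero)
qed

text \<open>Bijectivity comes for free: a kernel vector lies in the radical of T, which is zero, and
  an injective self-map of a finite set is onto.\<close>

lemma SE6_I:
  fixes g :: "'a::{field,finite} albert \<Rightarrow> 'a albert"
  assumes g: "lin g" and det: "\<And>x. albert_det (g x) = albert_det x"
    and deriv: "\<And>x y. det_deriv (g x) (g y) = det_deriv x y"
  shows "g \<in> carrier SE6"
proof -
  have tri: "det_tri (g x) (g z) (g y) = det_tri x z y" for x y z
  proof -
    have "det_tri x z y = det_deriv (x + z) y - det_deriv x y - det_deriv z y" for x y z :: "'a albert"
      by (simp add: det_deriv_add)
    then show ?thesis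
      by (simp add: deriv flip: vec.linear_add[OF g])
  qed
  have "inj g"
  proof (subst vec.linear_inj_iff_eq_0[OF g], intro allI impI)
    fix x assume "g x = 0"
    then have "det_tri x z y = 0" for z y
      by (metis tri det_tri_linear(4))
    then show "x = 0" by (rule det_tri_nondegenerate)
  qed
  then have "bij g"
    by (simp add: bij_def finite_UNIV_inj_surj)
  with assms show ?thesis by (simp add: SE6_iff)
qed

lemma SE6_I_lift:
  fixes g :: "'a::{field,finite} albert \<Rightarrow> 'a albert"
  assumes g: "lin g" and det: "\<And>x y. albert_det (albert_lift (g x) (g y)) = albert_det (albert_lift x y)"
  shows "g \<in> carrier SE6"
  using det by (intro SE6_I[OF g]) (simp_all add: albert_det_lift)

subsection \<open>Generators\<close>

text \<open>\<open>shear r\<close> is \<open>x \<mapsto> M x M\<^sup>\<dagger>\<close> for \<open>M\<close> the identity matrix with an extra entry \<open>r\<close> in position \<open>(1,2)\<close>.\<close>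

definition shear :: "'a::comm_ring_1 oct \<Rightarrow> 'a albert \<Rightarrow> 'a albert" where
  "shear r x = herm (x $ Ja + oct_inner (albC x) r + oct_norm r * x $ Jb) (x $ Jb) (x $ Jc)
     (albA x) (albB x + oct_cnj (albA x) \<odot> oct_cnj r) (albC x + x $ Jb *s r)"

lemma shear_herm: "shear r (herm a b c A B C) =
    herm (a + oct_inner C r + oct_norm r * b) b c A (B + oct_cnj A \<odot> oct_cnj r) (C + b *s r)"
  by (simp add: shear_def)

lemma albert_det_shear: "albert_det (shear r x) = albert_det x"
proof -
  obtain a b c A B C where x: "x = herm a b c A B C" by (rule herm_exhaust)
  \<comment> \<open>These identities make the mixed terms cancel: the first two terms of
    \<open>Tr\<close> that appear here cancel against \<open>b N(B)\<close> and against the growth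
    of \<open>a\<close> in \<open>a N(A)\<close>, while the third, with its factor 2, absorbs both
    remaining copies of \<open>b N(r) N(A)\<close>.\<close>
  have "oct_inner B (oct_cnj A \<odot> oct_cnj r) = oct_trace (A \<odot> (B \<odot> r))"
    by (simp add: oct_inner_def oct_cnj_mult oct_trace_cycle[of A])
  moreover have "oct_trace (A \<odot> ((oct_cnj A \<odot> oct_cnj r) \<odot> C)) = oct_norm A * oct_inner C r"
    by (simp add: oct_inner_def oct_cnj_cancel oct_linear oct_trace_commute[of C] flip: oct_trace_assoc)
  moreover have "oct_trace (A \<odot> ((oct_cnj A \<odot> oct_cnj r) \<odot> r)) = oct_norm r * (2 * oct_norm A)"
    by (simp add: oct_cnj_cancel oct_linear flip: oct_inner_self) (simp add: oct_inner_def)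
  ultimately show ?thesis
    by (simp add: x shear_herm albert_det_herm oct_linear oct_norm_mult algebra_simps)
qed

lemma shear_SE6: "shear (r :: 'a::{field,finite} oct) \<in> carrier SE6"
proof (rule SE6_I_lift)
  show "lin (shear r)"
    by (rule linI) (simp_all add: albert_eq_iff shear_def alb_linear oct_linear oct_cnj_linear vec_eq_iff algebra_simps)
  fix x y :: "'a albert"
  define R where "R = (\<chi> i. [:r $ i:])"
  have "albert_lift (shear r x) (shear r y) = shear R (albert_lift x y)"
    by (simp add: albert_eq_iff shear_def albert_lift_def oct_eq_iff oct_mult_nth oct_norm_eq oct_inner_eq R_def algebra_simps)
  then show "albert_det (albert_lift (shear r x) (shear r y)) = albert_det (albert_lift x y)"
    by (simp add: albert_det_shear)
qed

definition cyc :: "'a albert \<Rightarrow> 'a albert" where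
  "cyc x = herm (x $ Jb) (x $ Jc) (x $ Ja) (albB x) (albC x) (albA x)"

text \<open>Each off-diagonal entry changes sides of the diagonal when axes 1 and 2 are exchanged,
  hence the conjugations.\<close>

definition transpose12 :: "'a::comm_ring_1 albert \<Rightarrow> 'a albert" where
  "transpose12 x = herm (x $ Jb) (x $ Ja) (x $ Jc) (oct_cnj (albB x)) (oct_cnj (albA x)) (oct_cnj (albC x))"

lemma cyc_herm: "cyc (herm a b c A B C) = herm b c a B C A"
  by (simp add: cyc_def)

lemma transpose12_herm: "transpose12 (herm a b c A B C) = herm b a c (oct_cnj B) (oct_cnj A) (oct_cnj C)"
  by (simp add: transpose12_def)

lemma cyc_SE6: "(cyc :: 'a::{field,finite} albert \<Rightarrow> 'a albert) \<in> carrier SE6"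
proof (rule SE6_I_lift)
  show "lin (cyc :: 'a albert \<Rightarrow> 'a albert)"
    by (rule linI) (simp_all add: albert_eq_iff cyc_def vec_eq_iff)
  fix x y :: "'a albert"
  have "albert_lift (cyc x) (cyc y) = cyc (albert_lift x y)"
    by (simp add: albert_eq_iff cyc_def albert_lift_def vec_eq_iff)
  moreover have "albert_det (cyc z) = albert_det z" for z :: "'a poly albert"
  proof -
    obtain a b c A B C where z: "z = herm a b c A B C" by (rule herm_exhaust)
    show ?thesis
      by (simp add: z cyc_herm albert_det_herm oct_trace_cycle[of A] algebra_simps)
  qed
  ultimately show "albert_det (albert_lift (cyc x) (cyc y)) = albert_det (albert_lift x y)"
    by simp
qed

lemma transpose12_SE6: "(transpose12 :: 'a::{field,finite} albert \<Rightarrow> 'a albert) \<in> carrier SE6"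
proof (rule SE6_I_lift)
  show "lin (transpose12 :: 'a albert \<Rightarrow> 'a albert)"
    by (rule linI) (simp_all add: albert_eq_iff transpose12_def alb_linear oct_cnj_linear)
  fix x y :: "'a albert"
  have "albert_lift (transpose12 x) (transpose12 y) = transpose12 (albert_lift x y)"
    by (simp add: albert_eq_iff transpose12_def albert_lift_def oct_eq_iff)
  moreover have "albert_det (transpose12 z) = albert_det z" for z :: "'a poly albert"
  proof -
    obtain a b c A B C where z: "z = herm a b c A B C" by (rule herm_exhaust)
    have "oct_trace (oct_cnj B \<odot> (oct_cnj A \<odot> oct_cnj C)) = oct_trace ((C \<odot> A) \<odot> B)"
      by (metis oct_cnj_mult oct_trace_cnj)
    also have "\<dots> = oct_trace (A \<odot> (B \<odot> C))"
      by (metis oct_trace_assoc oct_trace_cycle)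
    finally show ?thesis
      by (simp add: z transpose12_herm albert_det_herm algebra_simps)
  qed
  ultimately show "albert_det (albert_lift (transpose12 x) (transpose12 y)) = albert_det (albert_lift x y)"
    by simp
qed

definition diag_map :: "'a::comm_ring_1 \<Rightarrow> 'a \<Rightarrow> 'a \<Rightarrow> ('a oct \<Rightarrow> 'a oct) \<Rightarrow> ('a oct \<Rightarrow> 'a oct) \<Rightarrow> ('a oct \<Rightarrow> 'a oct) \<Rightarrow> 'a albert \<Rightarrow> 'a albert" where
  "diag_map p q r \<alpha> \<beta> \<gamma> x = herm (p * x $ Ja) (q * x $ Jb) (r * x $ Jc) (\<alpha> (albA x)) (\<beta> (albB x)) (\<gamma> (albC x))"

lemma diag_map_herm: "diag_map p q r \<alpha> \<beta> \<gamma> (herm a b c A B C) = herm (p * a) (q * b) (r * c) (\<alpha> A) (\<beta> B) (\<gamma> C)"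
  by (simp add: diag_map_def)

text \<open>The multipliers \<open>p\<close>, \<open>q\<close>, \<open>r\<close> compensate the
  similitude factors of the three maps. For \<open>p = q = r = 1\<close> these are the related
  triples of triality.\<close>

lemma diag_map_SE6:
  fixes p q r :: "'a::{field,finite}"
  assumes lin: "lin \<alpha>" "lin \<beta>" "lin \<gamma>"
    and norm: "\<And>A. p * oct_norm (\<alpha> A) = oct_norm A" "\<And>B. q * oct_norm (\<beta> B) = oct_norm B" "\<And>C. r * oct_norm (\<gamma> C) = oct_norm C"
    and tri: "\<And>A B C. oct_trace (\<alpha> A \<odot> (\<beta> B \<odot> \<gamma> C)) = oct_trace (A \<odot> (B \<odot> C))"
    and pqr: "p * q * r = 1"
  shows "diag_map p q r \<alpha> \<beta> \<gamma> \<in> carrier SE6"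
proof (rule SE6_I)
  have *: "t * oct_inner (\<delta> x) (\<delta> y) = oct_inner x y" if "lin \<delta>" "\<And>A. t * oct_norm (\<delta> A) = oct_norm A" for t \<delta> and x y :: "'a oct"
    using that(2)[of "x + y"] that(2)[of x] that(2)[of y] by (simp add: vec.linear_add[OF that(1)] oct_norm_add algebra_simps)
  note inner = *[OF lin(1) norm(1)] *[OF lin(2) norm(2)] *[OF lin(3) norm(3)]
  show "lin (diag_map p q r \<alpha> \<beta> \<gamma>)"
    by (rule linI) (simp_all add: albert_eq_iff diag_map_def alb_linear lin vec.linear_add vec.linear_scale algebra_simps)
  have pqr': "p * (q * (r * z)) = z" for z
    using pqr by (simp flip: mult.assoc)
  fix x y :: "'a albert"
  obtain a b c A B C where x: "x = herm a b c A B C" by (rule herm_exhaust)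
  obtain a' b' c' A' B' C' where y: "y = herm a' b' c' A' B' C'" by (rule herm_exhaust)
  \<comment> \<open>\<open>E\<close> and \<open>E'\<close> put the hypotheses into the shape that
    products take after \<open>algebra_simps\<close>.\<close>
  have "(p * a) * ((q * b) * (r * c)) = a * (b * c)" for a b c
    using pqr'[of "a * b * c"] by (simp add: ac_simps)
  then have E: "a * p * (b * q * (c * r)) = a * (b * c)" for a b c
    by (simp add: ac_simps)
  have pqr'': "p * (q * r) = 1" using pqr by (simp add: ac_simps)
  have E':
    "a * (p * oct_norm (\<alpha> A)) = a * oct_norm A" "a * (q * oct_norm (\<beta> A)) = a * oct_norm A"
    "a * (r * oct_norm (\<gamma> A)) = a * oct_norm A"
    "a * (p * oct_inner (\<alpha> A) (\<alpha> B)) = a * oct_inner A B" "a * (q * oct_inner (\<beta> A) (\<beta> B)) = a * oct_inner A B"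
    "a * (r * oct_inner (\<gamma> A) (\<gamma> B)) = a * oct_inner A B" for a A B
    by (simp_all add: norm inner)
  show "albert_det (diag_map p q r \<alpha> \<beta> \<gamma> x) = albert_det x"
    using E E' pqr'' by (simp add: x diag_map_herm albert_det_herm tri norm algebra_simps)
  show "det_deriv (diag_map p q r \<alpha> \<beta> \<gamma> x) (diag_map p q r \<alpha> \<beta> \<gamma> y) = det_deriv x y"
    using E E' pqr'' by (simp add: x y diag_map_herm det_deriv_herm tri norm inner algebra_simps)
qed

text \<open>The Moufang identity merges the last two factors into \<open>oct_cnj u\<close> times
  \<open>z\<close> times \<open>oct_cnj u\<close>. Then \<open>u\<close> meets its conjugate twice,
  giving one factor \<open>oct_norm u\<close> each time.\<close>

lemma trace_similitude: "oct_trace (((u \<odot> A) \<odot> u) \<odot> ((oct_cnj u \<odot> B) \<odot> (C \<odot> oct_cnj u))) =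
   oct_norm u * oct_norm u * oct_trace (A \<odot> (B \<odot> C))"
proof -
  define z where "z = B \<odot> C"
  have "oct_trace (((u \<odot> A) \<odot> u) \<odot> ((oct_cnj u \<odot> B) \<odot> (C \<odot> oct_cnj u)))
     = oct_trace ((u \<odot> A) \<odot> (u \<odot> (oct_cnj u \<odot> (z \<odot> oct_cnj u))))"
    by (simp add: oct_Moufang z_def oct_trace_assoc)
  also have "\<dots> = oct_norm u * oct_trace ((u \<odot> A) \<odot> (z \<odot> oct_cnj u))"
    by (simp add: oct_cnj_cancel oct_linear)
  also have "oct_trace ((u \<odot> A) \<odot> (z \<odot> oct_cnj u)) = oct_trace (A \<odot> ((z \<odot> oct_cnj u) \<odot> u))"
    by (metis oct_trace_assoc oct_trace_cycle)
  finally show ?thesis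
    by (simp add: oct_cnj_cancel oct_linear z_def)
qed

text \<open>The two inverse norms cancel the square in \<open>trace_similitude\<close>. With norm 1
  this fixes the diagonal frame and multiplies octonion coordinates; with other norms it rescales
  diagonal entries.\<close>

definition simil :: "'a::field oct \<Rightarrow> 'a albert \<Rightarrow> 'a albert" where
  "simil u = diag_map 1 (inverse (oct_norm u)) (oct_norm u) (\<lambda>A. inverse (oct_norm u) *s ((u \<odot> A) \<odot> u))
     (\<lambda>B. oct_cnj u \<odot> B) (\<lambda>C. inverse (oct_norm u) *s (C \<odot> oct_cnj u))"

lemma simil_herm: "simil u (herm a b c A B C) = herm a (inverse (oct_norm u) * b) (oct_norm u * c)
   (inverse (oct_norm u) *s ((u \<odot> A) \<odot> u)) (oct_cnj u \<odot> B) (inverse (oct_norm u) *s (C \<odot> oct_cnj u))"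
  by (simp add: simil_def diag_map_herm)

lemma simil_SE6:
  fixes u :: "'a::{field,finite} oct"
  assumes "oct_norm u \<noteq> 0"
  shows "simil u \<in> carrier SE6"
  unfolding simil_def
proof (rule diag_map_SE6)
  show "oct_trace (inverse (oct_norm u) *s ((u \<odot> A) \<odot> u) \<odot> ((oct_cnj u \<odot> B) \<odot> (inverse (oct_norm u) *s (C \<odot> oct_cnj u)))) =
       oct_trace (A \<odot> (B \<odot> C))" for A B C
    using assms by (simp add: oct_linear trace_similitude field_simps)
qed (use assms in \<open>simp_all add: linI oct_linear oct_norm_mult vector_add_ldistrib field_simps\<close>)

subsection \<open>Orbits and stabilizers\<close>

definition function_group :: "('x \<Rightarrow> 'x) set \<Rightarrow> bool" where
  "function_group G \<longleftrightarrow> (\<forall>g\<in>G. bij g \<and> inv_into UNIV g \<in> G) \<and> (\<forall>g\<in>G. \<forall>h\<in>G. g \<circ> h \<in> G)"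

lemma function_group_stabilizer:
  assumes "function_group G" shows "function_group {g \<in> G. g x = x}"
  using assms unfolding function_group_def by (auto simp: bij_is_inj inv_f_eq)

lemma card_orbit_stabilizer:
  fixes G :: "('x::finite \<Rightarrow> 'x) set"
  assumes G: "function_group G" and X: "\<And>g. g \<in> G \<Longrightarrow> g x0 \<in> X"
    and trans: "\<And>x. x \<in> X \<Longrightarrow> \<exists>g\<in>G. g x = x0"
  shows "card G = card X * card {g \<in> G. g x0 = x0}"
proof -
  obtain t where t: "\<And>x. x \<in> X \<Longrightarrow> t x \<in> G \<and> t x x = x0"
    using trans by metis
  have b: "bij g" "inv_into UNIV g \<in> G" if "g \<in> G" for g
    using G that by (auto simp: function_group_def)
  have c: "g \<circ> h \<in> G" if "g \<in> G" "h \<in> G" for g h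
    using G that by (auto simp: function_group_def)
  have i: "inv_into UNIV g (g x) = x" "g (inv_into UNIV g x) = x" if "g \<in> G" for g x
    using b[OF that] by (auto simp: bij_is_inj bij_is_surj surj_f_inv_f)
  \<comment> \<open>Since \<open>t x\<close> carries \<open>x\<close> back to \<open>x0\<close>,
    every \<open>g\<close> splits uniquely into the point \<open>g x0\<close> and an element of the
    stabilizer.\<close>
  have "bij_betw (\<lambda>g. (g x0, t (g x0) \<circ> g)) G (X \<times> {g \<in> G. g x0 = x0})"
  proof (rule bij_betw_byWitness[where f' = "\<lambda>(x, s). inv_into UNIV (t x) \<circ> s"])
    show "\<forall>g\<in>G. (case (g x0, t (g x0) \<circ> g) of (x, s) \<Rightarrow> inv_into UNIV (t x) \<circ> s) = g"
      using t X by (auto simp: fun_eq_iff i)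
    have ix: "inv_into UNIV (t x) x0 = x" if "x \<in> X" for x
      using t[OF that] i(1)[of "t x" x] by simp
    show "\<forall>a'\<in>X \<times> {g \<in> G. g x0 = x0}. (\<lambda>g. (g x0, t (g x0) \<circ> g)) (case a' of (x, s) \<Rightarrow> inv_into UNIV (t x) \<circ> s) = a'"
      using t by (auto simp: fun_eq_iff i ix)
    show "(\<lambda>g. (g x0, t (g x0) \<circ> g)) ` G \<subseteq> X \<times> {g \<in> G. g x0 = x0}"
      using t X c by auto
    show "(\<lambda>(x, s). inv_into UNIV (t x) \<circ> s) ` (X \<times> {g \<in> G. g x0 = x0}) \<subseteq> G"
      using t b c by auto
  qed
  then show ?thesis
    by (simp add: bij_betw_same_card card_cartesian_product)
qed

lemma function_group_SE6: "function_group (carrier SE6)"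
  by (simp add: function_group_def SE6_bij SE6_inv SE6_comp)

subsection \<open>Elements of rank one\<close>

definition rank1 :: "'a::comm_ring_1 albert \<Rightarrow> bool" where
  "rank1 x \<longleftrightarrow> x \<noteq> 0 \<and> (\<forall>y. det_deriv x y = 0)"

text \<open>\<open>D(x, y)\<close> pairs \<open>y\<close> with Freudenthal's adjoint of
  \<open>x\<close>. The equations say that all its coordinates, the analogues of the 2 by 2 minors,
  vanish; nondegeneracy of \<open>oct_inner\<close> extracts them one at a time.\<close>

lemma rank1_herm:
  "rank1 (herm a b c A B C) \<longleftrightarrow> herm a b c A B C \<noteq> 0 \<and> b * c = oct_norm A \<and> c * a = oct_norm B \<and> a * b = oct_norm C \<and>
     B \<odot> C = a *s oct_cnj A \<and> C \<odot> A = b *s oct_cnj B \<and> A \<odot> B = c *s oct_cnj C"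
proof -
  have *: "- a * oct_inner A A' + oct_trace (A' \<odot> X) = oct_inner A' (oct_cnj (X - a *s oct_cnj A))" for a and A A' X :: "'a oct"
    by (simp add: oct_inner_def oct_linear oct_cnj_linear oct_trace_commute[of A] oct_trace_cnj[of "A' \<odot> oct_cnj A", symmetric] oct_cnj_mult
        del: oct_trace_cnj)
  have "det_deriv (herm a b c A B C) (herm a' b' c' A' B' C') = a' * (b * c - oct_norm A) + b' * (c * a - oct_norm B) + c' * (a * b - oct_norm C)
    + oct_inner A' (oct_cnj (B \<odot> C - a *s oct_cnj A)) + oct_inner B' (oct_cnj (C \<odot> A - b *s oct_cnj B))
    + oct_inner C' (oct_cnj (A \<odot> B - c *s oct_cnj C))" for a' b' c' A' B' C'
    unfolding *[symmetric] det_deriv_herm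
    by (simp add: oct_trace_cycle[of A B'] oct_trace_cycle[of C' A B] algebra_simps)
  note D = this
  show ?thesis
  proof (cases "\<forall>y. det_deriv (herm a b c A B C) y = 0")
    case True
    note T = True[rule_format, of "herm _ _ _ _ _ _", unfolded D]
    have "oct_cnj (B \<odot> C - a *s oct_cnj A) = 0"
      using T[of 0 0 0 _ 0 0] by (intro oct_inner_nondegenerate) (simp add: oct_linear oct_inner_commute)
    then have "B \<odot> C - a *s oct_cnj A = 0" by (metis oct_cnj_cnj oct_cnj_linear(4))
    moreover have "oct_cnj (C \<odot> A - b *s oct_cnj B) = 0"
      using T[of 0 0 0 0 _ 0] by (intro oct_inner_nondegenerate) (simp add: oct_linear oct_inner_commute)
    then have "C \<odot> A - b *s oct_cnj B = 0" by (metis oct_cnj_cnj oct_cnj_linear(4))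
    moreover have "oct_cnj (A \<odot> B - c *s oct_cnj C) = 0"
      using T[of 0 0 0 0 0] by (intro oct_inner_nondegenerate) (simp add: oct_linear oct_inner_commute)
    then have "A \<odot> B - c *s oct_cnj C = 0" by (metis oct_cnj_cnj oct_cnj_linear(4))
    ultimately show ?thesis
      using True T[of 1 0 0 0 0 0] T[of 0 1 0 0 0 0] T[of 0 0 1 0 0 0] by (simp add: rank1_def oct_linear)
  next
    case False
    then obtain y where y: "det_deriv (herm a b c A B C) y \<noteq> 0" by blast
    obtain a' b' c' A' B' C' where "y = herm a' b' c' A' B' C'" by (rule herm_exhaust)
    with y have "\<not> (b * c = oct_norm A \<and> c * a = oct_norm B \<and> a * b = oct_norm C \<and>
     B \<odot> C = a *s oct_cnj A \<and> C \<odot> A = b *s oct_cnj B \<and> A \<odot> B = c *s oct_cnj C)"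
      by (auto simp: D oct_linear oct_cnj_linear)
    with False show ?thesis by (auto simp: rank1_def)
  qed
qed

lemma SE6_rank1: "g \<in> carrier SE6 \<Longrightarrow> rank1 x \<Longrightarrow> rank1 (g x)"
proof -
  assume g: "g \<in> carrier SE6" and x: "rank1 x"
  have "det_deriv (g x) y = 0" for y
  proof -
    obtain z where "y = g z" using SE6_bij[OF g] by (metis bij_pointE)
    then show ?thesis using x by (simp add: SE6_deriv[OF g] rank1_def)
  qed
  then show "rank1 (g x)"
    using x SE6_eq_iff[OF g, of x 0] by (auto simp: rank1_def SE6_zero[OF g])
qed

subsection \<open>Conjugates of the generators\<close>

text \<open>The digits give the position of the off-diagonal entry. In \<open>shear21\<close>,
  \<open>shear32\<close> and \<open>shear13\<close> that entry is \<open>oct_cnj r\<close>, so that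
  here too the octonion coordinate itself moves by a multiple of \<open>r\<close>.\<close>

definition shear23 :: "'a::field oct \<Rightarrow> 'a albert \<Rightarrow> 'a albert" where
  "shear23 r = cyc \<circ> cyc \<circ> shear r \<circ> cyc"
definition shear31 :: "'a::field oct \<Rightarrow> 'a albert \<Rightarrow> 'a albert" where
  "shear31 r = cyc \<circ> shear r \<circ> cyc \<circ> cyc"
definition shear21 :: "'a::field oct \<Rightarrow> 'a albert \<Rightarrow> 'a albert" where
  "shear21 r = transpose12 \<circ> shear (oct_cnj r) \<circ> transpose12"
definition shear32 :: "'a::field oct \<Rightarrow> 'a albert \<Rightarrow> 'a albert" where
  "shear32 r = cyc \<circ> cyc \<circ> shear21 r \<circ> cyc"
definition shear13 :: "'a::field oct \<Rightarrow> 'a albert \<Rightarrow> 'a albert" where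
  "shear13 r = cyc \<circ> shear21 r \<circ> cyc \<circ> cyc"
definition transpose23 :: "'a::field albert \<Rightarrow> 'a albert" where
  "transpose23 = cyc \<circ> cyc \<circ> transpose12 \<circ> cyc"

lemma oct_inner_cnj: "oct_inner (oct_cnj x) (oct_cnj y) = oct_inner x y"
  by (simp add: oct_inner_eq algebra_simps)

lemma conjugate_herm:
  "shear23 r (herm a b c A B C) = herm a (b + oct_inner A r + oct_norm r * c) c (A + c *s r) B (C + oct_cnj B \<odot> oct_cnj r)"
  "shear31 r (herm a b c A B C) = herm a b (c + oct_inner B r + oct_norm r * a) (A + oct_cnj C \<odot> oct_cnj r) (B + a *s r) C"
  "shear21 r (herm a b c A B C) = herm a (b + oct_inner C r + oct_norm r * a) c (A + oct_cnj r \<odot> oct_cnj B) B (C + a *s r)"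
  "shear32 r (herm a b c A B C) = herm a b (c + oct_inner A r + oct_norm r * b) (A + b *s r) (B + oct_cnj r \<odot> oct_cnj C) C"
  "shear13 r (herm a b c A B C) = herm (a + oct_inner B r + oct_norm r * c) b c A (B + c *s r) (C + oct_cnj r \<odot> oct_cnj A)"
  "transpose23 (herm a b c A B C) = herm a c b (oct_cnj A) (oct_cnj C) (oct_cnj B)"
  by (simp_all add: shear23_def shear31_def shear21_def shear32_def shear13_def transpose23_def
      cyc_herm shear_herm transpose12_herm oct_cnj_linear oct_cnj_mult oct_inner_cnj)

lemma conjugate_SE6:
  fixes r :: "'a::{field,finite} oct"
  shows "shear23 r \<in> carrier SE6" "shear31 r \<in> carrier SE6" "shear21 r \<in> carrier SE6" "shear32 r \<in> carrier SE6"
    "shear13 r \<in> carrier SE6" "(transpose23 :: 'a albert \<Rightarrow> 'a albert) \<in> carrier SE6"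
  by (simp_all add: shear23_def shear31_def shear21_def shear32_def shear13_def transpose23_def
      SE6_comp shear_SE6 cyc_SE6 transpose12_SE6)

text \<open>The split norm takes every value; through \<open>simil\<close> this lets a diagonal
  entry be multiplied by any nonzero scalar.\<close>

definition oct_of_norm :: "'a::comm_ring_1 \<Rightarrow> 'a oct" where
  "oct_of_norm n = axis (Pos I0) 1 + axis (Neg I0) n"

lemma oct_norm_of_norm [simp]: "oct_norm (oct_of_norm n) = n"
  by (simp add: oct_norm_eq oct_of_norm_def axis_def)

abbreviation "E1 \<equiv> herm 1 0 0 0 0 0"
abbreviation "E2 \<equiv> herm 0 1 0 0 0 0"
abbreviation "E3 \<equiv> herm 0 0 1 0 0 0"

lemma oct_inner_nonzero:
  fixes x :: "'a::comm_ring_1 oct"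
  shows "x \<noteq> 0 \<Longrightarrow> \<exists>r. oct_inner x r \<noteq> 0"
  using oct_inner_nondegenerate by blast

lemma ex_SE6_Ja_nonzero:
  fixes u :: "'a::{field,finite} albert"
  assumes "u \<noteq> 0"
  shows "\<exists>g\<in>carrier SE6. g u $ Ja \<noteq> 0"
proof -
  obtain a b c A B C where u: "u = herm a b c A B C" by (rule herm_exhaust)
  have c1: "(cyc :: 'a albert \<Rightarrow> _) \<in> carrier SE6" by (rule cyc_SE6)
  note c2 = SE6_comp[OF c1 c1]
  have "a \<noteq> 0 \<or> b \<noteq> 0 \<or> c \<noteq> 0 \<or> A \<noteq> 0 \<or> B \<noteq> 0 \<or> C \<noteq> 0"
    using assms unfolding u by (metis herm_zero)
  then consider "a \<noteq> 0" | "b \<noteq> 0" | "c \<noteq> 0" | "a = 0" "b = 0" "c = 0" "C \<noteq> 0" | "a = 0" "b = 0" "c = 0" "A \<noteq> 0"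
    | "a = 0" "b = 0" "c = 0" "B \<noteq> 0"
    by blast
  then show ?thesis
  proof cases
    case 1 then show ?thesis by (intro bexI[OF _ SE6_id]) (simp add: u)
  next
    case 2 then show ?thesis by (intro bexI[OF _ c1]) (simp add: u cyc_herm)
  next
    case 3 then show ?thesis by (intro bexI[OF _ c2]) (simp add: u cyc_herm)
  next
    case 4
    then obtain r where "oct_inner C r \<noteq> 0" using oct_inner_nonzero by blast
    with 4 show ?thesis by (intro bexI[OF _ shear_SE6[of r]]) (simp add: u shear_herm)
  next
    case 5
    then obtain r where "oct_inner A r \<noteq> 0" using oct_inner_nonzero by blast
    with 5 show ?thesis by (intro bexI[OF _ SE6_comp[OF shear_SE6[of r] c1]]) (simp add: u shear_herm cyc_herm)
  next
    case 6
    then obtain r where "oct_inner B r \<noteq> 0" using oct_inner_nonzero by blast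
    with 6 show ?thesis by (intro bexI[OF _ SE6_comp[OF shear_SE6[of r] c2]]) (simp add: u shear_herm cyc_herm)
  qed
qed

text \<open>Gaussian elimination with the first diagonal entry as pivot. Once its row is cleared,
  the rank-one equations annihilate the complementary block.\<close>

lemma SE6_transitive_rank1:
  fixes u :: "'a::{field,finite} albert"
  assumes u: "rank1 u"
  shows "\<exists>g\<in>carrier SE6. g u = E1"
proof -
  obtain g1 where g1: "g1 \<in> carrier SE6" "g1 u $ Ja \<noteq> 0"
    using u ex_SE6_Ja_nonzero by (auto simp: rank1_def)
  obtain a b c A B C where x: "g1 u = herm a b c A B C" by (rule herm_exhaust)
  with g1 have a: "a \<noteq> 0" by simp
  define g2 where "g2 = shear21 ((- inverse a) *s C) \<circ> g1"
  have g2: "g2 \<in> carrier SE6" by (simp add: g2_def SE6_comp conjugate_SE6 g1)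
  obtain b' A' where x2: "g2 u = herm a b' c A' B 0"
    using a by (simp add: g2_def x conjugate_herm vector_smult_assoc)
  define g3 where "g3 = shear31 ((- inverse a) *s B) \<circ> g2"
  have g3: "g3 \<in> carrier SE6" by (simp add: g3_def SE6_comp conjugate_SE6 g2)
  obtain b' c' A' where x3: "g3 u = herm a b' c' A' 0 0"
    using a by (simp add: g3_def x2 conjugate_herm vector_smult_assoc)
  have "rank1 (g3 u)" by (rule SE6_rank1[OF g3 u])
  then have "b' = 0" "c' = 0" "a *s oct_cnj A' = 0"
    using a unfolding x3 rank1_herm by (auto simp: oct_linear)
  then have "oct_cnj A' = 0" using a by (simp add: vec.scale_eq_0_iff)
  then have "A' = 0" by (metis oct_cnj_cnj oct_cnj_linear(4))
  with x3 \<open>b' = 0\<close> \<open>c' = 0\<close> have x3: "g3 u = herm a 0 0 0 0 0" by simp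
  \<comment> \<open>\<open>simil\<close> multiplies the third diagonal entry by the norm;
    \<open>cyc\<close> first brings \<open>a\<close> there, and two more turns bring it
    back.\<close>
  have n: "oct_norm (oct_of_norm (inverse a)) \<noteq> 0" using a by simp
  show ?thesis
  proof (intro bexI)
    show "(cyc \<circ> cyc \<circ> simil (oct_of_norm (inverse a)) \<circ> cyc \<circ> g3) u = E1"
      using a by (simp add: x3 cyc_herm simil_herm oct_linear)
    show "cyc \<circ> cyc \<circ> simil (oct_of_norm (inverse a)) \<circ> cyc \<circ> g3 \<in> carrier SE6"
      by (intro SE6_comp cyc_SE6 g3 simil_SE6 n)
  qed
qed

text \<open>The hypotheses are the values at \<open>albert_one\<close>, hence necessary. They
  suffice by elimination with operations fixing \<open>E1\<close>: shears inside the lower 2 by 2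
  block, and shears that add to the first row.\<close>

lemma SE6_fix_E1_to_one:
  fixes y :: "'a::{field,finite} albert"
  assumes "albert_det y = 1" "det_deriv y E1 = 1"
  shows "\<exists>h\<in>carrier SE6. h E1 = E1 \<and> h y = albert_one"
proof -
  have 1: "\<exists>h\<in>carrier SE6. h E1 = E1 \<and> h y $ Jb \<noteq> 0"
  proof -
    obtain a b c A B C where y: "y = herm a b c A B C" by (rule herm_exhaust)
    \<comment> \<open>This is the determinant of the lower block. It excludes the zero block, so a
      nonzero entry can be brought to position \<open>b\<close>.\<close>
    have *: "b * c - oct_norm A = 1" using assms(2) by (simp add: y det_deriv_herm oct_linear)
    consider "b \<noteq> 0" | "c \<noteq> 0" | "b = 0" "c = 0" "A \<noteq> 0"
      using * by (cases "b = 0"; cases "c = 0"; cases "A = 0") auto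
    then show ?thesis
    proof cases
      case 1 then show ?thesis by (intro bexI[OF _ SE6_id]) (simp add: y)
    next
      case 2 then show ?thesis by (intro bexI[OF _ conjugate_SE6(6)]) (simp add: y conjugate_herm oct_cnj_linear)
    next
      case 3
      then obtain r where "oct_inner A r \<noteq> 0" using oct_inner_nonzero by blast
      with 3 show ?thesis by (intro bexI[OF _ conjugate_SE6(1)[of r]]) (simp add: y conjugate_herm oct_linear oct_cnj_linear)
    qed
  qed
  then obtain h1 where h1: "h1 \<in> carrier SE6" "h1 E1 = E1" "h1 y $ Jb \<noteq> 0" by blast
  obtain a b c A B C where x: "h1 y = herm a b c A B C" by (rule herm_exhaust)
  with h1 have b: "b \<noteq> 0" by simp
  \<comment> \<open>The shear clears \<open>A\<close> and \<open>simil\<close> divides the pivot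
    \<open>b\<close> by itself. The block becomes \<open>diag(1, c')\<close>, and invariance of
    \<open>D(y, E1)\<close> forces \<open>c' = 1\<close>.\<close>
  define h2 where "h2 = simil (oct_of_norm b) \<circ> shear32 ((- inverse b) *s A) \<circ> h1"
  have h2: "h2 \<in> carrier SE6"
    unfolding h2_def using b by (intro SE6_comp conjugate_SE6 simil_SE6 h1) simp
  have h2e: "h2 E1 = E1" by (simp add: h2_def h1 conjugate_herm simil_herm oct_linear oct_cnj_linear)
  obtain c' B' C' where x2: "h2 y = herm a 1 c' 0 B' C'"
    using b by (simp add: h2_def x conjugate_herm simil_herm vector_smult_assoc oct_linear)
  have "det_deriv (h2 y) (h2 E1) = 1" using assms by (simp add: SE6_deriv[OF h2])
  then have "c' = 1" unfolding h2e x2 det_deriv_herm by (simp add: oct_linear)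
  note x2 = x2[unfolded this]
  define h3 where "h3 = shear13 (- B') \<circ> shear (- C') \<circ> h2"
  have h3: "h3 \<in> carrier SE6"
    unfolding h3_def by (intro SE6_comp conjugate_SE6 shear_SE6 h2)
  have h3e: "h3 E1 = E1" by (simp add: h3_def h2e conjugate_herm shear_herm oct_linear oct_cnj_linear)
  \<comment> \<open>With \<open>A = 0\<close>, clearing \<open>B'\<close> and \<open>C'\<close>
    changes only the first diagonal entry, which \<open>det\<close> then determines.\<close>
  obtain a' where x3: "h3 y = herm a' 1 1 0 0 0"
    by (simp add: h3_def x2 conjugate_herm shear_herm oct_linear oct_cnj_linear)
  have "albert_det (h3 y) = 1" using assms by (simp add: SE6_det[OF h3])
  then have "a' = 1" unfolding x3 albert_det_herm by (simp add: oct_linear)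
  with h3 h3e x3 show ?thesis by (auto simp: albert_one_def)
qed

lemma one_minus_E1: "albert_one = E1 + herm 0 1 1 0 0 0"
  by (simp add: albert_one_def herm_add)

text \<open>Again the idempotent is normalized first and the identity repaired afterwards, now with
  operations that fix both \<open>E1\<close> and \<open>E2\<close>.\<close>

lemma SE6_fix_E1_one_to_E2:
  fixes A :: "'a::{field,finite} oct"
  assumes "b * (1 - b) = oct_norm A"
  shows "\<exists>g\<in>carrier SE6. g E1 = E1 \<and> g albert_one = albert_one \<and> g (herm 0 b (1 - b) A 0 0) = E2"
proof -
  have *: "\<exists>g\<in>carrier SE6. g E1 = E1 \<and> g albert_one = albert_one \<and> g (herm 0 b (1 - b) A 0 0) = E2"
    if n: "b * (1 - b) = oct_norm A" and b: "b \<noteq> 0" for b and A :: "'a oct"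
  proof -
    have c: "1 - b = inverse b * oct_norm A" using b by (simp flip: n)
    define g1 where "g1 = simil (oct_of_norm b) \<circ> shear32 ((- inverse b) *s A)"
    have g1: "g1 \<in> carrier SE6"
      unfolding g1_def using b by (intro SE6_comp conjugate_SE6 simil_SE6) simp
    have g1e: "g1 E1 = E1" by (simp add: g1_def conjugate_herm simil_herm oct_linear oct_cnj_linear)
    have g1v: "g1 (herm 0 b (1 - b) A 0 0) = E2"
      using b unfolding c
      by (simp add: g1_def conjugate_herm simil_herm oct_linear oct_cnj_linear vector_smult_assoc oct_inner_self)
    obtain b' c' A' where x: "g1 (herm 0 1 1 0 0 0) = herm 0 b' c' A' 0 0"
      using b by (simp add: g1_def conjugate_herm simil_herm oct_linear oct_cnj_linear)
    have "det_deriv (g1 (herm 0 1 1 0 0 0)) (g1 E1) = 1" by (simp add: SE6_deriv[OF g1] det_deriv_herm oct_linear)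
    then have d: "b' * c' - oct_norm A' = 1" unfolding g1e x by (simp add: det_deriv_herm oct_linear)
    \<comment> \<open>The complement \<open>E2 + E3 - v\<close> has a block of determinant 0 while
      that of \<open>E2 + E3\<close> is 1; subtracting the two transported equations gives
      \<open>c' = 1\<close>.\<close>
    have "det_deriv (g1 (herm 0 1 1 0 0 0 - herm 0 b (1 - b) A 0 0)) (g1 E1) = 0"
      using n by (simp add: SE6_deriv[OF g1] det_deriv_herm oct_linear herm_diff algebra_simps)
    then have "(b' - 1) * c' - oct_norm A' = 0" unfolding SE6_diff[OF g1] g1v g1e x by (simp add: det_deriv_herm oct_linear herm_diff)
    with d have "c' = 1" by (simp add: algebra_simps)
    note x = x[unfolded this] and d = d[unfolded this]
    define g2 where "g2 = shear23 (- A') \<circ> g1"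
    have g2: "g2 \<in> carrier SE6"
      unfolding g2_def by (intro SE6_comp conjugate_SE6 g1)
    have g2e: "g2 E1 = E1" "g2 (herm 0 b (1 - b) A 0 0) = E2"
      by (simp_all add: g2_def g1e g1v conjugate_herm oct_linear oct_cnj_linear)
    have g2x: "g2 (herm 0 1 1 0 0 0) = herm 0 1 1 0 0 0"
      using d by (simp add: g2_def x conjugate_herm oct_linear oct_cnj_linear oct_inner_self algebra_simps)
    show ?thesis
      using g2 g2e g2x by (auto simp: one_minus_E1 SE6_add[OF g2])
  qed
  show ?thesis
  proof (cases "b = 0")
    case True
    \<comment> \<open>If \<open>b = 0\<close>, then \<open>c = 1\<close>, and exchanging axes 2 and
      3 reduces to the case already settled.\<close>
    with assms have "1 * (1 - 1) = oct_norm (oct_cnj A)" by simp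
    from *[OF this] obtain g where g: "g\<in>carrier SE6" "g E1 = E1" "g albert_one = albert_one" "g (herm 0 1 (1 - 1) (oct_cnj A) 0 0) = E2"
      by auto
    show ?thesis
      using g True
      by (intro bexI[OF _ SE6_comp[OF g(1) conjugate_SE6(6)]]) (simp add: conjugate_herm oct_cnj_linear albert_one_def)
  qed (use * assms in blast)
qed

subsection \<open>Counting elements of rank one\<close>

lemma card_times_eq:
  fixes s :: "'a::{field,finite}"
  shows "int (card {(a, b). a * b = s}) = int CARD('a) - 1 + (if s = 0 then int CARD('a) else 0)"
proof -
  have "{(a, b). a * b = s} = Sigma UNIV (\<lambda>a. {b. a * b = s})" by auto
  then have "card {(a, b). a * b = s} = (\<Sum>a\<in>UNIV. card {b. a * b = s})"
    by simp
  also have "\<dots> = card {b. 0 * b = s} + (\<Sum>a\<in>UNIV - {0}. card {b. a * b = s})"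
    by (rule sum.remove) auto
  also have "(\<Sum>a\<in>UNIV - {0}. card {b. a * b = s}) = (\<Sum>a\<in>UNIV - {0::'a}. 1)"
  proof (rule sum.cong[OF refl])
    fix a :: 'a assume "a \<in> UNIV - {0}"
    then have "{b. a * b = s} = {s / a}" by (auto simp: field_simps)
    then show "card {b. a * b = s} = 1" by simp
  qed
  also have "\<dots> = CARD('a) - 1" by (simp add: card_Diff_subset)
  finally show ?thesis
    by (auto simp: of_nat_diff Suc_leI card_gt_0_iff)
qed

text \<open>Adding a hyperbolic plane to a form: each \<open>x\<close> has \<open>q - 1\<close>
  completions, and \<open>q\<close> further ones exactly when \<open>h x = t\<close>. Four planes
  make up the octonion norm.\<close>

lemma card_plus_plane:
  fixes h :: "'x \<Rightarrow> 'a::{field,finite}"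
  assumes "finite X"
  shows "int (card {(x, a, b). x \<in> X \<and> h x + a * b = t}) =
    int (card X) * (int CARD('a) - 1) + int CARD('a) * int (card {x \<in> X. h x = t})"
proof -
  have "{(x, a, b). x \<in> X \<and> h x + a * b = t} = Sigma X (\<lambda>x. {(a, b). a * b = t - h x})"
    by (auto simp: eq_diff_eq add.commute)
  then have "int (card {(x, a, b). x \<in> X \<and> h x + a * b = t}) = (\<Sum>x\<in>X. int (card {(a, b). a * b = t - h x}))"
    using assms by simp
  also have "\<dots> = (\<Sum>x\<in>X. (int CARD('a) - 1) + int CARD('a) * of_bool (h x = t))"
    by (intro sum.cong) (auto simp: card_times_eq)
  also have "\<dots> = int (card X) * (int CARD('a) - 1) + int CARD('a) * (\<Sum>x\<in>X. of_bool (h x = t))"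
    by (simp add: sum.distrib sum_distrib_left)
  also have "(\<Sum>x\<in>X. of_bool (h x = t)) = int (card {x \<in> X. h x = t})"
    using assms by (simp add: of_bool_def sum.If_cases Int_def)
  finally show ?thesis .
qed

text \<open>The coordinates are nested as hyperbolic planes \<open>e_i\<close>,
  \<open>e_{-i}\<close>, the shape in which \<open>card_plus_plane\<close> is iterated.\<close>

definition oct_of_planes :: "(((('a \<times> 'a) \<times> 'a \<times> 'a) \<times> 'a \<times> 'a) \<times> 'a \<times> 'a) \<Rightarrow> 'a oct" where
  "oct_of_planes = (\<lambda>((((a, a'), b, b'), c, c'), d, d'). \<chi> l. case l of
     Pos I0 \<Rightarrow> a | Neg I0 \<Rightarrow> a' | Pos I1 \<Rightarrow> b | Neg I1 \<Rightarrow> b' | Pos I\<omega> \<Rightarrow> c | Neg I\<omega> \<Rightarrow> c' | Pos I\<omega>' \<Rightarrow> d | Neg I\<omega>' \<Rightarrow> d')"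

lemma card_oct_norm_eq:
  "int (card {A :: 'a::{field,finite} oct. oct_norm A = t}) =
    int CARD('a) ^ 7 - int CARD('a) ^ 3 + (if t = 0 then int CARD('a) ^ 4 else 0)"
proof -
  define q where "q = int CARD('a)"
  let ?h2 = "\<lambda>(a, b). a * b :: 'a" and ?h3 = "\<lambda>((a, b), c, d). a * b + c * d :: 'a"
    and ?h4 = "\<lambda>(((a, b), c, d), e, f). a * b + c * d + e * f :: 'a"
  have c1: "int (card {x \<in> UNIV. ?h2 x = t}) = q - 1 + (if t = 0 then q else 0)"
    using card_times_eq[of t] by (simp add: q_def case_prod_unfold)
  have c2: "int (card {x \<in> UNIV. ?h3 x = t}) = q^2 * (q - 1) + q * (q - 1 + (if t = 0 then q else 0))"
    using card_plus_plane[of UNIV ?h2 t] c1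
    by (simp add: q_def case_prod_unfold card_prod power2_eq_square)
  have c3: "int (card {x \<in> UNIV. ?h4 x = t}) = q^4 * (q - 1) + q * (q^2 * (q - 1) + q * (q - 1 + (if t = 0 then q else 0)))"
    using card_plus_plane[of UNIV ?h3 t] c2
    by (simp add: q_def case_prod_unfold card_prod eval_nat_numeral mult.assoc)
  have c4: "int (card {(x, a, b). ?h4 x + a * b = t}) = q^6 * (q - 1) + q * (q^4 * (q - 1) + q * (q^2 * (q - 1) + q * (q - 1 + (if t = 0 then q else 0))))"
    using card_plus_plane[of UNIV ?h4 t] c3
    by (simp add: q_def case_prod_unfold card_prod eval_nat_numeral mult.assoc)
  have "bij_betw oct_of_planes {(x, a, b). ?h4 x + a * b = t} {A. oct_norm A = t}"
  proof (rule bij_betwI[where g = "\<lambda>A. ((((A $ Pos I0, A $ Neg I0), A $ Pos I1, A $ Neg I1), A $ Pos I\<omega>, A $ Neg I\<omega>), A $ Pos I\<omega>', A $ Neg I\<omega>')"])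
  qed (auto simp: oct_of_planes_def oct_eq_iff oct_norm_eq)
  then have "card {(x, a, b). ?h4 x + a * b = t} = card {A. oct_norm A = t}"
    by (rule bij_betw_same_card)
  with c4 have "int (card {A :: 'a oct. oct_norm A = t}) = q^6 * (q - 1) + q * (q^4 * (q - 1) + q * (q^2 * (q - 1) + q * (q - 1 + (if t = 0 then q else 0))))"
    by simp
  then show ?thesis
    unfolding q_def[symmetric] by (simp add: eval_nat_numeral algebra_simps)
qed

lemma card_oct: "CARD('a::finite oct) = CARD('a) ^ 8"
proof -
  have "CARD(label) = 8" by (simp add: UNIV_label)
  then show ?thesis by simp
qed

lemma card_Sigma_oct_norm_eq:
  fixes h :: "'x \<Rightarrow> 'a::{field,finite}"
  assumes "finite X"
  shows "int (card (Sigma X (\<lambda>x. {A. oct_norm A = h x}))) =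
    int (card X) * (int CARD('a) ^ 7 - int CARD('a) ^ 3) + int CARD('a) ^ 4 * int (card {x \<in> X. h x = 0})"
proof -
  have "int (card (Sigma X (\<lambda>x. {A. oct_norm A = h x}))) = (\<Sum>x\<in>X. int (card {A. oct_norm A = h x}))"
    using assms by simp
  also have "\<dots> = (\<Sum>x\<in>X. (int CARD('a) ^ 7 - int CARD('a) ^ 3) + int CARD('a) ^ 4 * of_bool (h x = 0))"
    by (intro sum.cong) (auto simp: card_oct_norm_eq)
  also have "\<dots> = int (card X) * (int CARD('a) ^ 7 - int CARD('a) ^ 3) + int CARD('a) ^ 4 * (\<Sum>x\<in>X. of_bool (h x = 0))"
    by (simp add: sum.distrib sum_distrib_left)
  also have "(\<Sum>x\<in>X. of_bool (h x = 0)) = int (card {x \<in> X. h x = 0})"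
    using assms by (simp add: of_bool_def sum.If_cases Int_def)
  finally show ?thesis .
qed

section \<open>Enumeration of the two families of idempotents\<close>

definition E1_complements :: "'a::field albert set" where
  "E1_complements = {v. rank1 v \<and> rank1 (albert_one - E1 - v)}"

text \<open>Both \<open>v\<close> and its complement satisfy the rank-one equations with the same
  octonion products up to sign. Equating the two versions leaves linear conditions that force
  \<open>c = 1 - b\<close>, \<open>a = 0\<close> and \<open>B = C = 0\<close> in every
  characteristic.\<close>

lemma E1_complements_eq:
  "E1_complements = (\<lambda>(b, A). herm 0 b (1 - b) A 0 0) ` Sigma UNIV (\<lambda>b. {A. oct_norm A = b * (1 - b)})"
proof (intro equalityI subsetI)
  fix v :: "'a albert" assume v: "v \<in> E1_complements"
  obtain a b c A B C where h: "v = herm a b c A B C" by (rule herm_exhaust)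
  have w: "albert_one - E1 - v = herm (- a) (1 - b) (1 - c) (- A) (- B) (- C)"
    by (simp add: albert_one_def h herm_diff)
  have r: "b * c = oct_norm A \<and> c * a = oct_norm B \<and> a * b = oct_norm C \<and> B \<odot> C = a *s oct_cnj A \<and> C \<odot> A = b *s oct_cnj B \<and> A \<odot> B = c *s oct_cnj C"
    "(1 - b) * (1 - c) = oct_norm A \<and> (1 - c) * (- a) = oct_norm B \<and> - a * (1 - b) = oct_norm C
     \<and> C \<odot> A = - ((1 - b) *s oct_cnj B) \<and> A \<odot> B = - ((1 - c) *s oct_cnj C)"
    using v unfolding E1_complements_def h mem_Collect_eq w[unfolded h] rank1_herm by (auto simp: oct_linear oct_cnj_linear)
  have bc: "b * c = (1 - b) * (1 - c)" using r by simp
  then have c: "c = 1 - b" by (simp add: algebra_simps)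
  have "c * a = (1 - c) * (- a)" using r by simp
  then have a: "a = 0" by (simp add: algebra_simps)
  have "b *s oct_cnj B + (1 - b) *s oct_cnj B = 0" using r by (metis add.left_inverse)
  then have "oct_cnj B = 0" by (simp flip: vector_sadd_rdistrib)
  then have B: "B = 0" by (metis oct_cnj_cnj oct_cnj_linear(4))
  have "c *s oct_cnj C + (1 - c) *s oct_cnj C = 0" using r by (metis add.left_inverse)
  then have "oct_cnj C = 0" by (simp flip: vector_sadd_rdistrib)
  then have C: "C = 0" by (metis oct_cnj_cnj oct_cnj_linear(4))
  show "v \<in> (\<lambda>(b, A). herm 0 b (1 - b) A 0 0) ` Sigma UNIV (\<lambda>b. {A. oct_norm A = b * (1 - b)})"
  proof (rule image_eqI)
    show "v = (\<lambda>(b, A). herm 0 b (1 - b) A 0 0) (b, A)" by (simp only: h a B C c split)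
    show "(b, A) \<in> Sigma UNIV (\<lambda>b. {A. oct_norm A = b * (1 - b)})" using r(1) c by simp
  qed
next
  fix v :: "'a albert" assume "v \<in> (\<lambda>(b, A). herm 0 b (1 - b) A 0 0) ` Sigma UNIV (\<lambda>b. {A. oct_norm A = b * (1 - b)})"
  then show "v \<in> E1_complements"
    by (auto simp: E1_complements_def albert_one_def herm_diff rank1_herm oct_linear oct_cnj_linear algebra_simps)
      (auto simp: albert_eq_iff herm_zero[symmetric])
qed

lemma card_E1_complements: "int (card (E1_complements :: 'a::{field,finite} albert set)) = int CARD('a) ^ 8 + int CARD('a) ^ 4"
proof -
  let ?S = "Sigma UNIV (\<lambda>b :: 'a. {A. oct_norm A = b * (1 - b)})"
  have "inj_on (\<lambda>(b, A). herm 0 b (1 - b) A 0 0) ?S" by (auto simp: inj_on_def)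
  then have "card (E1_complements :: 'a albert set) = card ?S"
    unfolding E1_complements_eq by (rule card_image)
  moreover have "{b \<in> UNIV. b * (1 - b) = 0} = {0, 1 :: 'a}" by auto
  then have "card {b \<in> UNIV. b * (1 - b :: 'a) = 0} = 2" by simp
  ultimately show ?thesis
    using card_Sigma_oct_norm_eq[of UNIV "\<lambda>b :: 'a. b * (1 - b)"] by (simp add: eval_nat_numeral algebra_simps)
qed

definition primitive_idempotents :: "'a::field albert set" where
  "primitive_idempotents = {u. rank1 u \<and> det_deriv albert_one u = 1}"

lemma det_deriv_one_herm: "det_deriv albert_one (herm a b c A B C) = a + b + c"
  by (simp add: albert_one_def det_deriv_herm oct_linear)

text \<open>The first nonzero diagonal entry, which exists because the trace is 1, is the pivot.
  Rank one expresses the opposite block through the pivot's row, and the trace becomes a condition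
  on norms.\<close>

lemma primitive_idempotents_eq:
  "primitive_idempotents =
    (\<lambda>(a, B, C). herm a (inverse a * oct_norm C) (inverse a * oct_norm B) (inverse a *s oct_cnj (B \<odot> C)) B C)
        ` Sigma (- {0}) (\<lambda>a. {(B, C). oct_norm B + oct_norm C = a * (1 - a)})
    \<union> (\<lambda>(C, b, A). herm 0 b (1 - b) A (inverse b *s oct_cnj (C \<odot> A)) C)
        ` ({C. oct_norm C = 0} \<times> Sigma (- {0}) (\<lambda>b. {A. oct_norm A = b * (1 - b)}))
    \<union> (\<lambda>(A, B). herm 0 0 1 A B (oct_cnj (A \<odot> B))) ` ({A. oct_norm A = 0} \<times> {B. oct_norm B = 0})"
  (is "_ = ?f ` ?F \<union> ?g ` ?G \<union> ?h ` ?H")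
proof (intro equalityI subsetI)
  fix v :: "'a albert" assume v: "v \<in> primitive_idempotents"
  obtain a b c A B C where h: "v = herm a b c A B C" by (rule herm_exhaust)
  have r: "b * c = oct_norm A" "c * a = oct_norm B" "a * b = oct_norm C" "B \<odot> C = a *s oct_cnj A" "C \<odot> A = b *s oct_cnj B" "A \<odot> B = c *s oct_cnj C"
    and t: "c = 1 - a - b"
    using v by (simp_all add: primitive_idempotents_def h rank1_herm det_deriv_one_herm algebra_simps)
  consider "a \<noteq> 0" | "a = 0" "b \<noteq> 0" | "a = 0" "b = 0" by blast
  then show "v \<in> ?f ` ?F \<union> ?g ` ?G \<union> ?h ` ?H"
  proof cases
    case 1
    have "b = inverse a * oct_norm C" "c = inverse a * oct_norm B" "A = inverse a *s oct_cnj (B \<odot> C)"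
      using 1 by (simp_all add: r flip: r(2,3)) (simp add: oct_cnj_linear vector_smult_assoc)
    then have "v = ?f (a, B, C)" by (simp add: h)
    moreover have "oct_norm B + oct_norm C = a * (1 - a)"
      by (simp flip: r) (simp add: t algebra_simps)
    ultimately show ?thesis using 1 by blast
  next
    case 2
    have "B = inverse b *s oct_cnj (C \<odot> A)" "c = 1 - b"
      using 2 t by (simp_all add: r(5) oct_cnj_linear vector_smult_assoc)
    then have "v = ?g (C, b, A)" by (simp add: h 2)
    moreover have "oct_norm C = 0" "oct_norm A = b * (1 - b)"
      using 2 by (simp_all add: t flip: r)
    ultimately show ?thesis using 2 by blast
  next
    case 3
    then have "v = ?h (A, B)" "oct_norm A = 0" "oct_norm B = 0"
      by (simp_all add: h t r(6) flip: r(1,2))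
    then show ?thesis by blast
  qed
next
  fix v :: "'a albert" assume "v \<in> ?f ` ?F \<union> ?g ` ?G \<union> ?h ` ?H"
  then consider "v \<in> ?f ` ?F" | "v \<in> ?g ` ?G" | "v \<in> ?h ` ?H" by blast
  then show "v \<in> primitive_idempotents"
  proof cases
    case 1
    then obtain a B C where 1: "v = ?f (a, B, C)" "a \<noteq> 0" "oct_norm B + oct_norm C = a * (1 - a)"
      by auto
    have "a + inverse a * (oct_norm C + oct_norm B) = 1"
      using 1 by (simp add: field_simps)
    moreover have "v \<noteq> 0" using 1 by (auto simp: albert_eq_iff)
    ultimately show ?thesis using 1
      by (simp add: primitive_idempotents_def rank1_herm det_deriv_one_herm oct_linear oct_cnj_linear
          oct_cnj_mult oct_cnj_cancel oct_norm_mult vector_smult_assoc distrib_left add.assoc mult_ac)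
  next
    case 2
    then obtain C b A where 2: "v = ?g (C, b, A)" "b \<noteq> 0" "oct_norm C = 0" "oct_norm A = b * (1 - b)"
      by auto
    moreover have "v \<noteq> 0" using 2 by (auto simp: albert_eq_iff)
    ultimately show ?thesis
      by (simp add: primitive_idempotents_def rank1_herm det_deriv_one_herm oct_linear oct_cnj_linear
          oct_cnj_mult oct_cnj_cancel oct_norm_mult vector_smult_assoc)
  next
    case 3
    then obtain A B where 3: "v = ?h (A, B)" "oct_norm A = 0" "oct_norm B = 0"
      by auto
    moreover have "v \<noteq> 0" using 3 by (auto simp: albert_eq_iff)
    ultimately show ?thesis
      by (simp add: primitive_idempotents_def rank1_herm det_deriv_one_herm oct_linear oct_cnj_linear
          oct_cnj_mult oct_cnj_cancel oct_norm_mult)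
  qed
qed

lemma card_primitive_idempotents:
  "int (card (primitive_idempotents :: 'a::{field,finite} albert set)) =
     int CARD('a) ^ 16 + int CARD('a) ^ 12 + int CARD('a) ^ 8"
proof -
  define q where "q = int CARD('a)"
  have q1: "int (card (- {0 :: 'a})) = q - 1"
    by (simp add: q_def Compl_eq_Diff_UNIV card_Diff_subset of_nat_diff Suc_leI card_gt_0_iff)
  have "{b \<in> - {0}. b * (1 - b) = 0} = {1 :: 'a}" by auto
  then have c1: "card {b \<in> - {0}. b * (1 - b :: 'a) = 0} = 1" by simp
  let ?F = "Sigma (- {0}) (\<lambda>a. {(B :: 'a oct, C). oct_norm B + oct_norm C = a * (1 - a)})"
    and ?G = "{C :: 'a oct. oct_norm C = 0} \<times> Sigma (- {0 :: 'a}) (\<lambda>b. {A. oct_norm A = b * (1 - b)})"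
    and ?H = "{A :: 'a oct. oct_norm A = 0} \<times> {B :: 'a oct. oct_norm B = 0}"
  have n16: "int (card {(B :: 'a oct, C). oct_norm B + oct_norm C = s}) = q^15 - q^7 + (if s = 0 then q^8 else 0)" for s
  proof -
    have "{(B :: 'a oct, C). oct_norm B + oct_norm C = s} = Sigma UNIV (\<lambda>B. {C. oct_norm C = s - oct_norm B})"
      by (auto simp: algebra_simps)
    then have "int (card {(B :: 'a oct, C). oct_norm B + oct_norm C = s})
        = int (card (UNIV :: 'a oct set)) * (q^7 - q^3) + q^4 * int (card {x \<in> UNIV. s - oct_norm (x :: 'a oct) = 0})"
      using card_Sigma_oct_norm_eq[OF finite, of UNIV "\<lambda>B :: 'a oct. s - oct_norm B"] by (simp only: q_def)
    also have "{x \<in> UNIV. s - oct_norm (x :: 'a oct) = 0} = {x. oct_norm x = s}" by auto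
    also have "int (card \<dots>) = q^7 - q^3 + (if s = 0 then q^4 else 0)"
      by (simp add: card_oct_norm_eq q_def)
    also have "int (card (UNIV :: 'a oct set)) = q^8"
      by (simp only: card_oct q_def of_nat_power)
    finally show ?thesis
      by (simp add: eval_nat_numeral algebra_simps)
  qed
  \<comment> \<open>The root 0 of \<open>a * (1 - a)\<close> is excluded, so only
    \<open>a = 1\<close> contributes the extra isotropic term \<open>q^8\<close>.\<close>
  have "int (card ?F) = (\<Sum>a\<in>- {0 :: 'a}. q^15 - q^7 + (if a = 1 then q^8 else 0))"
    by (simp add: n16)
  also have "\<dots> = (q - 1) * (q^15 - q^7) + q^8"
    by (simp add: sum.distrib q1)
  finally have F: "int (card ?F) = (q - 1) * (q^15 - q^7) + q^8" .
  have G: "int (card ?G) = (q^7 - q^3 + q^4) * ((q - 1) * (q^7 - q^3) + q^4)"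
    using card_Sigma_oct_norm_eq[OF finite, of "- {0 :: 'a}" "\<lambda>b :: 'a. b * (1 - b)"]
    unfolding c1 q1 q_def[symmetric] card_cartesian_product
    by (simp add: card_oct_norm_eq del: card_SigmaI flip: q_def)
  have H: "int (card ?H) = (q^7 - q^3 + q^4)^2"
    by (simp add: card_cartesian_product card_oct_norm_eq power2_eq_square flip: q_def)
  let ?f = "\<lambda>(a :: 'a, B, C). herm a (inverse a * oct_norm C) (inverse a * oct_norm B) (inverse a *s oct_cnj (B \<odot> C)) B C"
    and ?g = "\<lambda>(C, b :: 'a, A). herm 0 b (1 - b) A (inverse b *s oct_cnj (C \<odot> A)) C"
    and ?h = "\<lambda>(A :: 'a oct, B). herm 0 0 1 A B (oct_cnj (A \<odot> B))"
  have i: "inj_on ?f ?F" "inj_on ?g ?G" "inj_on ?h ?H"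
    by (auto simp: inj_on_def)
  have d: "?f ` ?F \<inter> ?g ` ?G = {}" "(?f ` ?F \<union> ?g ` ?G) \<inter> ?h ` ?H = {}" by auto
  have "card (primitive_idempotents :: 'a albert set) = card ?F + card ?G + card ?H"
    unfolding primitive_idempotents_eq
    by (simp add: card_Un_disjoint d card_image i del: card_SigmaI)
  then have "int (card (primitive_idempotents :: 'a albert set)) = int (card ?F) + int (card ?G) + int (card ?H)" by simp
  then show ?thesis
    unfolding F G H q_def[symmetric] by (simp add: eval_nat_numeral algebra_simps)
qed

subsection \<open>A chain of stabilizers\<close>

abbreviation "embA A \<equiv> herm 0 0 0 A 0 0"
abbreviation "e_plus \<equiv> axis (Pos I0) 1"
abbreviation "e_minus \<equiv> axis (Neg I0) 1"

definition stab_one :: "('a::field albert \<Rightarrow> 'a albert) set" where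
  "stab_one = {g \<in> carrier SE6. g albert_one = albert_one}"
definition stab_E1 :: "('a::field albert \<Rightarrow> 'a albert) set" where
  "stab_E1 = {g \<in> stab_one. g E1 = E1}"
definition stab_frame :: "('a::field albert \<Rightarrow> 'a albert) set" where
  "stab_frame = {g \<in> stab_E1. g E2 = E2}"
definition stab_plus :: "('a::field albert \<Rightarrow> 'a albert) set" where
  "stab_plus = {g \<in> stab_frame. g (embA e_plus) = embA e_plus}"
definition stab_pair :: "('a::field albert \<Rightarrow> 'a albert) set" where
  "stab_pair = {g \<in> stab_plus. g (embA e_minus) = embA e_minus}"

lemmas stab_defs = stab_one_def stab_E1_def stab_frame_def stab_plus_def stab_pair_def

lemma function_group_stab:
  "function_group stab_one" "function_group stab_E1" "function_group stab_frame" "function_group stab_plus"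
  unfolding stab_defs by (intro function_group_stabilizer function_group_SE6)+

lemma stab_SE6: "g \<in> stab_one \<Longrightarrow> g \<in> carrier SE6" "g \<in> stab_E1 \<Longrightarrow> g \<in> carrier SE6"
  "g \<in> stab_frame \<Longrightarrow> g \<in> carrier SE6" "g \<in> stab_plus \<Longrightarrow> g \<in> carrier SE6" "g \<in> stab_pair \<Longrightarrow> g \<in> carrier SE6"
  by (simp_all add: stab_defs)

lemma rank1_E: "rank1 (E1 :: 'a::field albert)" "rank1 (E2 :: 'a albert)" "rank1 (E3 :: 'a albert)"
  by (simp_all add: rank1_herm oct_linear oct_cnj_linear herm_zero[symmetric])

lemma card_stab_one:
  "card (stab_one :: ('a::{field,finite} albert \<Rightarrow> 'a albert) set) =
     card (primitive_idempotents :: 'a albert set) * card (stab_E1 :: ('a albert \<Rightarrow> 'a albert) set)"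
  unfolding stab_E1_def
proof (rule card_orbit_stabilizer[OF function_group_stab(1)])
  fix g :: "'a albert \<Rightarrow> 'a albert" assume "g \<in> stab_one"
  then have g: "g \<in> carrier SE6" "g albert_one = albert_one" by (simp_all add: stab_one_def)
  have "det_deriv albert_one (g E1) = det_deriv (g albert_one) (g E1)" by (simp add: g)
  also have "\<dots> = 1" unfolding SE6_deriv[OF g(1)] by (simp add: det_deriv_one_herm)
  finally show "g E1 \<in> primitive_idempotents"
    using SE6_rank1[OF g(1) rank1_E(1)] by (simp add: primitive_idempotents_def)
next
  fix u :: "'a albert" assume u: "u \<in> primitive_idempotents"
  then obtain g where g: "g \<in> carrier SE6" "g u = E1"
    using SE6_transitive_rank1 by (auto simp: primitive_idempotents_def)
  \<comment> \<open>\<open>g\<close> may have moved the identity, but \<open>det\<close> and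
    \<open>D\<close> are preserved, so \<open>h\<close> can return it without moving
    \<open>E1\<close>.\<close>
  have "albert_det (g albert_one) = 1"
    unfolding SE6_det[OF g(1)] by (simp add: albert_one_def albert_det_herm oct_linear)
  moreover have "det_deriv (g albert_one) (g u) = 1"
    unfolding SE6_deriv[OF g(1)] using u by (simp add: primitive_idempotents_def)
  ultimately obtain h where h: "h \<in> carrier SE6" "h E1 = E1" "h (g albert_one) = albert_one"
    using SE6_fix_E1_to_one unfolding g(2) by blast
  show "\<exists>g\<in>stab_one. g u = E1"
    by (intro bexI[of _ "h \<circ> g"]) (simp_all add: stab_one_def SE6_comp g h)
qed

lemma E3_eq: "E3 = albert_one - E1 - (E2 :: 'a::comm_ring_1 albert)"
  by (simp add: albert_one_def herm_diff)

lemma card_stab_E1: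
  "card (stab_E1 :: ('a::{field,finite} albert \<Rightarrow> 'a albert) set) =
     card (E1_complements :: 'a albert set) * card (stab_frame :: ('a albert \<Rightarrow> 'a albert) set)"
  unfolding stab_frame_def
proof (rule card_orbit_stabilizer[OF function_group_stab(2)])
  fix g :: "'a albert \<Rightarrow> 'a albert" assume "g \<in> stab_E1"
  then have g: "g \<in> carrier SE6" "g albert_one = albert_one" "g E1 = E1" by (simp_all add: stab_defs)
  have "albert_one - E1 - g E2 = g E3" by (simp only: E3_eq SE6_diff[OF g(1)] g)
  then show "g E2 \<in> E1_complements"
    using SE6_rank1[OF g(1) rank1_E(2)] SE6_rank1[OF g(1) rank1_E(3)] by (simp add: E1_complements_def)
next
  fix v :: "'a albert" assume "v \<in> E1_complements"
  then obtain b A where "v = herm 0 b (1 - b) A 0 0" "b * (1 - b) = oct_norm A"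
    unfolding E1_complements_eq by auto
  then show "\<exists>g\<in>stab_E1. g v = E2"
    using SE6_fix_E1_one_to_E2[of b A] by (auto simp: stab_defs)
qed

section \<open>Peirce spaces and the action on the three octonion coordinates\<close>

lemma stab_frame_E: "g \<in> stab_frame \<Longrightarrow> g E1 = E1" "g \<in> stab_frame \<Longrightarrow> g E2 = E2" "g \<in> stab_frame \<Longrightarrow> g E3 = E3"
  using SE6_diff[of g] by (simp_all only: E3_eq) (simp_all add: stab_defs)

lemma det_tri_E:
  "det_tri (herm a b c A B C) E1 (herm a' b' c' A' B' C') = b' * c + c' * b - oct_inner A A'"
  "det_tri (herm a b c A B C) E2 (herm a' b' c' A' B' C') = a' * c + c' * a - oct_inner B B'"
  "det_tri (herm a b c A B C) E3 (herm a' b' c' A' B' C') = b' * a + a' * b - oct_inner C C'"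
  by (simp_all add: det_tri_def oct_linear algebra_simps)

text \<open>The radical of \<open>T(x, E_i, y)\<close> depends only on the form and
  \<open>E_i\<close>, so any isometry fixing \<open>E_i\<close> preserves it. Two such radicals
  intersect in a single octonion coordinate.\<close>

lemma Peirce_iff:
  "(\<forall>y. det_tri x E1 y = 0) \<longleftrightarrow> x $ Jb = 0 \<and> x $ Jc = 0 \<and> albA x = 0"
  "(\<forall>y. det_tri x E2 y = 0) \<longleftrightarrow> x $ Ja = 0 \<and> x $ Jc = 0 \<and> albB x = 0"
  "(\<forall>y. det_tri x E3 y = 0) \<longleftrightarrow> x $ Ja = 0 \<and> x $ Jb = 0 \<and> albC x = 0"
proof -
  obtain a b c A B C where x: "x = herm a b c A B C" by (rule herm_exhaust)
  have *: "(\<forall>y. P y) \<longleftrightarrow> (\<forall>a b c A B C. P (herm a b c A B C))" for P :: "'a albert \<Rightarrow> bool"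
    by (metis herm_exhaust)
  show "(\<forall>y. det_tri x E1 y = 0) \<longleftrightarrow> x $ Jb = 0 \<and> x $ Jc = 0 \<and> albA x = 0"
  proof (intro iffI)
    assume "\<forall>y. det_tri x E1 y = 0"
    then have H: "b' * c + c' * b - oct_inner A A' = 0" for b' c' A' by (metis x det_tri_E(1))
    then have "A = 0" by (intro oct_inner_nondegenerate) (use H[of 0 0] in simp)
    then show "x $ Jb = 0 \<and> x $ Jc = 0 \<and> albA x = 0" using H[of 1 0 0] H[of 0 1 0] by (simp add: x oct_linear)
  qed (simp add: * x det_tri_E oct_linear)
  show "(\<forall>y. det_tri x E2 y = 0) \<longleftrightarrow> x $ Ja = 0 \<and> x $ Jc = 0 \<and> albB x = 0"
  proof (intro iffI)
    assume "\<forall>y. det_tri x E2 y = 0"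
    then have H: "b' * c + c' * a - oct_inner B A' = 0" for b' c' A' by (metis x det_tri_E(2))
    then have "B = 0" by (intro oct_inner_nondegenerate) (use H[of 0 0] in simp)
    then show "x $ Ja = 0 \<and> x $ Jc = 0 \<and> albB x = 0" using H[of 1 0 0] H[of 0 1 0] by (simp add: x oct_linear)
  qed (simp add: * x det_tri_E oct_linear)
  show "(\<forall>y. det_tri x E3 y = 0) \<longleftrightarrow> x $ Ja = 0 \<and> x $ Jb = 0 \<and> albC x = 0"
  proof (intro iffI)
    assume "\<forall>y. det_tri x E3 y = 0"
    then have H: "b' * a + c' * b - oct_inner C A' = 0" for b' c' A' by (metis x det_tri_E(3))
    then have "C = 0" by (intro oct_inner_nondegenerate) (use H[of 0 0] in simp)
    then show "x $ Ja = 0 \<and> x $ Jb = 0 \<and> albC x = 0" using H[of 1 0 0] H[of 0 1 0] by (simp add: x oct_linear)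
  qed (simp add: * x det_tri_E oct_linear)
qed

lemma SE6_tri_zero:
  assumes "g \<in> carrier SE6" "g z = z"
  shows "(\<forall>y. det_tri (g x) z y = 0) \<longleftrightarrow> (\<forall>y. det_tri x z y = 0)"
proof -
  have "det_tri (g x) z (g y) = det_tri x z y" for y
    using SE6_tri[OF assms(1), of x z y] by (simp add: assms(2))
  then show ?thesis using SE6_bij[OF assms(1)] by (metis bij_pointE)
qed

lemma stab_frame_blocks:
  assumes "g \<in> stab_frame"
  shows "g (herm 0 0 0 A 0 0) = herm 0 0 0 (albA (g (herm 0 0 0 A 0 0))) 0 0"
    "g (herm 0 0 0 0 B 0) = herm 0 0 0 0 (albB (g (herm 0 0 0 0 B 0))) 0"
    "g (herm 0 0 0 0 0 C) = herm 0 0 0 0 0 (albC (g (herm 0 0 0 0 0 C)))"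
proof -
  note g = stab_SE6(3)[OF assms] and e = stab_frame_E[OF assms]
  note z = SE6_tri_zero[OF g e(1), unfolded Peirce_iff] SE6_tri_zero[OF g e(2), unfolded Peirce_iff] SE6_tri_zero[OF g e(3), unfolded Peirce_iff]
  show "g (herm 0 0 0 A 0 0) = herm 0 0 0 (albA (g (herm 0 0 0 A 0 0))) 0 0"
    using z(2,3)[of "herm 0 0 0 A 0 0"] by (simp add: albert_eq_iff)
  show "g (herm 0 0 0 0 B 0) = herm 0 0 0 0 (albB (g (herm 0 0 0 0 B 0))) 0"
    using z(1,3)[of "herm 0 0 0 0 B 0"] by (simp add: albert_eq_iff)
  show "g (herm 0 0 0 0 0 C) = herm 0 0 0 0 0 (albC (g (herm 0 0 0 0 0 C)))"
    using z(1,2)[of "herm 0 0 0 0 0 C"] by (simp add: albert_eq_iff)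
qed

text \<open>The norm is visible to the form: \<open>D(embA A, E1) = - oct_norm A\<close>.\<close>

lemma stab_frame_norm:
  assumes "g \<in> stab_frame" "g (embA A) = embA A'"
  shows "oct_norm A' = oct_norm A"
  using SE6_deriv[OF stab_SE6(3)[OF assms(1)], of "embA A" E1]
  by (simp add: assms(2) stab_frame_E[OF assms(1)] det_deriv_herm oct_linear)

lemma stab_frame_inner:
  assumes "g \<in> stab_frame" "g (embA A) = embA A'" "g (embA B) = embA B'"
  shows "oct_inner A' B' = oct_inner A B"
  using SE6_tri[OF stab_SE6(3)[OF assms(1)], of "embA A" E1 "embA B"]
  by (simp add: assms(2,3) stab_frame_E[OF assms(1)] det_tri_E)

text \<open>\<open>cyc\<close> brings \<open>A\<close> into a slot where \<open>simil\<close>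
  multiplies on one side only; \<open>simil\<close> conjugates its parameter there, hence
  \<open>oct_cnj u\<close>.\<close>

definition left_map :: "'a::field oct \<Rightarrow> 'a albert \<Rightarrow> 'a albert" where
  "left_map u = cyc \<circ> simil (oct_cnj u) \<circ> cyc \<circ> cyc"
definition right_map :: "'a::field oct \<Rightarrow> 'a albert \<Rightarrow> 'a albert" where
  "right_map u = cyc \<circ> cyc \<circ> simil (oct_cnj u) \<circ> cyc"

lemma left_map_embA: "oct_norm u = 1 \<Longrightarrow> left_map u (embA A) = embA (u \<odot> A)"
  and right_map_embA: "oct_norm u = 1 \<Longrightarrow> right_map u (embA A) = embA (A \<odot> u)"
  by (simp_all add: left_map_def right_map_def cyc_herm simil_herm oct_linear)

lemma left_right_map_stab_frame:
  fixes u :: "'a::{field,finite} oct"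
  assumes "oct_norm u = 1"
  shows "left_map u \<in> stab_frame" "right_map u \<in> stab_frame"
  unfolding stab_defs mem_Collect_eq using assms
  by (intro conjI; simp add: left_map_def right_map_def SE6_comp simil_SE6 cyc_SE6 cyc_herm simil_herm oct_linear albert_one_def)+

section \<open>Transitivity on isotropic octonions and on hyperbolic partners\<close>

lemma oct_of_planes_nth [simp]:
  "oct_of_planes ((((a, a'), b, b'), c, c'), d, d') $ Pos I0 = a"
  "oct_of_planes ((((a, a'), b, b'), c, c'), d, d') $ Neg I0 = a'"
  "oct_of_planes ((((a, a'), b, b'), c, c'), d, d') $ Pos I1 = b"
  "oct_of_planes ((((a, a'), b, b'), c, c'), d, d') $ Neg I1 = b'"
  "oct_of_planes ((((a, a'), b, b'), c, c'), d, d') $ Pos I\<omega> = c"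
  "oct_of_planes ((((a, a'), b, b'), c, c'), d, d') $ Neg I\<omega> = c'"
  "oct_of_planes ((((a, a'), b, b'), c, c'), d, d') $ Pos I\<omega>' = d"
  "oct_of_planes ((((a, a'), b, b'), c, c'), d, d') $ Neg I\<omega>' = d'"
  by (simp_all add: oct_of_planes_def)

lemma axis_nth_eq: "axis i a $ j = (if j = i then a else 0)"
  by (simp add: axis_def)

lemma stab_frame_comp: "g \<in> stab_frame \<Longrightarrow> h \<in> stab_frame \<Longrightarrow> g \<circ> h \<in> stab_frame"
  using function_group_stab(3) by (auto simp: function_group_def)

lemma function_group_symmetric:
  assumes "function_group G" "g \<in> G" "g x = y"
  shows "\<exists>h\<in>G. h y = x"
  using assms unfolding function_group_def by (metis bij_inv_eq_iff)

lemma stab_frame_transitive_plus_nonzero: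
  fixes A :: "'a::{field,finite} oct"
  assumes n: "oct_norm A = 0" and nz: "A $ Pos I0 \<noteq> 0"
  shows "\<exists>g\<in>stab_frame. g (embA A) = embA e_plus"
proof -
  define l where "l = A $ Pos I0"
  \<comment> \<open>\<open>?d\<close> has norm \<open>l * inverse l = 1\<close> and sends
    \<open>e_0\<close> to \<open>l e_0\<close>, supplying the leading coefficient of
    \<open>A\<close>.\<close>
  let ?d = "oct_of_planes ((((l, inverse l), 0, 0), 0, 0), 0, 0)"
  let ?t = "oct_of_planes ((((1, 1), A $ Pos I1 / l, 0), A $ Pos I\<omega> / l, 0), A $ Pos I\<omega>' / l, 0)"
  let ?s = "oct_of_planes ((((1, 1), 0, A $ Neg I1 / l), 0, A $ Neg I\<omega> / l), 0, A $ Neg I\<omega>' / l)"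
  have l: "l \<noteq> 0" using nz by (simp add: l_def)
  have N: "oct_norm ?d = 1" "oct_norm ?t = 1" "oct_norm ?s = 1" using l by (simp_all add: oct_norm_eq)
  \<comment> \<open>\<open>(1 + t)(l e\<^sub>0)(1 + s) = l (e\<^sub>0 + t + s - (s \<cdot> t) e\<^bsub>-0\<^esub>)\<close> for \<open>t\<close>, \<open>s\<close> in the spans of
    the \<open>e\<^sub>i\<close> and of the \<open>e\<^bsub>-i\<^esub>\<close>, \<open>i \<noteq> 0\<close>\<close>
  have "A $ Neg I0 = - (A $ Pos I1 * A $ Neg I1 + A $ Pos I\<omega> * A $ Neg I\<omega> + A $ Pos I\<omega>' * A $ Neg I\<omega>') / l"
    using n l by (simp add: oct_norm_eq l_def field_simps eq_neg_iff_add_eq_0)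
  then have "(?t \<odot> (?d \<odot> e_plus)) \<odot> ?s = A"
    using l by (simp add: oct_eq_iff oct_mult_nth axis_nth_eq l_def[symmetric] diff_divide_distrib add_divide_distrib)
  then have "(right_map ?s \<circ> left_map ?t \<circ> left_map ?d) (embA e_plus) = embA A"
    using N by (simp add: left_map_embA right_map_embA)
  moreover have "right_map ?s \<circ> left_map ?t \<circ> left_map ?d \<in> stab_frame"
    by (intro stab_frame_comp left_right_map_stab_frame N)
  ultimately show ?thesis
    using function_group_symmetric[OF function_group_stab(3)] by blast
qed

lemma stab_frame_transitive_plus:
  fixes A :: "'a::{field,finite} oct"
  assumes n: "oct_norm A = 0" and nz: "A \<noteq> 0"
  shows "\<exists>g\<in>stab_frame. g (embA A) = embA e_plus"
proof -
  have L: "\<exists>g\<in>stab_frame. g (embA A) = embA e_plus" if "oct_norm u = 1" "\<exists>g\<in>stab_frame. g (embA (u \<odot> A)) = embA e_plus" for u A :: "'a oct"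
    using that left_right_map_stab_frame[OF that(1)] by (metis comp_apply left_map_embA stab_frame_comp)
  have R: "\<exists>g\<in>stab_frame. g (embA A) = embA e_plus" if "oct_norm u = 1" "\<exists>g\<in>stab_frame. g (embA (A \<odot> u)) = embA e_plus" for u A :: "'a oct"
    using that left_right_map_stab_frame[OF that(1)] by (metis comp_apply right_map_embA stab_frame_comp)
  have *: "\<exists>g\<in>stab_frame. g (embA A) = embA e_plus"
    if n: "oct_norm A = 0" and nz: "A $ Pos I0 \<noteq> 0 \<or> A $ Pos I1 \<noteq> 0 \<or> A $ Pos I\<omega> \<noteq> 0 \<or> A $ Pos I\<omega>' \<noteq> 0 \<or>
     A $ Neg I1 \<noteq> 0 \<or> A $ Neg I\<omega> \<noteq> 0 \<or> A $ Neg I\<omega>' \<noteq> 0" for A :: "'a oct"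
  proof (cases "A $ Pos I0 = 0")
    case True
    \<comment> \<open>Since \<open>e_{-i} e_i = - e_0\<close>, multiplying by
      \<open>1 + e_{-i}\<close> on the left, or by \<open>1 + e_i\<close> on the right, copies
      coordinate \<open>i\<close>, respectively \<open>-i\<close>, with a sign into the vanishing
      coordinate at \<open>e_0\<close>.\<close>
    let ?u = "\<lambda>l. oct_one + axis l (1 :: 'a)"
    have N: "oct_norm (?u l) = 1" if "l \<noteq> Pos I0" "l \<noteq> Neg I0" for l
      using that by (cases l; rename_tac i; case_tac i; simp add: oct_norm_eq axis_nth_eq)
    from True nz consider "A $ Pos I1 \<noteq> 0" | "A $ Pos I\<omega> \<noteq> 0" | "A $ Pos I\<omega>' \<noteq> 0" |
     "A $ Neg I1 \<noteq> 0" | "A $ Neg I\<omega> \<noteq> 0" | "A $ Neg I\<omega>' \<noteq> 0" by blast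
    then show ?thesis
    proof cases
      case 1 show ?thesis
        by (rule L[of "?u (Neg I1)"], simp add: N, rule stab_frame_transitive_plus_nonzero)
          (use True n 1 in \<open>simp_all add: oct_norm_mult oct_mult_nth axis_nth_eq\<close>)
    next
      case 2 show ?thesis
        by (rule L[of "?u (Neg I\<omega>)"], simp add: N, rule stab_frame_transitive_plus_nonzero)
          (use True n 2 in \<open>simp_all add: oct_norm_mult oct_mult_nth axis_nth_eq\<close>)
    next
      case 3 show ?thesis
        by (rule L[of "?u (Neg I\<omega>')"], simp add: N, rule stab_frame_transitive_plus_nonzero)
          (use True n 3 in \<open>simp_all add: oct_norm_mult oct_mult_nth axis_nth_eq\<close>)
    next
      case 4 show ?thesis
        by (rule R[of "?u (Pos I1)"], simp add: N, rule stab_frame_transitive_plus_nonzero)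
          (use True n 4 in \<open>simp_all add: oct_norm_mult oct_mult_nth axis_nth_eq\<close>)
    next
      case 5 show ?thesis
        by (rule R[of "?u (Pos I\<omega>)"], simp add: N, rule stab_frame_transitive_plus_nonzero)
          (use True n 5 in \<open>simp_all add: oct_norm_mult oct_mult_nth axis_nth_eq\<close>)
    next
      case 6 show ?thesis
        by (rule R[of "?u (Pos I\<omega>')"], simp add: N, rule stab_frame_transitive_plus_nonzero)
          (use True n 6 in \<open>simp_all add: oct_norm_mult oct_mult_nth axis_nth_eq\<close>)
    qed
  qed (use n stab_frame_transitive_plus_nonzero in blast)
  show ?thesis
  proof (cases "A $ Pos I0 \<noteq> 0 \<or> A $ Pos I1 \<noteq> 0 \<or> A $ Pos I\<omega> \<noteq> 0 \<or> A $ Pos I\<omega>' \<noteq> 0 \<or>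
     A $ Neg I1 \<noteq> 0 \<or> A $ Neg I\<omega> \<noteq> 0 \<or> A $ Neg I\<omega>' \<noteq> 0")
    case False
    then have m: "A $ Neg I0 \<noteq> 0" using nz by (auto simp: oct_eq_iff)
    \<comment> \<open>Only \<open>e_{-0}\<close> occurs in \<open>A\<close>. As
      \<open>e_{-1} e_{-0} = e_{-1}\<close>, one multiplication reaches the previous case.\<close>
    have "oct_norm (oct_one + axis (Neg I1) (1 :: 'a)) = 1" by (simp add: oct_norm_eq axis_nth_eq)
    moreover have "((oct_one + axis (Neg I1) 1) \<odot> A) $ Neg I1 \<noteq> 0"
      using False m by (simp add: oct_mult_nth axis_nth_eq)
    moreover have "oct_norm ((oct_one + axis (Neg I1) 1) \<odot> A) = 0"
      using n by (simp add: oct_norm_mult)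
    ultimately show ?thesis
      using L *[of "(oct_one + axis (Neg I1) 1) \<odot> A"] by blast
  qed (use n * in blast)
qed

lemma card_stab_frame:
  "int (card (stab_frame :: ('a::{field,finite} albert \<Rightarrow> 'a albert) set)) =
     (int CARD('a) ^ 4 - 1) * (int CARD('a) ^ 3 + 1) * int (card (stab_plus :: ('a albert \<Rightarrow> 'a albert) set))"
proof -
  let ?X = "embA ` ({A :: 'a oct. oct_norm A = 0} - {0})"
  have "card (stab_frame :: ('a albert \<Rightarrow> 'a albert) set) = card ?X * card (stab_plus :: ('a albert \<Rightarrow> 'a albert) set)"
    unfolding stab_plus_def
  proof (rule card_orbit_stabilizer[OF function_group_stab(3)])
    fix g :: "'a albert \<Rightarrow> 'a albert" assume g: "g \<in> stab_frame"
    obtain A where A: "g (embA e_plus) = embA A" using stab_frame_blocks(1)[OF g] by blast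
    have "oct_norm A = 0" using stab_frame_norm[OF g A] by (simp add: oct_norm_eq axis_nth_eq)
    moreover have "embA e_plus \<noteq> (0 :: 'a albert)" by (simp add: herm_zero[symmetric] oct_eq_iff axis_nth_eq)
    then have "g (embA e_plus) \<noteq> 0" using stab_SE6(3)[OF g] by (metis SE6_eq_iff SE6_zero)
    then have "A \<noteq> 0" by (auto simp: A herm_zero)
    ultimately show "g (embA e_plus) \<in> ?X" by (simp add: A)
  qed (use stab_frame_transitive_plus in blast)
  moreover have "card ?X = card ({A :: 'a oct. oct_norm A = 0} - {0})"
    by (rule card_image) (auto simp: inj_on_def)
  moreover have "int (card ({A :: 'a oct. oct_norm A = 0} - {0})) = int (card {A :: 'a oct. oct_norm A = 0}) - 1"
    using card_Suc_Diff1[of "{A :: 'a oct. oct_norm A = 0}" 0] by simp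
  ultimately have "int (card (stab_frame :: ('a albert \<Rightarrow> 'a albert) set)) =
      (int (card {A :: 'a oct. oct_norm A = 0}) - 1) * int (card (stab_plus :: ('a albert \<Rightarrow> 'a albert) set))"
    by (simp only: of_nat_mult)
  then show ?thesis
    unfolding card_oct_norm_eq by (simp add: eval_nat_numeral algebra_simps)
qed

text \<open>An isotropic vector with inner product 1 against \<open>e_0\<close> has
  \<open>e_{-0}\<close>-coordinate 1. The six other hyperbolic coordinates are free, and isotropy
  fixes the one at \<open>e_0\<close>.\<close>

lemma card_stab_plus:
  "card (stab_plus :: ('a::{field,finite} albert \<Rightarrow> 'a albert) set) =
     CARD('a) ^ 6 * card (stab_pair :: ('a albert \<Rightarrow> 'a albert) set)"
proof -
  let ?Y = "{A :: 'a oct. oct_norm A = 0 \<and> A $ Neg I0 = 1}"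
  have "card (stab_plus :: ('a albert \<Rightarrow> 'a albert) set) = card (embA ` ?Y) * card (stab_pair :: ('a albert \<Rightarrow> 'a albert) set)"
    unfolding stab_pair_def
  proof (rule card_orbit_stabilizer[OF function_group_stab(4)])
    fix g :: "'a albert \<Rightarrow> 'a albert" assume "g \<in> stab_plus"
    then have g: "g \<in> stab_frame" "g (embA e_plus) = embA e_plus" by (simp_all add: stab_plus_def)
    obtain A where A: "g (embA e_minus) = embA A" using stab_frame_blocks(1)[OF g(1)] by blast
    have "oct_norm A = 0" using stab_frame_norm[OF g(1) A] by (simp add: oct_norm_eq axis_nth_eq)
    moreover have "A $ Neg I0 = 1" using stab_frame_inner[OF g(1) A g(2)] by (simp add: oct_inner_eq axis_nth_eq)
    ultimately show "g (embA e_minus) \<in> embA ` ?Y" by (simp add: A)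
  next
    fix x :: "'a albert" assume "x \<in> embA ` ?Y"
    then obtain A where A: "x = embA A" "oct_norm A = 0" "A $ Neg I0 = 1" by auto
    \<comment> \<open>For \<open>i\<close> different from 0, \<open>e_{-i} e_0 = 0\<close> and
      \<open>e_0 e_i = 0\<close>, so left multiplication by \<open>?s\<close> and right
      multiplication by \<open>?t\<close> both fix \<open>e_0\<close> while they spread
      \<open>e_{-0}\<close> out to \<open>A\<close>.\<close>
    let ?t = "oct_of_planes ((((1, 1), A $ Pos I1, 0), A $ Pos I\<omega>, 0), A $ Pos I\<omega>', 0)"
    let ?s = "oct_of_planes ((((1, 1), 0, A $ Neg I1), 0, A $ Neg I\<omega>), 0, A $ Neg I\<omega>')"
    have N: "oct_norm ?t = 1" "oct_norm ?s = 1" by (simp_all add: oct_norm_eq)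
    have "A $ Pos I0 = - (A $ Pos I1 * A $ Neg I1 + A $ Pos I\<omega> * A $ Neg I\<omega> + A $ Pos I\<omega>' * A $ Neg I\<omega>')"
      using A by (simp add: oct_norm_eq eq_neg_iff_add_eq_0 algebra_simps)
    then have "(?s \<odot> e_minus) \<odot> ?t = A"
      by (simp add: oct_eq_iff oct_mult_nth axis_nth_eq A)
    then have "(right_map ?t \<circ> left_map ?s) (embA e_minus) = x"
      using N by (simp add: left_map_embA right_map_embA A)
    moreover have "(?s \<odot> e_plus) \<odot> ?t = e_plus"
      by (simp add: oct_eq_iff oct_mult_nth axis_nth_eq)
    then have "(right_map ?t \<circ> left_map ?s) (embA e_plus) = embA e_plus"
      using N by (simp add: left_map_embA right_map_embA A)
    moreover have "right_map ?t \<circ> left_map ?s \<in> stab_frame"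
      by (intro stab_frame_comp left_right_map_stab_frame N)
    ultimately have "right_map ?t \<circ> left_map ?s \<in> stab_plus" "(right_map ?t \<circ> left_map ?s) (embA e_minus) = x"
      by (simp_all add: stab_plus_def)
    then show "\<exists>g\<in>stab_plus. g x = embA e_minus"
      using function_group_symmetric[OF function_group_stab(4)] by blast
  qed
  moreover have "card (embA ` ?Y) = card ?Y"
    by (rule card_image) (auto simp: inj_on_def)
  moreover have "bij_betw (\<lambda>(b, b', c, c', d, d'). oct_of_planes ((((- (b * b' + c * c' + d * d'), 1), b, b'), c, c'), d, d')) UNIV ?Y"
    by (rule bij_betwI[where g = "\<lambda>A. (A $ Pos I1, A $ Neg I1, A $ Pos I\<omega>, A $ Neg I\<omega>, A $ Pos I\<omega>', A $ Neg I\<omega>')"])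
      (auto simp: oct_eq_iff oct_norm_eq, algebra)
  then have "card ?Y = card (UNIV :: ('a \<times> 'a \<times> 'a \<times> 'a \<times> 'a \<times> 'a) set)"
    by (rule bij_betw_same_card[symmetric])
  then have "card ?Y = CARD('a) ^ 6"
    by (simp add: card_prod eval_nat_numeral)
  ultimately show ?thesis by simp
qed

subsection \<open>The pointwise stabilizer of a hyperbolic pair\<close>

lemma all_idx: "(\<forall>i::idx. P i) \<longleftrightarrow> P I0 \<and> P I1 \<and> P I\<omega> \<and> P I\<omega>'"
  by (metis idx.exhaust)

lemma sum_idx: "(\<Sum>i\<in>(UNIV::idx set). f i) = f I0 + f I1 + f I\<omega> + (f I\<omega>' :: 'a :: comm_monoid_add)"
  by (simp add: UNIV_idx add.assoc)

definition dotp :: "'a::comm_ring_1 ^ idx \<Rightarrow> 'a ^ idx \<Rightarrow> 'a" where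
  "dotp u v = (\<Sum>i\<in>UNIV. u $ i * v $ i)"

lemma dotp_matrix: "dotp (K *v u) v = dotp u (transpose K *v v)"
  by (simp add: dotp_def matrix_vector_mult_def transpose_def sum_idx algebra_simps)

lemma dotp_commute: "dotp u v = dotp v u"
  by (simp add: dotp_def mult.commute)

lemma dotp_linear: "dotp (u + v) w = dotp u w + dotp v w" "dotp (u - v) w = dotp u w - dotp v w"
  "dotp u (v - w) = dotp u v - dotp u w" "dotp 0 w = 0" "dotp w 0 = 0"
  by (simp_all add: dotp_def sum_idx algebra_simps)

lemma dotp_nondegenerate:
  fixes u :: "'a::comm_ring_1 ^ idx"
  assumes "\<And>v. dotp u v = 0"
  shows "u = 0"
proof -
  have "u $ i = 0" for i
    using assms[of "axis i 1"] by (cases i; simp add: dotp_def sum_idx axis_nth_eq)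
  then show ?thesis by (simp add: vec_eq_iff)
qed

text \<open>
  The six coordinates of \<open>A\<close> with \<open>i \<noteq> 0\<close> form an alternating \<open>4 \<times> 4\<close> matrix with \<open>A\<^sub>i\<close> in position
  \<open>(0, i)\<close> and \<open>A\<^bsub>-i\<^esub>\<close> in the complementary position.
\<close>

definition altform :: "'a::comm_ring_1 oct \<Rightarrow> 'a ^ idx \<Rightarrow> 'a ^ idx \<Rightarrow> 'a" where
  "altform A u v = A $ Pos I1 * (u $ I0 * v $ I1 - u $ I1 * v $ I0) + A $ Pos I\<omega> * (u $ I0 * v $ I\<omega> - u $ I\<omega> * v $ I0)
    + A $ Pos I\<omega>' * (u $ I0 * v $ I\<omega>' - u $ I\<omega>' * v $ I0) + A $ Neg I1 * (u $ I\<omega> * v $ I\<omega>' - u $ I\<omega>' * v $ I\<omega>)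
    + A $ Neg I\<omega> * (u $ I\<omega>' * v $ I1 - u $ I1 * v $ I\<omega>') + A $ Neg I\<omega>' * (u $ I1 * v $ I\<omega> - u $ I\<omega> * v $ I1)"

text \<open>Pluecker coordinates in the layout of \<open>altform\<close>.
  \<open>pfaffian_polar\<close> pairs complementary positions, as the product of two bivectors in
  the top exterior power does.\<close>

definition wedge :: "'a::comm_ring_1 ^ idx \<Rightarrow> 'a ^ idx \<Rightarrow> 'a oct" where
  "wedge u v = oct_of_planes ((((0, 0),
     u $ I0 * v $ I1 - u $ I1 * v $ I0, u $ I\<omega> * v $ I\<omega>' - u $ I\<omega>' * v $ I\<omega>),
     u $ I0 * v $ I\<omega> - u $ I\<omega> * v $ I0, u $ I\<omega>' * v $ I1 - u $ I1 * v $ I\<omega>'),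
     u $ I0 * v $ I\<omega>' - u $ I\<omega>' * v $ I0, u $ I1 * v $ I\<omega> - u $ I\<omega> * v $ I1)"

definition pfaffian :: "'a::comm_ring_1 oct \<Rightarrow> 'a" where
  "pfaffian A = A $ Pos I1 * A $ Neg I1 + A $ Pos I\<omega> * A $ Neg I\<omega> + A $ Pos I\<omega>' * A $ Neg I\<omega>'"

definition pfaffian_polar :: "'a::comm_ring_1 oct \<Rightarrow> 'a oct \<Rightarrow> 'a" where
  "pfaffian_polar A B = A $ Pos I1 * B $ Neg I1 + A $ Pos I\<omega> * B $ Neg I\<omega> + A $ Pos I\<omega>' * B $ Neg I\<omega>'
     + A $ Neg I1 * B $ Pos I1 + A $ Neg I\<omega> * B $ Pos I\<omega> + A $ Neg I\<omega>' * B $ Pos I\<omega>'"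

lemma pfaffian_add: "pfaffian (A + B) = pfaffian A + pfaffian B + pfaffian_polar A B"
  by (simp add: pfaffian_def pfaffian_polar_def algebra_simps)

lemma oct_norm_pfaffian: "oct_norm A = A $ Pos I0 * A $ Neg I0 + pfaffian A"
  by (simp add: oct_norm_eq pfaffian_def algebra_simps)

text \<open>The determinant of four vectors, by Laplace expansion along two columns.\<close>

definition det4 :: "'a::comm_ring_1 ^ idx \<Rightarrow> 'a ^ idx \<Rightarrow> 'a ^ idx \<Rightarrow> 'a ^ idx \<Rightarrow> 'a" where
  "det4 u v x y = pfaffian_polar (wedge u v) (wedge x y)"

text \<open>The left side is the Pfaffian of the Gram matrix of the alternating form on
  \<open>u\<close>, \<open>v\<close>, \<open>x\<close>, \<open>y\<close>. On the columns of K it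
  reads \<open>Pf(K^T A K) = det(K) Pf(A)\<close>.\<close>

lemma altform_Pluecker:
  "altform A u v * altform A x y + altform A u x * altform A y v + altform A u y * altform A v x
   = det4 u v x y * pfaffian A"
  unfolding altform_def det4_def wedge_def pfaffian_def pfaffian_polar_def oct_of_planes_nth
  by (simp add: algebra_simps)

text \<open>The congruence \<open>A\<close> to \<open>K^T A K\<close> on the alternating part,
  identity on the coordinates at \<open>e_0\<close> and \<open>e_{-0}\<close>.\<close>

definition alpha :: "'a::comm_ring_1 ^ idx ^ idx \<Rightarrow> 'a oct \<Rightarrow> 'a oct" where
  "alpha K A = (let k = (\<lambda>i j. altform A (column i K) (column j K)) in
     oct_of_planes ((((A $ Pos I0, A $ Neg I0), k I0 I1, k I\<omega> I\<omega>'), k I0 I\<omega>, k I\<omega>' I1), k I0 I\<omega>', k I1 I\<omega>))"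

definition matdet4 :: "'a::comm_ring_1 ^ idx ^ idx \<Rightarrow> 'a" where
  "matdet4 K = det4 (column I0 K) (column I1 K) (column I\<omega> K) (column I\<omega>' K)"

lemma pfaffian_alpha: "pfaffian (alpha K A) = matdet4 K * pfaffian A"
  unfolding matdet4_def altform_Pluecker[symmetric] by (simp add: pfaffian_def alpha_def)

lemma alpha_linear: "alpha K (A + B) = alpha K A + alpha K B" "alpha K (c *s A) = c *s alpha K A"
  by (simp_all add: oct_eq_iff alpha_def altform_def algebra_simps)

lemma pfaffian_polar_alpha: "pfaffian_polar (alpha K A) (alpha K B) = matdet4 K * pfaffian_polar A B"
  using pfaffian_alpha[of K "A + B"] by (simp add: alpha_linear pfaffian_add pfaffian_alpha algebra_simps)

lemma column_nth: "column j K $ i = K $ i $ j"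
  by (simp add: column_def)

lemma altform_alpha: "altform (alpha K A) u v = altform A (K *v u) (K *v v)"
  by (simp add: alpha_def altform_def column_nth matrix_vector_mult_def sum_idx algebra_simps)

lemma alpha_wedge: "alpha K (wedge u v) = wedge (transpose K *v u) (transpose K *v v)"
  by (simp add: oct_eq_iff wedge_def alpha_def altform_def column_nth matrix_vector_mult_def transpose_def sum_idx algebra_simps)

text \<open>The halves of \<open>B\<close> that pair with \<open>C\<close> under \<open>Tr(e\<^sub>0 B C)\<close> and under \<open>Tr(e\<^bsub>-0\<^esub> B C)\<close>.\<close>

definition upper :: "'a oct \<Rightarrow> 'a ^ idx" where
  "upper B = (\<chi> i. if i = I0 then B $ Pos I0 else B $ Neg i)"
definition lower :: "'a oct \<Rightarrow> 'a ^ idx" where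
  "lower B = (\<chi> i. if i = I0 then B $ Neg I0 else B $ Pos i)"
definition oct_join :: "'a ^ idx \<Rightarrow> 'a ^ idx \<Rightarrow> 'a oct" where
  "oct_join p s = oct_of_planes ((((p $ I0, s $ I0), s $ I1, p $ I1), s $ I\<omega>, p $ I\<omega>), s $ I\<omega>', p $ I\<omega>')"

lemma upper_lower_join [simp]: "upper (oct_join p s) = p" "lower (oct_join p s) = s" "oct_join (upper B) (lower B) = B"
  by (simp_all add: vec_eq_iff all_idx all_label upper_def lower_def oct_join_def)

lemma upper_lower_linear: "upper (x + y) = upper x + upper y" "upper (c *s x) = c *s upper x"
  "lower (x + y) = lower x + lower y" "lower (c *s x) = c *s lower x" "upper 0 = 0" "lower 0 = 0"
  by (simp_all add: vec_eq_iff all_idx upper_def lower_def)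

lemma oct_join_linear: "oct_join (p + p') (s + s') = oct_join p s + oct_join p' s'" "oct_join (c *s p) (c *s s) = c *s oct_join p s"
  by (simp_all add: oct_eq_iff oct_join_def)

lemma oct_norm_join: "oct_norm B = dotp (upper B) (lower B)"
  by (simp add: oct_norm_eq dotp_def upper_def lower_def sum_idx algebra_simps)

text \<open>With \<open>C\<close> conjugated, \<open>B\<close> and \<open>C\<close> split alike into
  V and V*. The hyperbolic pair couples V with V*; the alternating part couples V with V, and dually
  V* with V*. This turns invariance of the trace into linear algebra in dimension 4.\<close>

lemma trace_join: "oct_trace (A \<odot> (B \<odot> oct_cnj C)) = A $ Pos I0 * dotp (upper B) (lower C) + A $ Neg I0 * dotp (lower B) (upper C)
    + altform A (upper B) (upper C) + pfaffian_polar A (wedge (lower B) (lower C))"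
  by (simp add: oct_trace_def oct_mult_nth dotp_def upper_def lower_def sum_idx altform_def pfaffian_polar_def wedge_def algebra_simps)

declare transpose_matrix_vector [simp del]

text \<open>The inverse on the upper half balances \<open>K^T A K\<close> in \<open>altform\<close>;
  the transpose on the lower half is then contragredient and keeps \<open>dotp\<close>.\<close>

definition beta :: "'a::field ^ idx ^ idx \<Rightarrow> 'a oct \<Rightarrow> 'a oct" where
  "beta K B = oct_join (matrix_inv K *v upper B) (transpose K *v lower B)"

definition SL4 :: "('a::field ^ idx ^ idx) set" where
  "SL4 = {K. invertible K \<and> matdet4 K = 1}"

definition pair_map :: "'a::field ^ idx ^ idx \<Rightarrow> 'a albert \<Rightarrow> 'a albert" where
  "pair_map K = diag_map 1 1 1 (alpha K) (beta K) (\<lambda>C. oct_cnj (beta K (oct_cnj C)))"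

lemma matrix_inv_cancel:
  fixes K :: "'a::field ^ 'n ^ 'n"
  assumes "invertible K"
  shows "K *v (matrix_inv K *v u) = u" "matrix_inv K *v (K *v u) = u"
proof -
  have "K ** matrix_inv K = mat 1" "matrix_inv K ** K = mat 1"
    using assms unfolding invertible_def matrix_inv_def by (metis (mono_tags, lifting) someI_ex)+
  then show "K *v (matrix_inv K *v u) = u" "matrix_inv K *v (K *v u) = u"
    by (simp_all add: matrix_vector_mul_assoc)
qed

lemma pair_map_stab:
  fixes K :: "'a::{field,finite} ^ idx ^ idx"
  assumes K: "K \<in> SL4"
  shows "pair_map K \<in> stab_pair"
proof -
  have i: "invertible K" and d: "matdet4 K = 1" using K by (simp_all add: SL4_def)
  note c = matrix_inv_cancel[OF i]
  have dot: "dotp (matrix_inv K *v u) (transpose K *v v) = dotp u v" for u v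
    by (simp add: c flip: dotp_matrix)
  have dot': "dotp (transpose K *v v) (matrix_inv K *v u) = dotp v u" for u v
    by (metis dot dotp_commute)
  have lin: "lin (alpha K)" "lin (beta K)"
    by (auto intro!: linI simp: alpha_linear beta_def upper_lower_linear oct_join_linear matrix_vector_right_distrib vector_scalar_commute)
  have "oct_norm (alpha K A) = oct_norm A" for A
    by (simp add: oct_norm_pfaffian pfaffian_alpha d) (simp add: alpha_def)
  moreover have nb: "oct_norm (beta K B) = oct_norm B" for B
    by (simp add: oct_norm_join beta_def dot)
  moreover have "oct_trace (alpha K A \<odot> (beta K B \<odot> oct_cnj (beta K (oct_cnj C)))) = oct_trace (A \<odot> (B \<odot> C))" for A B C
  proof -
    have "oct_trace (alpha K A \<odot> (beta K B \<odot> oct_cnj (beta K (oct_cnj C)))) = oct_trace (A \<odot> (B \<odot> oct_cnj (oct_cnj C)))"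
      unfolding trace_join beta_def upper_lower_join altform_alpha alpha_wedge[symmetric] pfaffian_polar_alpha c dot dot' d
      by (simp add: alpha_def)
    then show ?thesis by simp
  qed
  ultimately have "pair_map K \<in> carrier SE6"
    unfolding pair_map_def using lin
    by (intro diag_map_SE6) (auto intro!: linI simp: vec.linear_add vec.linear_scale oct_cnj_linear)
  moreover have "beta K 0 = 0" "alpha K 0 = 0"
    using lin by (simp_all add: vec.linear_0)
  moreover have "alpha K e_plus = e_plus" "alpha K e_minus = e_minus"
    by (simp_all add: oct_eq_iff alpha_def altform_def axis_nth_eq)
  ultimately show ?thesis
    by (simp add: stab_defs albert_one_def pair_map_def diag_map_herm oct_cnj_linear)
qed

lemma pair_map_inj: "inj_on pair_map (SL4 :: ('a::field ^ idx ^ idx) set)"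
proof (rule inj_onI)
  fix K K' :: "'a ^ idx ^ idx" assume eq: "pair_map K = pair_map K'"
  have "transpose K *v s = transpose K' *v s" for s
  proof -
    have "lower (albB (pair_map K (herm 0 0 0 0 (oct_join 0 s) 0))) = lower (albB (pair_map K' (herm 0 0 0 0 (oct_join 0 s) 0)))"
      by (simp add: eq)
    then show ?thesis by (simp add: pair_map_def diag_map_herm beta_def)
  qed
  then have "transpose K = transpose K'" by (simp add: matrix_eq)
  then show "K = K'" by (metis transpose_transpose)
qed

lemma altform_axis:
  "altform A (axis I0 1) (axis I1 1) = A $ Pos I1" "altform A (axis I0 1) (axis I\<omega> 1) = A $ Pos I\<omega>"
  "altform A (axis I0 1) (axis I\<omega>' 1) = A $ Pos I\<omega>'" "altform A (axis I\<omega> 1) (axis I\<omega>' 1) = A $ Neg I1"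
  "altform A (axis I\<omega>' 1) (axis I1 1) = A $ Neg I\<omega>" "altform A (axis I1 1) (axis I\<omega> 1) = A $ Neg I\<omega>'"
  by (simp_all add: altform_def axis_nth_eq)

lemma matrix_vector_axis: "K *v axis i 1 = column i (K :: 'a::comm_ring_1 ^ idx ^ idx)"
  by (cases i; simp add: vec_eq_iff matrix_vector_mult_def column_nth sum_idx axis_nth_eq)

lemma herm_decompose:
  fixes a b c :: "'a::field"
  shows "herm a b c A B C = a *s E1 + b *s E2 + c *s E3 + herm 0 0 0 A 0 0 + herm 0 0 0 0 B 0 + herm 0 0 0 0 0 C"
  by (simp add: herm_scale herm_add)

text \<open>Setting \<open>A\<close> to \<open>e_0\<close> and to \<open>e_{-0}\<close> in the
  invariant trace isolates the two pairings of V with V*. They force the maps on \<open>B\<close>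
  and \<open>C\<close> to respect both halves, the norm of \<open>B\<close> makes the halves
  contragredient, and the trace on V with V then determines the map on \<open>A\<close>.\<close>

lemma stab_pair_ex_pair_map:
  fixes g :: "'a::{field,finite} albert \<Rightarrow> 'a albert"
  assumes g: "g \<in> stab_pair"
  shows "\<exists>K\<in>SL4. g = pair_map K"
proof -
  have gf: "g \<in> stab_frame" and gp: "g (embA e_plus) = embA e_plus" "g (embA e_minus) = embA e_minus"
    using g by (simp_all add: stab_plus_def stab_pair_def)
  note gS = stab_SE6(3)[OF gf] and gE = stab_frame_E[OF gf] and bl = stab_frame_blocks[OF gf]
  define \<alpha> where "\<alpha> A = albA (g (herm 0 0 0 A 0 0))" for A
  define \<beta> where "\<beta> B = albB (g (herm 0 0 0 0 B 0))" for B
  define \<gamma> where "\<gamma> C = oct_cnj (albC (g (herm 0 0 0 0 0 (oct_cnj C))))" for C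
  have ga: "g (herm 0 0 0 A 0 0) = herm 0 0 0 (\<alpha> A) 0 0" for A by (subst bl(1)) (simp add: \<alpha>_def)
  have gb: "g (herm 0 0 0 0 B 0) = herm 0 0 0 0 (\<beta> B) 0" for B by (subst bl(2)) (simp add: \<beta>_def)
  have gc: "g (herm 0 0 0 0 0 C) = herm 0 0 0 0 0 (oct_cnj (\<gamma> (oct_cnj C)))" for C by (subst bl(3)) (simp add: \<gamma>_def)
  have gh: "g (herm a b c A B C) = herm a b c (\<alpha> A) (\<beta> B) (oct_cnj (\<gamma> (oct_cnj C)))" for a b c A B C
    unfolding herm_decompose[of a b c A B C] SE6_add[OF gS] SE6_scale[OF gS] ga gb gc gE
    by (simp add: herm_scale herm_add)
  have \<beta>_add: "\<beta> (x + y) = \<beta> x + \<beta> y" and \<beta>_scale: "\<beta> (t *s x) = t *s \<beta> x" for x y t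
  proof -
    have "herm 0 0 0 0 (x + y) 0 = herm 0 0 0 0 x 0 + herm 0 0 0 0 y 0" "herm 0 0 0 0 (t *s x) 0 = t *s herm 0 0 0 0 x 0"
      by (simp_all add: herm_add herm_scale)
    then show "\<beta> (x + y) = \<beta> x + \<beta> y" "\<beta> (t *s x) = t *s \<beta> x"
      unfolding \<beta>_def by (simp_all add: SE6_add[OF gS] SE6_scale[OF gS] alb_linear)
  qed
  have surj: "\<exists>B. \<beta> B = B'" "\<exists>C. \<gamma> C = C'" for B' C'
  proof -
    obtain x where x: "g x = herm 0 0 0 0 B' (oct_cnj C')" using SE6_bij[OF gS] by (metis bij_pointE)
    obtain a b c A B C where "x = herm a b c A B C" by (rule herm_exhaust)
    with x have "\<beta> B = B'" "\<gamma> (oct_cnj C) = C'"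
      by (auto simp: gh) (metis oct_cnj_cnj)
    then show "\<exists>B. \<beta> B = B'" "\<exists>C. \<gamma> C = C'"
      by blast+
  qed
  have N: "oct_norm (\<alpha> A) = oct_norm A" "oct_norm (\<beta> B) = oct_norm B" for A B
    using SE6_deriv[OF gS, of "herm 0 0 0 A 0 0" E1] SE6_deriv[OF gS, of "herm 0 0 0 0 B 0" E2]
    by (simp_all add: gE ga gb det_deriv_herm oct_linear)
  have tri: "oct_trace (\<alpha> A \<odot> (\<beta> B \<odot> oct_cnj (\<gamma> C))) = oct_trace (A \<odot> (B \<odot> oct_cnj C))" for A B C
    using SE6_tri[OF gS, of "herm 0 0 0 A 0 0" "herm 0 0 0 0 B 0" "herm 0 0 0 0 0 (oct_cnj C)"]
    by (simp add: ga gb gc det_tri_def oct_linear)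
  have \<alpha>p: "\<alpha> e_plus = e_plus" "\<alpha> e_minus = e_minus" using gp by (simp_all add: \<alpha>_def)
  have \<alpha>0: "\<alpha> A $ Pos I0 = A $ Pos I0" "\<alpha> A $ Neg I0 = A $ Neg I0" for A
    using stab_frame_inner[OF gf ga gp(2), of A] stab_frame_inner[OF gf ga gp(1), of A]
    by (simp_all add: oct_inner_eq axis_nth_eq)

  have d1: "dotp (upper (\<beta> B)) (lower (\<gamma> C)) = dotp (upper B) (lower C)" for B C
    using tri[of e_plus B C] unfolding \<alpha>p trace_join by (simp add: axis_nth_eq altform_def pfaffian_polar_def)
  have d2: "dotp (lower (\<beta> B)) (upper (\<gamma> C)) = dotp (lower B) (upper C)" for B C
    using tri[of e_minus B C] unfolding \<alpha>p trace_join by (simp add: axis_nth_eq altform_def pfaffian_polar_def)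
  have d3: "dotp (upper (\<beta> B)) (lower (\<beta> B)) = dotp (upper B) (lower B)" for B
    using N(2)[of B] by (simp add: oct_norm_join)
  have surj_l: "\<exists>C. lower (\<gamma> C) = v" "\<exists>C. upper (\<gamma> C) = v" "\<exists>B. lower (\<beta> B) = v" "\<exists>B. upper (\<beta> B) = v" for v
    by (metis surj upper_lower_join(1,2))+
  define M where "M p = upper (\<beta> (oct_join p 0))" for p
  define L where "L s = lower (\<beta> (oct_join 0 s))" for s
  have split: "B = oct_join (upper B) 0 + oct_join 0 (lower B)" for B :: "'a oct"
    by (simp flip: oct_join_linear)
  \<comment> \<open>The upper half of \<open>oct_join 0 s\<close> is zero, so by \<open>d1\<close>
    the upper half of its image is orthogonal to all lower halves of images, which fill the whole
    space.\<close>
  have z1: "upper (\<beta> (oct_join 0 s)) = 0" for s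
  proof (rule dotp_nondegenerate)
    show "dotp (upper (\<beta> (oct_join 0 s))) v = 0" for v
      using surj_l(1)[of v] d1[of "oct_join 0 s"] by (auto simp: dotp_linear)
  qed
  have z2: "lower (\<beta> (oct_join p 0)) = 0" for p
  proof (rule dotp_nondegenerate)
    show "dotp (lower (\<beta> (oct_join p 0))) v = 0" for v
      using surj_l(2)[of v] d2[of "oct_join p 0"] by (auto simp: dotp_linear)
  qed
  have u\<beta>: "upper (\<beta> B) = M (upper B)" for B
    by (subst split[of B]) (simp add: \<beta>_add upper_lower_linear z1 M_def)
  have l\<beta>: "lower (\<beta> B) = L (lower B)" for B
    by (subst split[of B]) (simp add: \<beta>_add upper_lower_linear z2 L_def)
  have surj_adj: "\<exists>p. M p = v" "\<exists>s. L s = v" for v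
    using surj_l(3,4) by (metis u\<beta> l\<beta>)+
  have adj: "dotp (M p) (L s) = dotp p s" for p s
    using d3[of "oct_join p s"] by (simp add: u\<beta> l\<beta>)
  \<comment> \<open>By \<open>d1\<close> the lower half of \<gamma> is the contragredient of
    \<open>M\<close>, and by \<open>adj\<close> so is \<open>L\<close>. The same argument for the
    other half yields \<gamma> = \<beta>.\<close>
  have l\<gamma>: "lower (\<gamma> C) = L (lower C)" for C
  proof -
    have "dotp (lower (\<gamma> C) - L (lower C)) v = 0" for v
    proof -
      obtain p where p: "M p = v" using surj_adj by blast
      have "dotp v (lower (\<gamma> C)) = dotp v (L (lower C))"
        using d1[of "oct_join p 0" C] by (simp add: u\<beta> adj flip: p)
      then show ?thesis by (simp add: dotp_linear dotp_commute[of _ v])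
    qed
    then show ?thesis using dotp_nondegenerate by (metis eq_iff_diff_eq_0)
  qed
  have u\<gamma>: "upper (\<gamma> C) = M (upper C)" for C
  proof -
    have "dotp (upper (\<gamma> C) - M (upper C)) v = 0" for v
    proof -
      obtain s where s: "L s = v" using surj_adj by blast
      have "dotp (upper (\<gamma> C)) v = dotp (M (upper C)) v"
        using d2[of "oct_join 0 s" C] by (simp add: l\<beta> adj dotp_commute[of _ "upper _"] flip: s)
      then show ?thesis by (simp add: dotp_linear)
    qed
    then show ?thesis using dotp_nondegenerate by (metis eq_iff_diff_eq_0)
  qed
  have \<gamma>\<beta>: "\<gamma> C = \<beta> C" for C
    by (metis l\<beta> l\<gamma> u\<beta> u\<gamma> upper_lower_join(3))
  have lin: "lin M" "lin L"
    by (auto intro!: linI simp: M_def L_def simp flip: upper_lower_linear \<beta>_add \<beta>_scale oct_join_linear)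
  \<comment> \<open>\<open>K\<close> is read off from the lower half, where \<open>beta K\<close>
    acts by \<open>transpose K\<close>; then \<open>adj\<close> says that \<open>M\<close> is its
    inverse.\<close>
  define K where "K = transpose (matrix L)"
  have tK: "transpose K *v s = L s" for s
    using matrix_works[OF lin(2)] by (simp add: K_def)
  have KM: "K *v M p = p" for p
  proof -
    have "dotp (K *v M p - p) s = 0" for s
      by (simp add: dotp_linear dotp_matrix tK adj)
    then show ?thesis using dotp_nondegenerate by (metis eq_iff_diff_eq_0)
  qed
  have "K ** matrix M = mat 1"
    by (simp add: matrix_eq matrix_vector_mul_assoc[symmetric] matrix_works[OF lin(1)] KM)
  then have inv: "invertible K" by (auto simp: invertible_right_inverse)
  have M: "matrix_inv K *v p = M p" for p
    using matrix_inv_cancel(2)[OF inv, of "M p"] by (simp add: KM)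
  have \<beta>: "\<beta> = beta K"
    by (rule ext) (metis M beta_def l\<beta> tK u\<beta> upper_lower_join(3))
  have "altform (\<alpha> A) (M p) (M r) = altform A p r" for A p r
    using tri[of A "oct_join p 0" "oct_join r 0"] unfolding trace_join u\<beta> l\<beta> u\<gamma> l\<gamma>
    by (simp add: pfaffian_polar_def wedge_def dotp_linear vec.linear_0[OF lin(2)])
  moreover have "M (K *v u) = u" for u
    using matrix_inv_cancel(2)[OF inv, of u] by (simp add: M)
  ultimately have form: "altform (\<alpha> A) u v = altform A (K *v u) (K *v v)" for A u v
    by metis
  have \<alpha>: "\<alpha> = alpha K"
  proof
    fix A
    show "\<alpha> A = alpha K A"
      unfolding oct_eq_iff altform_axis[of "\<alpha> A", symmetric] form matrix_vector_axis
      by (simp add: alpha_def \<alpha>0)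
  qed
  have "matdet4 K = 1"
  proof -
    \<comment> \<open>\<alpha> preserves the norm and the coordinates at \<open>e_0\<close> and
      \<open>e_{-0}\<close>, hence the Pfaffian; any element of Pfaffian 1 then exposes
      \<open>matdet4 K\<close>.\<close>
    let ?A = "axis (Pos I1) 1 + axis (Neg I1) 1 :: 'a oct"
    have p: "pfaffian ?A = 1" by (simp add: pfaffian_def axis_nth_eq)
    have "pfaffian (\<alpha> ?A) = pfaffian ?A"
      using N(1)[of ?A] by (simp add: oct_norm_pfaffian \<alpha>0)
    then show ?thesis by (simp add: \<alpha> pfaffian_alpha p)
  qed
  with inv have "K \<in> SL4" by (simp add: SL4_def)
  moreover have "g = pair_map K"
  proof
    fix x :: "'a albert"
    obtain a b c A B C where "x = herm a b c A B C" by (rule herm_exhaust)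
    then show "g x = pair_map K x"
      by (simp add: gh pair_map_def diag_map_herm \<gamma>\<beta> \<alpha> \<beta>)
  qed
  ultimately show ?thesis by blast
qed

lemma card_stab_pair:
  "card (stab_pair :: ('a::{field,finite} albert \<Rightarrow> 'a albert) set) = card (SL4 :: ('a ^ idx ^ idx) set)"
proof -
  have "stab_pair = pair_map ` (SL4 :: ('a ^ idx ^ idx) set)"
    using pair_map_stab stab_pair_ex_pair_map by fast
  then show ?thesis
    by (metis card_image pair_map_inj)
qed

subsection \<open>The order of the special linear group\<close>

fun lincomb :: "'a::field list \<Rightarrow> ('a ^ 'n) list \<Rightarrow> 'a ^ 'n" where
  "lincomb (c # cs) (v # vs) = c *s v + lincomb cs vs"
| "lincomb _ _ = 0"

definition independent_list :: "('a::field ^ 'n) list \<Rightarrow> bool" where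
  "independent_list vs \<longleftrightarrow> (\<forall>cs. length cs = length vs \<longrightarrow> lincomb cs vs = 0 \<longrightarrow> set cs \<subseteq> {0})"

definition span_list :: "('a::field ^ 'n) list \<Rightarrow> ('a ^ 'n) set" where
  "span_list vs = (\<lambda>cs. lincomb cs vs) ` {cs. length cs = length vs}"

lemma lincomb_scale: "lincomb (map ((*) c) cs) vs = c *s lincomb cs vs"
  by (induction cs vs rule: lincomb.induct) (simp_all add: vector_add_ldistrib vector_smult_assoc)

lemma lincomb_diff:
  "length cs = length vs \<Longrightarrow> length ds = length vs \<Longrightarrow>
    lincomb (map2 (-) cs ds) vs = lincomb cs vs - lincomb ds vs"
proof (induction vs arbitrary: cs ds)
  case (Cons v vs)
  then show ?case
    by (cases cs; cases ds) (simp_all add: vector_ssub_ldistrib vec.scale_left_diff_distrib)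
qed simp

lemma card_span_list:
  fixes vs :: "('a::{field,finite} ^ 'n) list"
  assumes "independent_list vs"
  shows "card (span_list vs) = CARD('a) ^ length vs"
proof -
  have "inj_on (\<lambda>cs. lincomb cs vs) {cs. length cs = length vs}"
  proof (rule inj_onI)
    fix cs ds :: "'a list"
    assume l: "cs \<in> {cs. length cs = length vs}" "ds \<in> {cs. length cs = length vs}" and "lincomb cs vs = lincomb ds vs"
    then have "lincomb (map2 (-) cs ds) vs = 0" by (simp add: lincomb_diff)
    moreover have "length (map2 (-) cs ds) = length vs" using l by simp
    ultimately have "set (map2 (-) cs ds) \<subseteq> {0}" using assms unfolding independent_list_def by blast
    then have "map2 (-) cs ds ! i = 0" if "i < length vs" for i
      using that l nth_mem[of i "map2 (-) cs ds"] by fastforce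
    then show "cs = ds"
      using l by (intro nth_equalityI) auto
  qed
  moreover have "card {cs :: 'a list. length cs = length vs} = CARD('a) ^ length vs"
    using card_lists_length_eq[of "UNIV :: 'a set"] by simp
  ultimately show ?thesis
    by (simp add: span_list_def card_image)
qed

lemma independent_list_Cons:
  "independent_list (v # vs) \<longleftrightarrow> independent_list vs \<and> v \<notin> span_list vs"
proof (intro iffI conjI)
  assume i: "independent_list (v # vs)"
  show "independent_list vs"
    unfolding independent_list_def
  proof (intro allI impI)
    fix cs :: "'a list" assume "length cs = length vs" "lincomb cs vs = 0"
    then show "set cs \<subseteq> {0}"
      using i[unfolded independent_list_def, rule_format, of "0 # cs"] by simp
  qed
  show "v \<notin> span_list vs"
  proof
    assume "v \<in> span_list vs"
    then obtain cs where "length cs = length vs" "v = lincomb cs vs" by (auto simp: span_list_def)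
    then show False
      using i[unfolded independent_list_def, rule_format, of "1 # map ((*) (- 1)) cs"] by (simp add: lincomb_scale)
  qed
next
  assume i: "independent_list vs \<and> v \<notin> span_list vs"
  show "independent_list (v # vs)"
    unfolding independent_list_def
  proof (intro allI impI)
    fix ds :: "'a list" assume "length ds = length (v # vs)" and z: "lincomb ds (v # vs) = 0"
    then obtain c cs where ds: "ds = c # cs" "length cs = length vs" by (cases ds) auto
    have "c = 0"
    proof (rule ccontr)
      assume c: "c \<noteq> 0"
      have "c *s v = - lincomb cs vs" using z by (simp add: ds eq_neg_iff_add_eq_0)
      then have "inverse c *s (c *s v) = inverse c *s (- lincomb cs vs)" by simp
      then have "v = lincomb (map ((*) (- inverse c)) cs) vs" using c by (simp add: lincomb_scale vector_smult_assoc)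
      then show False using i ds by (auto simp: span_list_def)
    qed
    then show "set ds \<subseteq> {0}" using z i ds by (auto simp: independent_list_def)
  qed
qed

text \<open>An independent list of length \<open>k\<close> extends by any vector outside its span,
  which has \<open>q^k\<close> elements.\<close>

lemma card_independent_lists:
  "finite {vs :: ('a::{field,finite} ^ 'n) list. length vs = k \<and> independent_list vs} \<and>
   int (card {vs :: ('a ^ 'n) list. length vs = k \<and> independent_list vs}) =
     (\<Prod>i<k. int CARD('a ^ 'n) - int CARD('a) ^ i)"
proof (induction k)
  case 0
  have "{vs :: ('a ^ 'n) list. length vs = 0 \<and> independent_list vs} = {[]}"
    by (auto simp: independent_list_def)
  then show ?case by simp
next
  case (Suc k)
  let ?I = "\<lambda>k. {vs :: ('a ^ 'n) list. length vs = k \<and> independent_list vs}"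
  have eq: "?I (Suc k) = (\<lambda>(vs, v). v # vs) ` Sigma (?I k) (\<lambda>vs. - span_list vs)"
  proof (intro equalityI subsetI)
    fix ws assume ws: "ws \<in> ?I (Suc k)"
    then obtain v vs where "ws = v # vs" by (cases ws) auto
    with ws show "ws \<in> (\<lambda>(vs, v). v # vs) ` Sigma (?I k) (\<lambda>vs. - span_list vs)"
      by (auto simp: independent_list_Cons)
  qed (auto simp: independent_list_Cons)
  have c: "int (card (- span_list vs)) = int CARD('a ^ 'n) - int CARD('a) ^ k" if "vs \<in> ?I k" for vs
    using that card_span_list[of vs] card_mono[of UNIV "span_list vs"]
    by (simp add: Compl_eq_Diff_UNIV card_Diff_subset of_nat_diff del: CARD_vec)
  have "card (?I (Suc k)) = card (Sigma (?I k) (\<lambda>vs. - span_list vs))"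
    unfolding eq by (rule card_image) (auto simp: inj_on_def)
  then have "int (card (?I (Suc k))) = (\<Sum>vs\<in>?I k. int (card (- span_list vs)))"
    using Suc by simp
  also have "\<dots> = (\<Sum>vs\<in>?I k. int CARD('a ^ 'n) - int CARD('a) ^ k)"
    by (intro sum.cong refl c)
  finally have "int (card (?I (Suc k))) = int (card (?I k)) * (int CARD('a ^ 'n) - int CARD('a) ^ k)"
    by simp
  moreover have "finite (?I (Suc k))"
    unfolding eq using Suc by auto
  ultimately show ?case using Suc by (simp add: mult.commute del: CARD_vec)
qed

section \<open>From independent columns to matrices of determinant one\<close>

lemma invertible_iff_kernel: "invertible K \<longleftrightarrow> (\<forall>c. K *v c = 0 \<longrightarrow> c = 0)" for K :: "'a::field ^ 'n ^ 'n"
  by (simp add: invertible_left_inverse matrix_left_invertible_ker)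

lemma matrix_vector_columns: "K *v c = c $ I0 *s column I0 K + c $ I1 *s column I1 K + c $ I\<omega> *s column I\<omega> K + c $ I\<omega>' *s column I\<omega>' K"
  for K :: "'a::comm_ring_1 ^ idx ^ idx"
  by (simp add: vec_eq_iff matrix_vector_mult_def sum_idx column_nth mult.commute)

definition vec4 :: "'b \<Rightarrow> 'b \<Rightarrow> 'b \<Rightarrow> 'b \<Rightarrow> 'b ^ idx" where
  "vec4 a b c d = (\<chi> i. case i of I0 \<Rightarrow> a | I1 \<Rightarrow> b | I\<omega> \<Rightarrow> c | I\<omega>' \<Rightarrow> d)"

lemma vec4_nth [simp]: "vec4 a b c d $ I0 = a" "vec4 a b c d $ I1 = b" "vec4 a b c d $ I\<omega> = c" "vec4 a b c d $ I\<omega>' = d"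
  by (simp_all add: vec4_def)

lemma length_4_iff: "length xs = 4 \<longleftrightarrow> (\<exists>a b c d. xs = [a, b, c, d])"
  by (auto simp: eval_nat_numeral length_Suc_conv)

lemma invertible_iff_columns:
  fixes K :: "'a::field ^ idx ^ idx"
  shows "invertible K \<longleftrightarrow> independent_list [column I0 K, column I1 K, column I\<omega> K, column I\<omega>' K]"
proof
  assume K: "invertible K"
  show "independent_list [column I0 K, column I1 K, column I\<omega> K, column I\<omega>' K]"
    unfolding independent_list_def
  proof (intro allI impI)
    fix cs :: "'a list"
    assume "length cs = length [column I0 K, column I1 K, column I\<omega> K, column I\<omega>' K]"
      and z: "lincomb cs [column I0 K, column I1 K, column I\<omega> K, column I\<omega>' K] = 0"
    then obtain a b c d where cs: "cs = [a, b, c, d]" using length_4_iff[of cs] by auto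
    have "K *v vec4 a b c d = 0" using z by (simp add: cs matrix_vector_columns add.assoc)
    then have "vec4 a b c d = 0" using K by (simp add: invertible_iff_kernel)
    then show "set cs \<subseteq> {0}" by (simp add: cs vec_eq_iff all_idx)
  qed
next
  assume i: "independent_list [column I0 K, column I1 K, column I\<omega> K, column I\<omega>' K]"
  show "invertible K"
    unfolding invertible_iff_kernel
  proof (intro allI impI)
    fix c assume "K *v c = 0"
    then have "set [c $ I0, c $ I1, c $ I\<omega>, c $ I\<omega>'] \<subseteq> {0}"
      by (intro i[unfolded independent_list_def, rule_format]) (simp_all add: matrix_vector_columns add.assoc)
    then show "c = 0" by (simp add: vec_eq_iff all_idx)
  qed
qed

lemma card_invertible:
  "int (card {K :: 'a::{field,finite} ^ idx ^ idx. invertible K}) =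
    (int CARD('a) ^ 4 - 1) * (int CARD('a) ^ 4 - int CARD('a)) * (int CARD('a) ^ 4 - int CARD('a) ^ 2) * (int CARD('a) ^ 4 - int CARD('a) ^ 3)"
proof -
  have CARD_idx: "CARD(idx) = 4" by (simp add: UNIV_idx)
  have "bij_betw (\<lambda>K. [column I0 K, column I1 K, column I\<omega> K, column I\<omega>' K]) {K :: 'a ^ idx ^ idx. invertible K}
     {vs. length vs = 4 \<and> independent_list vs}"
  proof (rule bij_betwI[where g = "\<lambda>vs. transpose (vec4 (vs ! 0) (vs ! 1) (vs ! 2) (vs ! 3))"])
    show "(\<lambda>vs. transpose (vec4 (vs ! 0) (vs ! 1) (vs ! 2) (vs ! 3))) \<in> {vs. length vs = 4 \<and> independent_list vs} \<rightarrow> {K :: 'a ^ idx ^ idx. invertible K}"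
      by (auto simp: length_4_iff invertible_iff_columns row_def)
  qed (auto simp: length_4_iff invertible_iff_columns row_def vec_eq_iff all_idx transpose_def column_def)
  then have "card {K :: 'a ^ idx ^ idx. invertible K} = card {vs :: ('a ^ idx) list. length vs = 4 \<and> independent_list vs}"
    by (rule bij_betw_same_card)
  then show ?thesis
    using card_independent_lists[where 'a='a and 'n=idx, of 4]
    by (simp add: CARD_idx eval_nat_numeral mult.assoc)
qed

definition scale_column :: "'a::comm_ring_1 \<Rightarrow> 'a ^ idx ^ idx \<Rightarrow> 'a ^ idx ^ idx" where
  "scale_column t K = (\<chi> i j. if j = I0 then t * K $ i $ j else K $ i $ j)"

lemma matdet4_scale_column: "matdet4 (scale_column t K) = t * matdet4 K"
  by (simp add: matdet4_def det4_def pfaffian_polar_def wedge_def column_nth scale_column_def algebra_simps)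

lemma scale_column_scale_column: "scale_column s (scale_column t K) = scale_column (s * t) K"
  by (simp add: vec_eq_iff scale_column_def mult.assoc)

lemma scale_column_1 [simp]: "scale_column 1 K = K"
  by (simp add: vec_eq_iff scale_column_def)

lemma invertible_scale_column:
  fixes K :: "'a::field ^ idx ^ idx"
  assumes "invertible K" "t \<noteq> 0"
  shows "invertible (scale_column t K)"
  unfolding invertible_iff_kernel
proof (intro allI impI)
  fix c assume "scale_column t K *v c = 0"
  then have "K *v vec4 (t * c $ I0) (c $ I1) (c $ I\<omega>) (c $ I\<omega>') = 0"
    by (simp add: vec_eq_iff matrix_vector_mult_def sum_idx scale_column_def mult_ac)
  then have "vec4 (t * c $ I0) (c $ I1) (c $ I\<omega>) (c $ I\<omega>') = 0"
    using assms(1) by (simp add: invertible_iff_kernel)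
  then show "c = 0" using assms(2) by (simp add: vec_eq_iff all_idx)
qed

text \<open>If \<open>matdet4 K\<close> were 0, \<open>alpha K\<close> would make all pairings
  vanish. But an invertible transpose puts both coordinate bivectors on complementary axes into its
  image, and they pair to 1.\<close>

lemma matdet4_nonzero:
  fixes K :: "'a::field ^ idx ^ idx"
  assumes "invertible K"
  shows "matdet4 K \<noteq> 0"
proof
  assume z: "matdet4 K = 0"
  have "\<exists>v. transpose K *v v = w" for w
  proof
    have "matrix_inv K ** K = mat 1"
      by (simp only: matrix_eq matrix_vector_mul_assoc[symmetric] matrix_inv_cancel(2)[OF assms] matrix_vector_mul_lid simp_thms)
    then have "transpose K ** transpose (matrix_inv K) = mat 1"
      by (simp only: matrix_transpose_mul[symmetric] transpose_mat)
    then show "transpose K *v (transpose (matrix_inv K) *v w) = w"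
      by (simp add: matrix_vector_mul_assoc)
  qed
  then have "\<forall>i. \<exists>v. transpose K *v v = axis i 1" by blast
  then obtain v where v: "transpose K *v v i = axis i 1" for i by metis
  have "pfaffian_polar (wedge (axis I0 1) (axis I1 1)) (wedge (axis I\<omega> 1) (axis I\<omega>' 1)) = (0 :: 'a)"
    using pfaffian_polar_alpha[of K "wedge (v I0) (v I1)" "wedge (v I\<omega>) (v I\<omega>')"] by (simp add: alpha_wedge v z)
  then show False
    by (simp add: pfaffian_polar_def wedge_def axis_nth_eq)
qed

text \<open>Scaling one column by \<open>t\<close> multiplies \<open>matdet4\<close> by
  \<open>t\<close>, so nonzero scalars times \<open>SL4\<close> parametrize the invertible
  matrices.\<close>

lemma card_SL4_mult:
  "(int CARD('a) - 1) * int (card (SL4 :: ('a::{field,finite} ^ idx ^ idx) set)) = int (card {K :: 'a ^ idx ^ idx. invertible K})"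
proof -
  have "bij_betw (\<lambda>(t, K). scale_column t K) ((UNIV - {0 :: 'a}) \<times> SL4) {K. invertible K}"
    by (rule bij_betwI[where g = "\<lambda>K. (matdet4 K, scale_column (inverse (matdet4 K)) K)"])
      (auto simp: SL4_def matdet4_nonzero matdet4_scale_column scale_column_scale_column intro!: invertible_scale_column)
  then have "card ((UNIV - {0 :: 'a}) \<times> (SL4 :: ('a ^ idx ^ idx) set)) = card {K :: 'a ^ idx ^ idx. invertible K}"
    by (rule bij_betw_same_card)
  moreover have "int (card (UNIV - {0 :: 'a})) = int CARD('a) - 1"
    using card_Suc_Diff1[of "UNIV :: 'a set" 0] by simp
  ultimately show ?thesis
    by (metis card_cartesian_product of_nat_mult)
qed

lemma card_SL4:
  "int (card (SL4 :: ('a::{field,finite} ^ idx ^ idx) set)) =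
     int CARD('a) ^ 6 * (int CARD('a) ^ 2 - 1) * (int CARD('a) ^ 3 - 1) * (int CARD('a) ^ 4 - 1)"
proof -
  define q where "q = int CARD('a)"
  have "card {0, 1 :: 'a} \<le> CARD('a)" by (rule card_mono) auto
  then have "q - 1 \<noteq> 0" by (simp add: q_def)
  moreover have "(q - 1) * int (card (SL4 :: ('a ^ idx ^ idx) set)) = (q - 1) * (q^6 * (q^2 - 1) * (q^3 - 1) * (q^4 - 1))"
    using card_SL4_mult[where 'a='a] card_invertible[where 'a='a] unfolding q_def[symmetric]
    by (simp add: eval_nat_numeral algebra_simps)
  ultimately show ?thesis
    unfolding q_def[symmetric] by (metis mult_left_cancel)
qed

theorem mainTheorem3:
  fixes q :: nat
  assumes "primepow q"
    and "CARD('a::{field,finite}) = q"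
  shows "order (F4 :: ('a albert \<Rightarrow> 'a albert) monoid) =
    q ^ 24 * (q ^ 12 - 1) * (q ^ 8 - 1) * (q ^ 6 - 1) * (q ^ 2 - 1)"
proof -
  let ?q = "int q"
  have "q \<ge> 1" using assms(2) by (metis One_nat_def Suc_leI zero_less_card_finite)
  then have p: "int (q ^ n - 1) = ?q ^ n - 1" for n
    by (simp add: of_nat_diff)
  have "order (F4 :: ('a albert \<Rightarrow> 'a albert) monoid) = card (stab_one :: ('a albert \<Rightarrow> 'a albert) set)"
    by (simp add: Coset.order_def F4_def stab_one_def)
  then have "int (order (F4 :: ('a albert \<Rightarrow> 'a albert) monoid)) =
     (?q^16 + ?q^12 + ?q^8) * ((?q^8 + ?q^4) * ((?q^4 - 1) * (?q^3 + 1) * (?q^6 * (?q^6 * (?q^2 - 1) * (?q^3 - 1) * (?q^4 - 1)))))"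
    by (simp add: card_stab_one card_stab_E1 card_primitive_idempotents card_E1_complements card_stab_frame
      card_stab_plus card_stab_pair card_SL4 assms(2))
  \<comment> \<open>The powers of q add up to 8 + 4 + 6 + 6 = 24. One factor \<open>q^4 - 1\<close>
    completes \<open>q^8 + q^4 + 1\<close> to \<open>q^12 - 1\<close>, the other completes
    \<open>q^4 + 1\<close> to \<open>q^8 - 1\<close>, and \<open>q^3 + 1\<close> with
    \<open>q^3 - 1\<close> gives \<open>q^6 - 1\<close>.\<close>
  also have "\<dots> = int (q ^ 24 * (q ^ 12 - 1) * (q ^ 8 - 1) * (q ^ 6 - 1) * (q ^ 2 - 1))"
    unfolding of_nat_mult p of_nat_power by algebra
  finally show ?thesis by (simp only: of_nat_eq_iff)
qed

end
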